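(* Consider the entire function $\mathbb{C}^2\to\mathbb{C}$, $(\alpha,s)\mapsto\varphi_\alpha(s)$. (i) $$\lim_{\alpha\to0}\frac{\varphi_\alpha(s)}{\alpha e^\alpha}=\sum_{n=0}^\infty\frac{(-1)^n}{n+2}\frac{s^n}{n!}=\begin{cases}\dfrac{1-(1+s)e^{-s}}{s^2},&s\ne0,\\[2mm]\dfrac12,&s=0,\end{cases}$$ uniformly for $s$ in compact subsets of $\mathbb{C}$. The limit function has no real zeros but infinitely many complex zeros $s=\xi_k=-W(k,-1/e)-1$, $k\in\mathbb{Z}\setminus\{-1,0\}$, where $W(k,z)$ is the $k$'th branch of the Lambert $W$ function. One has $\xi_1=\overline{\xi_{-2}}\approx2.08884-7.46148\,i$ and $\xi_2=\overline{\xi_{-3}}\approx2.66406-13.87905\,i$. (ii) Given $n\in\mathbb{N}$, $\varphi_\alpha$ has at least $n$ non-real zeros when $|\alpha|$ is sufficiently small ($\alpha\neq0$). (iii) $$\lim_{|\alpha|\to\infty}\frac{\varphi_\alpha(s/\alpha)}{\alpha e^\alpha}=\frac{J_1(\sqrt{2s})}{\sqrt{2s}}$$ uniformly for $s$ in compact subsets of $\mathbb{C}$, where $J_1$ is the Bessel function of order $1$. (iv) Given $n\in\mathbb{N}$, $\varphi_\alpha$ has, for $|\alpha|$ sufficiently large, at least $n$ simple zeros $s_1(\alpha),\ldots,s_n(\alpha)$ such that $0<|s_1(\alpha)|<|s_2(\alpha)|<\cdots<|s_n(\alpha)|$, and they satisfy $$\lim_{|\alpha|\to\infty}\alpha s_k(\alpha)=\frac{j_k^2}{2}\quad\text{for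 all }k\le n,$$ where $0<j_1<j_2<\cdots$ are the positive zeros of $J_1$. If in addition $\alpha>0$, then $s_j(\alpha)>0$ for $j=1,\ldots,n$. (v) For $\alpha>0$, the entire function $\varphi_\alpha$ is of order one and type one.
   Context: For $\alpha\in\mathbb{C}$ let $f_\alpha(z)=e^\alpha-\exp(\alpha z\,\mathrm{Log}(1+1/z))$ for $z\in\mathbb{C}\setminus[-1,0]$, with $\mathrm{Log}$ the principal logarithm; $f_\alpha(z)\to e^\alpha-1$ as $z\to0$ within $\mathbb{C}\setminus]-\infty,0]$. The entire function $\varphi_\alpha$ is defined by $$\varphi_\alpha(s)=\frac{1}{2\pi i}\int_{C(r,c)}f_\alpha(z)e^{sz}\,dz,\quad s\in\mathbb{C},$$ where $c>1$, $r>0$ and $C(r,c)$ is the positively oriented boundary of the rectangle with corners $-c\pm ir$, $\pm ir$ (with $f_\alpha(0):=e^\alpha-1$ on the side $[-ir,ir]$); the value does not depend on $c>1$, $r>0$. The function $J_1(\sqrt{2s})/\sqrt{2s}$ denotes the entire function $\sum_{n\ge0}(-1)^n\frac{s^n}{2^{n+1}n!(n+1)!}$. The branches of the Lambert function satisfy $W(k,z)e^{W(k,z)}=z$, with the standard indexing (Corless, Gonnet, Hare, Jeffrey, Knuth); for $k\in\mathbb{Z}\setminus\{-1,0\}$, $w=W(k,-1/e)$ is the unique solution of $w+\mathrm{Log}\,w=-1+i\pi+2\pi ik$. The symbol $\approx$ indicates decimal approximations with error less than $10^{-5}$ in the real and imaginary parts. Order and type are those of entire functions in the usual sense of growth theory.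 *)

theory Defs
  imports "HOL-Complex_Analysis.Complex_Analysis"
begin

(* For z = 0 the value is the limit of f a z as z tends to 0 off the negative real axis.
   The formula is only meaningful for z outside the segment [-1,0[. *)
definition f_fun :: "complex \<Rightarrow> complex \<Rightarrow> complex" where
  "f_fun \<alpha> z = (if z = 0 then exp \<alpha> - 1 else exp \<alpha> - exp (\<alpha> * z * Ln (1 + 1 / z)))"

(* rectpath takes the lower left and the upper right corner and runs anticlockwise.
   The value does not depend on c > 1 and r > 0. *)
definition phi :: "real \<Rightarrow> real \<Rightarrow> complex \<Rightarrow> complex \<Rightarrow> complex" where
  "phi c r \<alpha> s = 1 / (2 * of_real pi * \<i>) *
     contour_integral (rectpath (Complex (- c) (- r)) (Complex 0 r)) (\<lambda>z. f_fun \<alpha> z * exp (s * z))"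

definition entire2 :: "(complex \<Rightarrow> complex \<Rightarrow> complex) \<Rightarrow> bool" where
  "entire2 F \<longleftrightarrow> (\<forall>p. \<exists>A B. ((\<lambda>(x, y). F x y) has_derivative (\<lambda>(u, v). A * u + B * v)) (at p))"

(* The k-th branch of the Lambert W function, in the indexing of Corless, Gonnet, Hare,
   Jeffrey and Knuth.  Off z = 0 and off the real segment [-1/e,0[ for k = 0, -1, the value
   W k z is the unique solution of w + Log w = Log z + 2 pi i k (Jeffrey, Hare, Corless,
   "Unwinding the branches of the Lambert W function").  On the segment, W 0 and W (-1) are
   the two real branches, with values in [-1,0[ and ]-\<infinity>,-1].  For k \<noteq> 0 the
   function has a logarithmic singularity at 0 and the value there is irrelevant.
   The condition w \<noteq> 0 is needed because Ln 0 = 0 in the library. *)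
definition lambertW :: "int \<Rightarrow> complex \<Rightarrow> complex" where
  "lambertW k z =
     (if k = 0 \<and> z = 0 then 0
      else if k = 0 \<and> z \<in> \<real> \<and> - exp (- 1) \<le> Re z \<and> Re z < 0 then
        (THE w. w \<in> \<real> \<and> - 1 \<le> Re w \<and> w * exp w = z)
      else if k = - 1 \<and> z \<in> \<real> \<and> - exp (- 1) \<le> Re z \<and> Re z < 0 then
        (THE w. w \<in> \<real> \<and> Re w \<le> - 1 \<and> w * exp w = z)
      else (THE w. w \<noteq> 0 \<and> w + Ln w = Ln z + 2 * of_real pi * \<i> * of_int k))"

definition bessel_J :: "nat \<Rightarrow> complex \<Rightarrow> complex" where
  "bessel_J \<nu> z = (\<Sum>n. (- 1) ^ n / (fact n * fact (n + \<nu>)) * (z / 2) ^ (2 * n + \<nu>))"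

(* The entire function J_1(sqrt(2 s)) / sqrt(2 s). *)
definition bessel_quot :: "complex \<Rightarrow> complex" where
  "bessel_quot s = (\<Sum>n. (- 1) ^ n * (s ^ n / (2 ^ (n + 1) * fact n * fact (n + 1))))"

definition simple_zero :: "(complex \<Rightarrow> complex) \<Rightarrow> complex \<Rightarrow> bool" where
  "simple_zero g z \<longleftrightarrow> g z = 0 \<and> deriv g z \<noteq> 0"

definition max_modulus :: "(complex \<Rightarrow> complex) \<Rightarrow> real \<Rightarrow> real" where
  "max_modulus g R = (SUP z\<in>sphere 0 R. norm (g z))"

definition entire_order :: "(complex \<Rightarrow> complex) \<Rightarrow> ereal" where
  "entire_order g = Limsup at_top (\<lambda>R. ereal (ln (ln (max_modulus g R)) / ln R))"

(* The type with respect to the order of g; meant for finite positive order. *)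
definition entire_type :: "(complex \<Rightarrow> complex) \<Rightarrow> ereal" where
  "entire_type g =
     Limsup at_top (\<lambda>R. ereal (ln (max_modulus g R) / R powr real_of_ereal (entire_order g)))"

end

theory Submission
  imports Defs
begin

text \<open>
With \<open>g(z) = z Log (1 + 1/z)\<close> the factor \<open>e^\<alpha>\<close> in \<open>f_\<alpha>\<close> contributes an entire function, so
\<open>\<phi>_\<alpha>(s)\<close> is \<open>-1/(2\<pi>i)\<close> times the integral of \<open>exp (\<alpha> g(z) + s z)\<close>.  The only singularities are
on the cut \<open>[-1,0]\<close>; the rectangle touches it at \<open>0\<close>, where \<open>g\<close> is still continuous from the right half
plane, and can therefore be blown up to a large square (\<open>rectangle_integral_deform\<close>).  On the square
\<open>exp (\<alpha> g(z)) = e^\<alpha> \<Sum> c_n(\<alpha>) (-1/z)^n\<close>, and termwise integration gives the identity behind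
everything else (\<open>phi_sums\<close>):

\<open>\<phi>_\<alpha>(s) = e^\<alpha> \<Sum> (-1)^n c_{n+1}(\<alpha>) s^n / n!\<close>.

Here \<open>\<Sum> c_n(\<alpha>) x^n = exp (\<alpha> (x/2 + x^2/3 + x^3/4 + ...))\<close>.  Hence \<open>c_n\<close> is, for \<open>n \<ge> 1\<close>, a polynomial
in \<open>\<alpha>\<close> with nonnegative coefficients, lowest term \<open>\<alpha>/(n+1)\<close> and highest term \<open>\<alpha>^n/(2^n n!)\<close>, and
the coefficients sum to \<open>c_n(1) \<le> 1\<close>.  Dividing by \<open>\<alpha>\<close>, or by \<open>\<alpha>^n\<close>, isolates the extreme
terms with an error at most \<open>|\<alpha>|\<close>, respectively \<open>1/|\<alpha>|\<close>, uniformly in \<open>n\<close>; this gives the limits for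
\<open>\<alpha> \<rightarrow> 0\<close> and \<open>|\<alpha>| \<rightarrow> \<infinity>\<close> with explicit bounds (\<open>phi_limit_0_bound\<close>, \<open>phi_limit_infinity_bound\<close>).

For small \<open>\<alpha>\<close> the limit vanishes where \<open>e^s = 1 + s\<close>, \<open>s \<noteq> 0\<close>.  Writing \<open>w = -1 - s\<close> these are the
solutions of \<open>w e^w = -1/e\<close> other than \<open>-1\<close>.  Taking logarithms turns the equation into fixed point
problems \<open>w = -1 + (2k+1)\<pi>i - Log w\<close>, whose right-hand side is a contraction of
\<open>{Im w \<ge> \<pi>}\<close> for \<open>k \<ge> 1\<close>; conjugation deals with \<open>k \<le> -2\<close>.  The contraction also turns an approximate
solution into an error bound, which gives the decimals.  All these zeros are non-real, and a
Hurwitz type argument carries \<open>n\<close> of them over to \<open>\<phi>_\<alpha>\<close>.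

For large \<open>\<alpha>\<close> the limit \<open>B(s) = J_1(\<surd>(2s))/\<surd>(2s)\<close> satisfies \<open>s B'' + 2 B' + B/2 = 0\<close>, that is,
\<open>y'' = -y/(2s)\<close> for \<open>y = s B\<close>.  A Sturm comparison yields infinitely many positive zeros
(\<open>bessel_fun_zero_between\<close>) and an energy argument their simplicity (\<open>bessel_fun_simple_zero\<close>).
Simplicity passes to the perturbed zeros because derivatives converge too, and for
\<open>\<alpha> > 0\<close> the sign change at a simple zero produces real zeros.

For the growth with \<open>\<alpha> = a > 0\<close>, all \<open>c_n(a)\<close> are nonnegative, so the maximum modulus is controlled by
the value at \<open>-R\<close>.  The bounds \<open>a/(n+1) \<le> c_n(a) \<le> C q^n\<close>, for every \<open>q > 1\<close>, squeeze it between
\<open>e^R/R^2\<close> and \<open>e^(qR)\<close> up to constants.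
\<close>


section \<open>Coefficients of the expansion at infinity\<close>

text \<open>
The series \<open>x/2 + x^2/3 + x^3/4 + ...\<close>, that is, the expansion of \<open>-log (1 - x)/x - 1\<close>.  It is kept
polymorphic so that its powers can be compared over the reals, where nonnegativity makes sense,
and over the complex numbers.
\<close>
definition log_series :: "'a::real_normed_field fps" where
  "log_series = Abs_fps (\<lambda>n. if n = 0 then 0 else 1 / of_nat (Suc n))"

definition exp_coeff :: "'a::real_normed_field \<Rightarrow> nat \<Rightarrow> 'a" where
  "exp_coeff \<alpha> n = fps_nth (fps_exp \<alpha> oo log_series) n"

lemma log_series_nth: "fps_nth log_series n = (if n = 0 then 0 else 1 / of_nat (Suc n))"
  by (simp add: log_series_def)

lemma log_series_power_nth_of_real:
  "fps_nth (log_series ^ k) n = (of_real (fps_nth (log_series ^ k) n) :: 'a::real_normed_field)"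
proof (induction k arbitrary: n)
  case 0 then show ?case by simp
next
  case (Suc k)
  show ?case unfolding power_Suc fps_mult_nth of_real_sum of_real_mult
    by (intro sum.cong refl arg_cong2[where f = times] Suc) (simp add: log_series_nth)
qed

lemma log_series_power_nth_nonneg: "0 \<le> fps_nth (log_series ^ k :: real fps) n"
  by (induction k arbitrary: n)
     (auto simp: fps_mult_nth log_series_nth intro!: sum_nonneg mult_nonneg_nonneg)

text \<open>
The coefficients are polynomials in \<open>\<alpha>\<close> with nonnegative real coefficients.  The limits for small
and for large \<open>\<alpha>\<close> are read off from this shape.
\<close>
lemma exp_coeff_eq_sum:
  "exp_coeff \<alpha> n = (\<Sum>k\<in>{0..n}. \<alpha> ^ k / fact k * of_real (fps_nth (log_series ^ k) n))"
  unfolding exp_coeff_def fps_compose_nth fps_exp_nth log_series_power_nth_of_real[symmetric] of_nat_fact ..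

lemma exp_coeff_of_real: "exp_coeff (of_real a) n = of_real (exp_coeff a n)"
  by (simp add: exp_coeff_eq_sum)

lemma exp_coeff_nonneg: "0 \<le> a \<Longrightarrow> 0 \<le> exp_coeff (a::real) n"
  by (auto simp: exp_coeff_eq_sum log_series_power_nth_nonneg intro!: sum_nonneg mult_nonneg_nonneg)

text \<open>
Comparing coefficients in \<open>E' = a h' E\<close> for \<open>E = exp (a h)\<close>.
\<close>
lemma exp_coeff_Suc:
  fixes a :: real
  shows "real (Suc n) * exp_coeff a (Suc n) = a * (\<Sum>i=0..n. exp_coeff a i * (real (Suc (n - i)) / real (Suc (Suc (n - i)))))"
proof -
  have "real (Suc n) * exp_coeff a (Suc n) = fps_nth (fps_deriv (fps_exp a oo log_series)) n"
    by (simp add: exp_coeff_def)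
  also have "fps_deriv (fps_exp a oo log_series) = (fps_const a * fps_exp a oo log_series) * fps_deriv log_series"
    by (simp add: fps_compose_deriv log_series_nth fps_exp_deriv)
  also have "\<dots> = fps_const a * ((fps_exp a oo log_series) * fps_deriv log_series)"
    by (simp add: fps_compose_mult_distrib log_series_nth mult.assoc)
  also have "fps_nth \<dots> n = a * fps_nth ((fps_exp a oo log_series) * fps_deriv log_series) n"
    by (rule fps_mult_left_const_nth)
  also have "\<dots> = a * (\<Sum>i=0..n. exp_coeff a i * (real (Suc (n - i)) / real (Suc (Suc (n - i)))))"
    unfolding fps_mult_nth exp_coeff_def fps_deriv_nth by (simp add: log_series_nth)
  finally show ?thesis .
qed

lemma exp_coeff_0 [simp]: "exp_coeff \<alpha> 0 = 1"
  by (simp add: exp_coeff_def)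

lemma exp_coeff_recursion_le:
  fixes a :: real
  assumes "a \<ge> 0"
  shows "real (Suc n) * exp_coeff a (Suc n) \<le> a * (\<Sum>i\<le>n. exp_coeff a i)"
  unfolding exp_coeff_Suc atMost_atLeast0 using assms
  by (intro mult_left_mono sum_mono mult_left_le) (auto simp: exp_coeff_nonneg)

text \<open>
The recursion bounds each coefficient by the average of the preceding ones.
\<close>
lemma exp_coeff_1_le_1: "exp_coeff (1::real) n \<le> 1"
proof (induction n rule: less_induct)
  case (less n)
  show ?case
  proof (cases n)
    case (Suc m)
    have "real (Suc m) * exp_coeff 1 (Suc m) \<le> (\<Sum>i\<le>m. exp_coeff (1::real) i)"
      using exp_coeff_recursion_le[of 1 m] by simp
    also have "\<dots> \<le> (\<Sum>i\<le>m. 1)" using less Suc by (intro sum_mono) auto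
    finally have "real (Suc m) * exp_coeff 1 (Suc m) \<le> real (Suc m) * 1" by simp
    then show ?thesis unfolding Suc by (simp only: mult_le_cancel_left_pos of_nat_0_less_iff zero_less_Suc)
  qed simp
qed

text \<open>
The generating function is analytic in the unit disc, hence growth is slower than any \<open>q^n\<close>.  Directly: if
the bound holds below \<open>n\<close>, the recursion and a geometric sum give it at \<open>n\<close> as soon as
\<open>n \<ge> a/(q - 1)\<close>; the finitely many smaller indices are absorbed in \<open>C\<close>.
\<close>
lemma exp_coeff_geometric_bound:
  fixes a q :: real
  assumes a: "a \<ge> 0" and q: "q > 1"
  shows "\<exists>C>0. \<forall>n. exp_coeff a n \<le> C * q ^ n"
proof -
  obtain N :: nat where N: "a / (q - 1) \<le> real N" using real_arch_simple by blast
  define C where "C = (\<Sum>i\<le>N. exp_coeff a i)"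
  have C1: "C \<ge> 1"
    using member_le_sum[of 0 "{..N}" "exp_coeff a"] a by (simp add: C_def exp_coeff_nonneg)
  have "exp_coeff a n \<le> C * q ^ n" for n
  proof (induction n rule: less_induct)
    case (less n)
    show ?case
    proof (cases "n \<le> N")
      case True
      have "exp_coeff a n * 1 \<le> C * q ^ n"
        using member_le_sum[of n "{..N}" "exp_coeff a"] a True q C1
        by (intro mult_mono) (auto simp: C_def exp_coeff_nonneg intro!: sum_nonneg)
      then show ?thesis by simp
    next
      case False
      then obtain m where m: "n = Suc m" by (cases n) auto
      have "real n * exp_coeff a n \<le> a * (\<Sum>i\<le>m. exp_coeff a i)"
        using exp_coeff_recursion_le[OF a, of m] m by simp
      also have "\<dots> \<le> a * (\<Sum>i<n. C * q ^ i)"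
        using less a by (auto intro!: mult_left_mono sum_mono simp: m lessThan_Suc_atMost)
      also have "\<dots> = a * (C * ((q ^ n - 1) / (q - 1)))"
        using q by (simp add: sum_distrib_left[symmetric] geometric_sum)
      also have "\<dots> \<le> a * (C * (q ^ n / (q - 1)))"
        using a C1 q by (intro mult_left_mono divide_right_mono) auto
      also have "\<dots> = (a / (q - 1)) * (C * q ^ n)" by simp
      also have "\<dots> \<le> real n * (C * q ^ n)"
        using N False C1 q by (intro mult_right_mono) auto
      finally show ?thesis using False by (simp add: mult_le_cancel_left_pos)
    qed
  qed
  then show ?thesis using C1 by (intro exI[of _ C]) auto
qed

lemma exp_coeff_ge: "a \<ge> 0 \<Longrightarrow> exp_coeff (a::real) (Suc n) \<ge> a / real (n + 2)"
  unfolding exp_coeff_eq_sum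
  using member_le_sum[of 1 "{0..Suc n}" "\<lambda>k. a ^ k / fact k * fps_nth (log_series ^ k) (Suc n)"]
  by (simp add: log_series_power_nth_nonneg log_series_nth)

text \<open>
Apart from the term of degree one, every term of the quotient carries a factor of modulus at most
\<open>|\<alpha>|\<close>; what remains are the coefficients of the polynomial, whose sum is its value at 1.
\<close>
lemma exp_coeff_tendsto_0_bound:
  fixes \<alpha> :: complex
  assumes "\<alpha> \<noteq> 0" "norm \<alpha> \<le> 1"
  shows "norm (exp_coeff \<alpha> (Suc n) / \<alpha> - 1 / of_nat (n + 2)) \<le> norm \<alpha>"
proof -
  define b where "b = (\<lambda>k. fps_nth (log_series ^ k :: real fps) (Suc n))"
  have b: "b k \<ge> 0" for k by (simp add: b_def log_series_power_nth_nonneg)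
  have b0: "b 0 = 0" and b1: "b 1 = 1 / (real n + 2)" by (simp_all add: b_def log_series_nth)
  have expand: "exp_coeff \<beta> (Suc n) = (\<Sum>k\<in>{0..Suc n}. \<beta> ^ k / fact k * of_real (b k))"
    for \<beta> :: "'a::real_normed_field"
    by (simp only: exp_coeff_eq_sum b_def)
  have "{0..Suc n} = {0, 1} \<union> {2..Suc n}" by auto
  then have "exp_coeff \<alpha> (Suc n) = (\<Sum>k\<in>{0, 1} \<union> {2..Suc n}. \<alpha> ^ k / fact k * of_real (b k))"
    by (simp only: expand)
  also have "\<dots> = (\<Sum>k\<in>{0, 1}. \<alpha> ^ k / fact k * of_real (b k)) + (\<Sum>k\<in>{2..Suc n}. \<alpha> ^ k / fact k * of_real (b k))"
    by (rule sum.union_disjoint) auto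
  also have "(\<Sum>k\<in>{0, 1}. \<alpha> ^ k / fact k * of_real (b k)) = \<alpha> / of_nat (n + 2)"
    using b0 b1 by simp
  finally have "exp_coeff \<alpha> (Suc n) = \<alpha> / of_nat (n + 2) + (\<Sum>k\<in>{2..Suc n}. \<alpha> ^ k / fact k * of_real (b k))" .
  then have "exp_coeff \<alpha> (Suc n) / \<alpha> - 1 / of_nat (n + 2) = (\<Sum>k\<in>{2..Suc n}. \<alpha> ^ (k - 1) / fact k * of_real (b k))"
    using assms(1) by (simp add: add_divide_distrib sum_divide_distrib power_diff mult.commute del: sum.cl_ivl_Suc)
  also have "norm \<dots> \<le> (\<Sum>k\<in>{2..Suc n}. norm \<alpha> * (1 ^ k / fact k * b k))"
  proof (intro sum_norm_le)
    fix k assume "k \<in> {2..Suc n}"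
    then have "norm \<alpha> ^ (k - 1) \<le> norm \<alpha> ^ 1" using assms(2) by (intro power_decreasing) auto
    then have "norm \<alpha> ^ (k - 1) * (b k / fact k) \<le> norm \<alpha> * (b k / fact k)"
      using b[of k] by (intro mult_right_mono) auto
    then show "norm (\<alpha> ^ (k - 1) / fact k * of_real (b k)) \<le> norm \<alpha> * (1 ^ k / fact k * b k)"
      using b[of k] by (simp add: norm_mult norm_divide norm_power)
  qed
  also have "\<dots> \<le> norm \<alpha> * exp_coeff 1 (Suc n)"
    unfolding expand sum_distrib_left[symmetric]
    using b by (auto intro!: mult_left_mono sum_mono2)
  also have "\<dots> \<le> norm \<alpha>" using exp_coeff_1_le_1[of "Suc n"] by (simp add: mult_left_le)
  finally show ?thesis .
qed

text \<open>
The mirror image of the previous bound: only the leading term survives division by \<open>\<alpha>^(n+1)\<close>, since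
the lower ones lose at least one factor \<open>\<alpha>\<close>.
\<close>
lemma exp_coeff_tendsto_infinity_bound:
  fixes \<alpha> :: complex
  assumes "norm \<alpha> \<ge> 1"
  shows "norm (exp_coeff \<alpha> (Suc n) / \<alpha> ^ Suc n - 1 / (2 ^ Suc n * fact (Suc n))) \<le> 1 / norm \<alpha>"
proof -
  define b where "b = (\<lambda>k. fps_nth (log_series ^ k :: real fps) (Suc n))"
  have b: "b k \<ge> 0" for k by (simp add: b_def log_series_power_nth_nonneg)
  have bn: "b (Suc n) = 1 / 2 ^ Suc n"
    unfolding b_def by (subst startsby_zero_power_nth_same) (auto simp: log_series_nth power_divide)
  have expand: "exp_coeff \<beta> (Suc n) = (\<Sum>k\<in>{0..Suc n}. \<beta> ^ k / fact k * of_real (b k))"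
    for \<beta> :: "'a::real_normed_field"
    by (simp only: exp_coeff_eq_sum b_def)
  have nz: "\<alpha> \<noteq> 0" using assms by auto
  have "exp_coeff \<alpha> (Suc n) = \<alpha> ^ Suc n / fact (Suc n) * of_real (b (Suc n)) + (\<Sum>k\<in>{0..n}. \<alpha> ^ k / fact k * of_real (b k))"
    by (simp only: expand sum.atLeast0_atMost_Suc add.commute)
  then have "exp_coeff \<alpha> (Suc n) / \<alpha> ^ Suc n - 1 / (2 ^ Suc n * fact (Suc n))
      = (\<Sum>k\<in>{0..n}. \<alpha> ^ k / fact k * of_real (b k)) / \<alpha> ^ Suc n"
    using nz by (simp add: bn add_divide_distrib del: fact_Suc power_Suc)
  also have "\<dots> = (\<Sum>k\<in>{0..n}. \<alpha> ^ k / \<alpha> ^ Suc n / fact k * of_real (b k))"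
    by (simp add: sum_divide_distrib mult.commute)
  also have "norm \<dots> \<le> (\<Sum>k\<in>{0..n}. 1 / norm \<alpha> * (1 ^ k / fact k * b k))"
  proof (intro sum_norm_le)
    fix k assume k: "k \<in> {0..n}"
    have "norm \<alpha> ^ k * norm \<alpha> \<le> norm \<alpha> ^ Suc n" 
      using power_increasing[of "Suc k" "Suc n" "norm \<alpha>"] k assms by (simp add: mult.commute)
    then have "norm \<alpha> ^ k / norm \<alpha> ^ Suc n \<le> 1 / norm \<alpha>"
      using nz by (simp add: field_simps)
    then have "norm \<alpha> ^ k / norm \<alpha> ^ Suc n * (b k / fact k) \<le> 1 / norm \<alpha> * (b k / fact k)"
      using b[of k] by (intro mult_right_mono) auto
    then show "norm (\<alpha> ^ k / \<alpha> ^ Suc n / fact k * of_real (b k)) \<le> 1 / norm \<alpha> * (1 ^ k / fact k * b k)"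
      using b[of k] by (simp add: norm_mult norm_divide norm_power)
  qed
  also have "\<dots> \<le> 1 / norm \<alpha> * exp_coeff 1 (Suc n)"
    unfolding expand sum_distrib_left[symmetric]
    using b by (auto intro!: mult_left_mono sum_mono2 divide_right_mono)
  also have "\<dots> \<le> 1 / norm \<alpha>" using exp_coeff_1_le_1[of "Suc n"] nz by (simp add: field_simps)
  finally show ?thesis .
qed


section \<open>Deformation of the contour\<close>

definition zlog :: "complex \<Rightarrow> complex" where "zlog z = z * Ln (1 + 1 / z)"

lemma zlog_0 [simp]: "zlog 0 = 0" by (simp add: zlog_def)

lemma f_fun_eq: "f_fun \<alpha> z = exp \<alpha> - exp (\<alpha> * zlog z)"
  by (simp add: f_fun_def zlog_def mult.assoc)

text \<open>
The argument \<open>1 + 1/z\<close> is a nonpositive real exactly when \<open>z\<close> lies in \<open>[-1,0[\<close>.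
\<close>
lemma zlog_field_differentiable:
  assumes "Im z \<noteq> 0 \<or> Re z < - 1 \<or> Re z > 0"
  shows "zlog field_differentiable at z"
proof -
  have z0: "z \<noteq> 0" using assms by auto
  have "1 + 1 / z \<notin> \<real>\<^sub>\<le>\<^sub>0"
  proof
    assume "1 + 1 / z \<in> \<real>\<^sub>\<le>\<^sub>0"
    then obtain t where t: "t \<le> 0" "1 + 1 / z = of_real t" by (auto elim!: nonpos_Reals_cases)
    then have "1 / z = of_real (t - 1)" by (simp add: algebra_simps)
    then have "z = of_real (1 / (t - 1))" by (metis of_real_divide of_real_1 divide_divide_eq_right div_by_1 mult_1 nonzero_divide_eq_eq z0 times_divide_eq_right)
    then have "Im z = 0" "Re z = 1 / (t - 1)" by simp_all
    moreover have "- 1 \<le> 1 / (t - 1)" "1 / (t - 1) \<le> 0" using t(1) by (simp_all add: field_simps)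
    ultimately show False using assms by auto
  qed
  then have "(Ln \<circ> (\<lambda>z. 1 + 1 / z)) field_differentiable at z"
    using z0 by (intro field_differentiable_compose field_differentiable_at_Ln)
      (auto intro!: derivative_intros)
  then show ?thesis unfolding zlog_def comp_def
    by (intro derivative_intros)
qed

text \<open>
In the right half plane \<open>|1 + 1/z| \<ge> 1\<close>, so the logarithm is at most \<open>log (1 + 1/|z|) + \<pi>\<close>.  With
\<open>x = 1/|z|\<close>, the inequality \<open>1 + x \<le> (1 + \<surd>x)^2\<close> bounds this by \<open>2\<surd>x + \<pi>\<close>; multiplied by \<open>|z|\<close> it
tends to 0 at the origin.
\<close>
lemma norm_zlog_le:
  assumes "Re z \<ge> 0"
  shows "norm (zlog z) \<le> 2 * sqrt (norm z) + pi * norm z"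
proof (cases "z = 0")
  case False
  define u where "u = 1 + 1 / z"
  define x where "x = 1 / norm z"
  have x: "x > 0" using False by (simp add: x_def)
  have "Re (1 / z) \<ge> 0" using assms by (simp add: Re_divide)
  then have "Re u \<ge> 1" by (simp add: u_def)
  then have u1: "norm u \<ge> 1" using complex_Re_le_cmod[of u] by linarith
  then have u0: "u \<noteq> 0" by auto
  have "norm u \<le> 1 + x" unfolding u_def x_def by (metis norm_triangle_ineq norm_one norm_divide)
  also have "\<dots> \<le> (1 + sqrt x)\<^sup>2" using x by (simp add: power2_sum)
  finally have "ln (norm u) \<le> ln ((1 + sqrt x)\<^sup>2)" using u1 by (intro ln_mono) auto
  also have "\<dots> = 2 * ln (1 + sqrt x)" using x by (simp add: ln_realpow add_pos_nonneg)
  also have "\<dots> \<le> 2 * sqrt x" using ln_add_one_self_le_self[of "sqrt x"] x by simp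
  finally have "ln (norm u) \<le> 2 * sqrt x" .
  moreover have "\<bar>Im (Ln u)\<bar> \<le> pi" using Im_Ln_le_pi[OF u0] mpi_less_Im_Ln[OF u0] by simp
  moreover have "norm (Ln u) \<le> \<bar>ln (norm u)\<bar> + \<bar>Im (Ln u)\<bar>"
    using cmod_le[of "Ln u"] u0 by simp
  ultimately have "norm (Ln u) \<le> 2 * sqrt x + pi" using u1 by simp
  then have "norm z * norm (Ln u) \<le> norm z * (2 * sqrt x + pi)" by (intro mult_left_mono) auto
  also have "norm z * sqrt x = sqrt (norm z)" using False 
    by (simp add: x_def real_sqrt_divide real_div_sqrt)
  then have "norm z * (2 * sqrt x + pi) = 2 * sqrt (norm z) + pi * norm z" by (simp add: algebra_simps)
  finally show ?thesis by (simp add: zlog_def u_def norm_mult)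
qed simp

lemma continuous_on_zlog_right: "continuous_on {z. Re z \<ge> 0} zlog"
  unfolding continuous_on_eq_continuous_within
proof
  fix z assume z: "z \<in> {z. Re z \<ge> 0}"
  show "continuous (at z within {z. Re z \<ge> 0}) zlog"
  proof (cases "z = 0")
    case False
    then have "Im z \<noteq> 0 \<or> Re z < - 1 \<or> Re z > 0" using z by (auto simp: complex_eq_iff)
    then show ?thesis
      using zlog_field_differentiable field_differentiable_imp_continuous_at continuous_at_imp_continuous_at_within by blast
  next
    case True
    have "(zlog \<longlongrightarrow> 0) (at 0 within {z. Re z \<ge> 0})"
    proof (rule Lim_null_comparison)
      show "\<forall>\<^sub>F z in at 0 within {z. Re z \<ge> 0}. norm (zlog z) \<le> 2 * sqrt (norm z) + pi * norm z"
        using norm_zlog_le by (auto simp: eventually_at_filter)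
      show "((\<lambda>z. 2 * sqrt (norm z) + pi * norm z) \<longlongrightarrow> 0) (at (0::complex) within {z. Re z \<ge> 0})"
        by (auto intro!: tendsto_eq_intros)
    qed
    then show ?thesis using True by (simp add: continuous_within)
  qed
qed

definition phi_integrand :: "complex \<Rightarrow> complex \<Rightarrow> complex \<Rightarrow> complex" where
  "phi_integrand \<alpha> s z = exp (\<alpha> * zlog z + s * z)"

text \<open>
Cauchy's theorem needs differentiability only in the interior of a convex set, provided the function is
continuous on the whole set.  This is what allows corners and edges of the contour to touch the cut at
\<open>0\<close>.
\<close>
lemma quadrilateral_integral_zero:
  assumes cont: "continuous_on H f" and conv: "convex H"
    and diff: "\<And>z. z \<in> interior H \<Longrightarrow> f field_differentiable at z"
    and abcd: "a \<in> H" "b \<in> H" "c \<in> H" "d \<in> H"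
  shows "contour_integral (linepath a b) f + contour_integral (linepath b c) f
       + contour_integral (linepath c d) f + contour_integral (linepath d a) f = 0"
proof -
  have seg: "closed_segment x y \<subseteq> H" if "x \<in> H" "y \<in> H" for x y
    using that conv by (simp add: closed_segment_subset)
  have int: "f contour_integrable_on linepath x y" if "x \<in> H" "y \<in> H" for x y
    using cont seg[OF that] by (intro contour_integrable_continuous_linepath) (rule continuous_on_subset)
  define p where "p = linepath a b +++ linepath b c +++ linepath c d +++ linepath d a"
  have "path_image p \<subseteq> H" unfolding p_def using abcd seg
    by (simp add: path_image_join)
  then have "(f has_contour_integral 0) p"
    by (intro Cauchy_theorem_convex[OF cont conv, of "{}"] diff) (auto simp: p_def)
  then have "contour_integral p f = 0" by (rule contour_integral_unique)
  then show ?thesis unfolding p_def using abcd int by (simp add: add.assoc)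
qed

lemma
  assumes "continuous_on (path_image (rectpath a1 a3)) f"
  shows contour_integrable_rectpath: "f contour_integrable_on rectpath a1 a3"
    and contour_integral_rectpath_eq: "contour_integral (rectpath a1 a3) f =
     contour_integral (linepath a1 (Complex (Re a3) (Im a1))) f +
     contour_integral (linepath (Complex (Re a3) (Im a1)) a3) f +
     contour_integral (linepath a3 (Complex (Re a1) (Im a3))) f +
     contour_integral (linepath (Complex (Re a1) (Im a3)) a1) f"
proof -
  define a2 a4 where "a2 = Complex (Re a3) (Im a1)" and "a4 = Complex (Re a1) (Im a3)"
  have p: "rectpath a1 a3 = linepath a1 a2 +++ linepath a2 a3 +++ linepath a3 a4 +++ linepath a4 a1"
    by (simp add: rectpath_def Let_def a2_def a4_def)
  have int: "f contour_integrable_on linepath x y"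
    if "closed_segment x y \<subseteq> path_image (rectpath a1 a3)" for x y
    by (rule contour_integrable_continuous_linepath) (rule continuous_on_subset[OF assms that])
  have sub: "closed_segment a1 a2 \<subseteq> path_image (rectpath a1 a3)" "closed_segment a2 a3 \<subseteq> path_image (rectpath a1 a3)"
    "closed_segment a3 a4 \<subseteq> path_image (rectpath a1 a3)" "closed_segment a4 a1 \<subseteq> path_image (rectpath a1 a3)"
    by (auto simp: p path_image_join)
  note ints = sub[THEN int]
  show "f contour_integrable_on rectpath a1 a3"
    unfolding p by (intro contour_integrable_joinI ints valid_path_join valid_path_linepath) simp_all
  show "contour_integral (rectpath a1 a3) f =
     contour_integral (linepath a1 (Complex (Re a3) (Im a1))) f +
     contour_integral (linepath (Complex (Re a3) (Im a1)) a3) f +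
     contour_integral (linepath a3 (Complex (Re a1) (Im a3))) f +
     contour_integral (linepath (Complex (Re a1) (Im a3)) a1) f"
    unfolding p a2_def[symmetric] a4_def[symmetric]
    by (simp only: contour_integral_join contour_integrable_joinI ints valid_path_join
        valid_path_linepath pathfinish_linepath pathstart_linepath pathstart_join add.assoc)
qed

lemma interior_Re_ge_0: "interior {z. Re z \<ge> 0} = {z. Re z > 0}"
  using interior_halfspace_ge[of "1::complex" 0] by (simp add: inner_complex_def)

lemma phi_integrand_differentiable:
  assumes "Im z \<noteq> 0 \<or> Re z < - 1 \<or> Re z > 0"
  shows "phi_integrand \<alpha> s field_differentiable at z"
proof -
  have "(exp \<circ> (\<lambda>z. \<alpha> * zlog z + s * z)) field_differentiable at z"
    by (intro field_differentiable_compose field_differentiable_within_exp derivative_intros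
        zlog_field_differentiable assms)
  moreover have "exp \<circ> (\<lambda>z. \<alpha> * zlog z + s * z) = phi_integrand \<alpha> s" by (simp add: fun_eq_iff phi_integrand_def)
  ultimately show ?thesis by (simp only:)
qed

lemma continuous_on_zlog:
  assumes "\<forall>z\<in>S. Im z \<noteq> 0 \<or> Re z < - 1 \<or> Re z > 0"
  shows "continuous_on S zlog"
  using assms zlog_field_differentiable
  by (meson continuous_at_imp_continuous_on field_differentiable_imp_continuous_at)

lemma continuous_on_phi_integrand: "continuous_on S zlog \<Longrightarrow> continuous_on S (phi_integrand \<alpha> s)"
  unfolding phi_integrand_def by (intro continuous_intros)

lemma continuous_on_zlog_rect:
  assumes "a > 1" "b \<ge> 0" "r > 0"
  shows "continuous_on (path_image (rectpath (Complex (- a) (- r)) (Complex b r))) zlog"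
proof -
  have "path_image (rectpath (Complex (- a) (- r)) (Complex b r)) \<subseteq> 
      {z. Im z \<le> - r} \<union> {z. Re z \<ge> 0} \<union> {z. Im z \<ge> r} \<union> {z. Re z \<le> - a}"
    using assms by (subst path_image_rectpath) auto
  moreover have "continuous_on ({z. Im z \<le> - r} \<union> {z. Re z \<ge> 0} \<union> {z. Im z \<ge> r} \<union> {z. Re z \<le> - a}) zlog"
    using assms
    by (intro continuous_on_closed_Un closed_Un continuous_on_zlog_right)
       (auto intro!: continuous_on_zlog closed_Collect_le continuous_intros)
  ultimately show ?thesis by (rule continuous_on_subset[rotated])
qed

text \<open>
The region between the rectangle and the square is cut along the four segments joining corresponding corners.
The four resulting quadrilaterals lie in the half planes \<open>Im z \<le> -r\<close>, \<open>Re z \<ge> 0\<close>, \<open>Im z \<ge> r\<close> and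
\<open>Re z \<le> -c\<close>, none of which contains a point of the cut except \<open>0\<close> on the boundary of the second.
\<close>
lemma rectangle_integral_deform:
  assumes "c > 1" "r > 0" "R \<ge> 0" "R \<ge> r" "R \<ge> c"
  shows "contour_integral (rectpath (Complex (- c) (- r)) (Complex 0 r)) (phi_integrand \<alpha> s) =
         contour_integral (rectpath (Complex (- R) (- R)) (Complex R R)) (phi_integrand \<alpha> s)"
proof -
  define I where "I = (\<lambda>a b. contour_integral (linepath a b) (phi_integrand \<alpha> s))"
  define A B C D where "A = Complex (- c) (- r)" and "B = Complex 0 (- r)" and "C = Complex 0 r" and "D = Complex (- c) r"
  define P Q S T where "P = Complex (- R) (- R)" and "Q = Complex R (- R)" and "S = Complex R R" and "T = Complex (- R) R"
  note defs = A_def B_def C_def D_def P_def Q_def S_def T_def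
  have H1: "continuous_on {z. Im z \<le> - r} (phi_integrand \<alpha> s)" and H2: "continuous_on {z. Re z \<ge> 0} (phi_integrand \<alpha> s)"
    and H3: "continuous_on {z. Im z \<ge> r} (phi_integrand \<alpha> s)" and H4: "continuous_on {z. Re z \<le> - c} (phi_integrand \<alpha> s)"
    using assms by (auto intro!: continuous_on_phi_integrand continuous_on_zlog_right continuous_on_zlog)
  have int: "z \<in> interior H \<Longrightarrow> z \<in> H" for z :: complex and H
    using interior_subset by blast
  have 1: "I A B + I B Q + I Q P + I P A = 0"
    unfolding I_def using assms
    by - (rule quadrilateral_integral_zero[OF H1 convex_halfspace_Im_le];
          (rule phi_integrand_differentiable, drule int)?; simp add: defs)
  have 2: "I B C + I C S + I S Q + I Q B = 0"
    unfolding I_def using assms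
    by - (rule quadrilateral_integral_zero[OF H2 convex_halfspace_Re_ge];
          (rule phi_integrand_differentiable)?; simp add: defs interior_Re_ge_0)
  have 3: "I C D + I D T + I T S + I S C = 0"
    unfolding I_def using assms
    by - (rule quadrilateral_integral_zero[OF H3 convex_halfspace_Im_ge];
          (rule phi_integrand_differentiable, drule int)?; simp add: defs)
  have d4: "phi_integrand \<alpha> s field_differentiable at z" if "z \<in> interior {z. Re z \<le> - c}" for z
  proof (rule phi_integrand_differentiable)
    have "Re z \<le> - c" using int[OF that] by simp
    with assms(1) have "Re z < - 1" by linarith
    then show "Im z \<noteq> 0 \<or> Re z < - 1 \<or> Re z > 0" by blast
  qed
  have "D \<in> {z. Re z \<le> - c}" "A \<in> {z. Re z \<le> - c}" "P \<in> {z. Re z \<le> - c}" "T \<in> {z. Re z \<le> - c}"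
    using assms(5) by (simp_all add: defs)
  then have 4: "I D A + I A P + I P T + I T D = 0"
    unfolding I_def by (intro quadrilateral_integral_zero[OF H4 convex_halfspace_Re_le] d4)
  have rev: "I y x = - I x y" if "x \<in> H" "y \<in> H" "convex H" "continuous_on H (phi_integrand \<alpha> s)" for x y H
    unfolding I_def
    by (rule contour_integral_reverse_linepath, rule continuous_on_subset[OF that(4)],
        rule closed_segment_subset) (use that in auto)
  have r1: "I Q B = - I B Q" "I P A = - I A P" "I Q P = - I P Q"
    using assms by - (rule rev[OF _ _ convex_halfspace_Im_le H1]; simp add: defs)+
  have r2: "I S C = - I C S" "I S Q = - I Q S"
    using assms by - (rule rev[OF _ _ convex_halfspace_Re_ge H2]; simp add: defs)+
  have r3: "I T D = - I D T" "I T S = - I S T"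
    using assms by - (rule rev[OF _ _ convex_halfspace_Im_ge H3]; simp add: defs)+
  have r4: "I P T = - I T P"
    using assms by - (rule rev[OF _ _ convex_halfspace_Re_le H4]; simp add: defs)+
  have "I A B + I B C + I C D + I D A - (I P Q + I Q S + I S T + I T P)
      = (I A B + I B Q + I Q P + I P A) + (I B C + I C S + I S Q + I Q B)
      + (I C D + I D T + I T S + I S C) + (I D A + I A P + I P T + I T D)"
    unfolding r1 r2 r3 r4 by simp
  then have "I A B + I B C + I C D + I D A = I P Q + I Q S + I S T + I T P"
    unfolding 1 2 3 4 by simp
  moreover have "contour_integral (rectpath A C) (phi_integrand \<alpha> s) = I A B + I B C + I C D + I D A"
    unfolding I_def using assms continuous_on_zlog_rect[of c 0 r]
    by (subst contour_integral_rectpath_eq) (auto intro!: continuous_on_phi_integrand simp: defs)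
  moreover have "contour_integral (rectpath P S) (phi_integrand \<alpha> s) = I P Q + I Q S + I S T + I T P"
    unfolding I_def using assms continuous_on_zlog_rect[of R R R]
    by (subst contour_integral_rectpath_eq) (auto intro!: continuous_on_phi_integrand simp: defs)
  ultimately show ?thesis by (simp add: defs)
qed

text \<open>
The summand \<open>e^\<alpha> e^(sz)\<close> of the original integrand is entire and integrates to 0.
\<close>
lemma phi_eq_phi_integrand:
  assumes "c > 1" "r > 0"
  shows "phi c r \<alpha> s = - 1 / (2 * of_real pi * \<i>) *
     contour_integral (rectpath (Complex (- c) (- r)) (Complex 0 r)) (phi_integrand \<alpha> s)"
proof -
  define p where "p = rectpath (Complex (- c) (- r)) (Complex 0 r)"
  have cont: "continuous_on (path_image p) (phi_integrand \<alpha> s)"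
    unfolding p_def using assms by (intro continuous_on_phi_integrand continuous_on_zlog_rect) auto
  have int: "phi_integrand \<alpha> s contour_integrable_on p"
    using cont unfolding p_def by (rule contour_integrable_rectpath)
  have 0: "((\<lambda>z. exp \<alpha> * exp (s * z)) has_contour_integral 0) p"
  proof (rule Cauchy_theorem_convex_simple[of _ UNIV])
    show "(\<lambda>z. exp \<alpha> * exp (s * z)) holomorphic_on UNIV" by (intro holomorphic_intros)
  qed (simp_all add: p_def)
  have eq: "(\<lambda>z. f_fun \<alpha> z * exp (s * z)) = (\<lambda>z. exp \<alpha> * exp (s * z) - phi_integrand \<alpha> s z)"
    by (rule ext) (simp add: f_fun_eq phi_integrand_def exp_add algebra_simps)
  have ci: "contour_integral p (\<lambda>z. exp \<alpha> * exp (s * z) - phi_integrand \<alpha> s z) = 0 - contour_integral p (phi_integrand \<alpha> s)"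
    by (rule contour_integral_unique[OF has_contour_integral_diff[OF 0 has_contour_integral_integral[OF int]]])
  show ?thesis unfolding phi_def p_def[symmetric] eq ci by (metis diff_0 minus_divide_left mult_minus_left mult_minus_right)
qed


section \<open>The power series of the transform and its analyticity\<close>

definition log_tail :: "complex \<Rightarrow> complex" where
  "log_tail x = (if x = 0 then 0 else - Ln (1 - x) / x - 1)"

lemma zlog_eq_log_tail: "z \<noteq> 0 \<Longrightarrow> zlog z = 1 + log_tail (- 1 / z)"
  by (simp add: zlog_def log_tail_def)

lemma log_tail_sums:
  assumes "norm x < 1"
  shows "(\<lambda>n. fps_nth log_series n * x ^ n) sums log_tail x"
proof (cases "x = 0")
  case True
  have "(\<lambda>n. fps_nth log_series n * (0::complex) ^ n) = (\<lambda>n. 0)"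
    by (auto simp: fun_eq_iff log_series_nth)
  then show ?thesis using True by (simp add: log_tail_def)
next
  case False
  have "(\<lambda>n. - (x ^ n) / of_nat n) sums Ln (1 - x)"
    using Ln_series'[of "- x"] assms by simp
  then have "(\<lambda>n. - (x ^ Suc n) / of_nat (Suc n)) sums Ln (1 - x)"
    by (subst sums_Suc_iff) simp
  then have "(\<lambda>n. - (x ^ Suc n) / of_nat (Suc n) * (- 1 / x)) sums (Ln (1 - x) * (- 1 / x))"
    by (rule sums_mult2)
  also have "(\<lambda>n. - (x ^ Suc n) / of_nat (Suc n) * (- 1 / x)) = (\<lambda>n. x ^ n / of_nat (Suc n))"
    using False by (auto simp: fun_eq_iff)
  finally have "(\<lambda>n. x ^ n / of_nat (Suc n)) sums (Ln (1 - x) * (- 1 / x))" .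
  moreover have "(\<lambda>n. if n = 0 then 1 else 0) sums (1::complex)" by (rule sums_single)
  ultimately have "(\<lambda>n. x ^ n / of_nat (Suc n) - (if n = 0 then 1 else 0)) sums (Ln (1 - x) * (- 1 / x) - 1)"
    by (rule sums_diff)
  moreover have "(\<lambda>n. x ^ n / of_nat (Suc n) - (if n = 0 then 1 else 0)) = (\<lambda>n. fps_nth log_series n * x ^ n)"
    by (auto simp: fun_eq_iff log_series_nth)
  ultimately show ?thesis using False by (simp add: log_tail_def)
qed

lemma log_tail_has_fps_expansion: "log_tail has_fps_expansion log_series"
proof -
  have "conv_radius (fps_nth (log_series :: complex fps)) \<ge> 1"
  proof (rule conv_radius_geI_ex)
    fix r :: real assume r: "0 < r" "ereal r < 1"
    then have "norm (of_real r :: complex) < 1" by simp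
    then have "summable (\<lambda>n. fps_nth log_series n * (of_real r :: complex) ^ n)"
      using log_tail_sums sums_summable by blast
    then show "\<exists>z::complex. norm z = r \<and> summable (\<lambda>n. fps_nth log_series n * z ^ n)"
      using r by (intro exI[of _ "of_real r"]) auto
  qed
  then have "fps_conv_radius (log_series :: complex fps) > 0"
    unfolding fps_conv_radius_def by (rule less_le_trans[rotated]) simp
  moreover have "eventually (\<lambda>x. eval_fps log_series x = log_tail x) (nhds 0)"
    unfolding eventually_nhds_metric eval_fps_def
    using log_tail_sums sums_unique by (intro exI[of _ 1]) (auto simp: sums_iff)
  ultimately show ?thesis by (simp add: has_fps_expansion_def)
qed

text \<open>
Only some positive radius is claimed: the square around the origin may be chosen as large as necessary,
depending on \<open>\<alpha>\<close>.
\<close>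
lemma exp_log_tail_sums:
  "\<exists>y>0. summable (\<lambda>n. norm (exp_coeff \<alpha> n * of_real y ^ n)) \<and>
     (\<forall>x. norm x \<le> y \<longrightarrow> (\<lambda>n. exp_coeff \<alpha> n * x ^ n) sums exp (\<alpha> * log_tail x))"
proof -
  have "((\<lambda>x. exp (\<alpha> * x)) \<circ> log_tail) has_fps_expansion (fps_exp \<alpha> oo log_series)"
    by (intro has_fps_expansion_compose has_fps_expansion_exp log_tail_has_fps_expansion) (simp add: log_series_nth)
  then have rad: "fps_conv_radius (fps_exp \<alpha> oo log_series) > 0"
    and ev: "eventually (\<lambda>x. eval_fps (fps_exp \<alpha> oo log_series) x = exp (\<alpha> * log_tail x)) (nhds 0)"
    by (auto simp: has_fps_expansion_def)
  from ev obtain d where d: "d > 0" "\<And>x. norm x < d \<Longrightarrow> eval_fps (fps_exp \<alpha> oo log_series) x = exp (\<alpha> * log_tail x)"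
    unfolding eventually_nhds_metric by auto
  have "ereal 0 < min (ereal d) (fps_conv_radius (fps_exp \<alpha> oo log_series))"
    using rad d(1) by (simp add: zero_ereal_def)
  then obtain y where y: "0 < y" "ereal y < min (ereal d) (fps_conv_radius (fps_exp \<alpha> oo log_series))"
    using ereal_dense2 by (metis less_ereal.simps(1))
  show ?thesis
  proof (intro exI[of _ y] conjI allI impI y(1))
    have "ereal (norm (of_real y :: complex)) < conv_radius (fps_nth (fps_exp \<alpha> oo log_series))"
      using y by (simp add: fps_conv_radius_def)
    then show "summable (\<lambda>n. norm (exp_coeff \<alpha> n * of_real y ^ n))"
      unfolding exp_coeff_def by (rule abs_summable_in_conv_radius)
    fix x :: complex assume x: "norm x \<le> y"
    then have "ereal (norm x) < fps_conv_radius (fps_exp \<alpha> oo log_series)"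
      using y(2) by (metis ereal_less_eq(3) min_less_iff_conj order_le_less_trans)
    then have "(\<lambda>n. exp_coeff \<alpha> n * x ^ n) sums eval_fps (fps_exp \<alpha> oo log_series) x"
      unfolding exp_coeff_def by (rule sums_eval_fps)
    also have "eval_fps (fps_exp \<alpha> oo log_series) x = exp (\<alpha> * log_tail x)"
      using y(2) x by (intro d(2)) auto
    finally show "(\<lambda>n. exp_coeff \<alpha> n * x ^ n) sums exp (\<alpha> * log_tail x)" .
  qed
qed

lemma path_image_square:
  assumes "R > 0"
  shows "z \<in> path_image (rectpath (Complex (- R) (- R)) (Complex R R)) \<Longrightarrow> R \<le> norm z"
  using assms abs_Re_le_cmod[of z] abs_Im_le_cmod[of z]
  by (subst (asm) path_image_rectpath) auto

text \<open>
The residue of \<open>e^(sz)/z^(m+1)\<close> at 0.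
\<close>
lemma square_integral_exp_over_power:
  assumes "R > 0"
  shows "contour_integral (rectpath (Complex (- R) (- R)) (Complex R R)) (\<lambda>z. exp (s * z) / z ^ n)
       = (case n of 0 \<Rightarrow> 0 | Suc m \<Rightarrow> 2 * of_real pi * \<i> * (s ^ m / fact m))"
proof (cases n)
  case 0
  have "((\<lambda>z. exp (s * z)) has_contour_integral 0) (rectpath (Complex (- R) (- R)) (Complex R R))"
  proof (rule Cauchy_theorem_convex_simple[of _ UNIV])
    show "(\<lambda>z. exp (s * z)) holomorphic_on UNIV" by (intro holomorphic_intros)
  qed simp_all
  then show ?thesis using 0 by (simp add: contour_integral_unique)
next
  case (Suc m)
  let ?p = "rectpath (Complex (- R) (- R)) (Complex R R)"
  have "contour_integral ?p (\<lambda>z. exp (s * z) / z ^ Suc m)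
      = 2 * pi * \<i> * (\<Sum>p\<in>{0}. winding_number ?p p * residue (\<lambda>z. exp (s * z) / z ^ Suc m) p)"
  proof (rule Residue_theorem[of UNIV])
    show "(\<lambda>z. exp (s * z) / z ^ Suc m) holomorphic_on UNIV - {0}" by (intro holomorphic_intros) auto
    show "path_image ?p \<subseteq> UNIV - {0}" using path_image_square[OF assms] assms by fastforce
  qed (simp_all add: convex_connected)
  moreover have "winding_number ?p 0 = 1"
    using assms by (intro winding_number_rectpath) (simp add: in_box_complex_iff)
  moreover have "residue (\<lambda>z. exp (s * z) / z ^ Suc m) 0 = s ^ m / fact m"
    using residue_fps_expansion_over_power_at_0[OF has_fps_expansion_exp[of s], of m] by simp
  ultimately show ?thesis using Suc by simp
qed

text \<open>
The expansion at infinity is integrated term by term over a square on which \<open>|1/z| \<le> y\<close>, where the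
Weierstrass test applies.
\<close>
theorem phi_sums:
  assumes "c > 1" "r > 0"
  shows "(\<lambda>n. exp \<alpha> * (- 1) ^ n * exp_coeff \<alpha> (Suc n) * (s ^ n / fact n)) sums phi c r \<alpha> s"
proof -
  obtain y where y: "y > 0" "summable (\<lambda>n. norm (exp_coeff \<alpha> n * of_real y ^ n))"
    and sums: "\<And>x. norm x \<le> y \<Longrightarrow> (\<lambda>n. exp_coeff \<alpha> n * x ^ n) sums exp (\<alpha> * log_tail x)"
    using exp_log_tail_sums[of \<alpha>] by blast
  \<comment> \<open>the square must enclose the rectangle and stay where the expansion at infinity converges\<close>
  define R where "R = Max {1 / y, c, r}"
  have R: "R \<ge> 1 / y" "R \<ge> c" "R \<ge> r" by (simp_all add: R_def)
  have R0: "R > 0" "R > 1" using R assms by linarith+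
  define a1 a2 a3 a4 where "a1 = Complex (- R) (- R)" and "a2 = Complex R (- R)"
    and "a3 = Complex R R" and "a4 = Complex (- R) R"
  define p where "p = rectpath a1 a3"
  define f where "f = (\<lambda>n z. exp \<alpha> * exp_coeff \<alpha> n * (- 1) ^ n * (exp (s * z) / z ^ n))"
  have nz: "R \<le> norm z" if "z \<in> path_image p" for z
    using that path_image_square[OF R0(1)] by (simp add: p_def a1_def a3_def)
  have contf: "continuous_on (path_image p) (f n)" for n
    unfolding f_def using nz R0 by (intro continuous_intros) force
  have contF: "continuous_on (path_image p) (phi_integrand \<alpha> s)"
    unfolding p_def a1_def a3_def using R0 by (intro continuous_on_phi_integrand continuous_on_zlog_rect) auto
  have "compact ((\<lambda>z. exp (s * z)) ` path_image p)"
    by (intro compact_continuous_image continuous_intros compact_path_image) (auto simp: p_def intro: valid_path_imp_path)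
  then obtain B where "\<forall>w\<in>(\<lambda>z. exp (s * z)) ` path_image p. norm w \<le> B"
    using compact_imp_bounded bounded_iff by metis
  then have B: "norm (exp (s * z)) \<le> B" if "z \<in> path_image p" for z using that by blast
  have fsums: "(\<lambda>n. f n z) sums phi_integrand \<alpha> s z" if z: "z \<in> path_image p" for z
  proof -
    have z0: "z \<noteq> 0" using nz[OF z] R0 by auto
    have "norm (- 1 / z) \<le> 1 / R" using nz[OF z] R0 by (simp add: norm_divide frac_le)
    also have "\<dots> \<le> y" using R(1) R0 y(1) by (simp add: field_simps)
    finally have "(\<lambda>n. exp_coeff \<alpha> n * (- 1 / z) ^ n) sums exp (\<alpha> * log_tail (- 1 / z))" by (rule sums)
    then have "(\<lambda>n. exp \<alpha> * exp (s * z) * (exp_coeff \<alpha> n * (- 1 / z) ^ n)) sums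
        (exp \<alpha> * exp (s * z) * exp (\<alpha> * log_tail (- 1 / z)))" by (rule sums_mult)
    moreover have "exp \<alpha> * exp (s * z) * exp (\<alpha> * log_tail (- 1 / z)) = phi_integrand \<alpha> s z"
      unfolding phi_integrand_def zlog_eq_log_tail[OF z0] by (simp add: exp_add algebra_simps)
    moreover have "exp \<alpha> * exp (s * z) * (exp_coeff \<alpha> n * (- 1 / z) ^ n) = f n z" for n
      unfolding f_def power_divide by simp
    ultimately show ?thesis by simp
  qed
  have "uniform_limit (path_image p) (\<lambda>N z. \<Sum>n<N. f n z) (\<lambda>z. \<Sum>n. f n z) sequentially"
  proof (rule Weierstrass_m_test)
    fix n z assume z: "z \<in> path_image p"
    have z0: "norm z > 0" using nz[OF z] R0 by auto
    have "1 / norm z \<le> 1 / R" using nz[OF z] R0 by (simp add: frac_le)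
    also have "\<dots> \<le> y" using R(1) R0 y(1) by (simp add: field_simps)
    finally have "(1 / norm z) ^ n \<le> y ^ n" by (intro power_mono) auto
    then have "norm (exp (s * z)) * (1 / norm z) ^ n \<le> B * y ^ n"
      using B[OF z] order_trans[OF norm_ge_zero B[OF z]] by (intro mult_mono) auto
    then have "norm (exp \<alpha> * exp_coeff \<alpha> n) * (norm (exp (s * z)) * (1 / norm z) ^ n) \<le> norm (exp \<alpha> * exp_coeff \<alpha> n) * (B * y ^ n)"
      by (intro mult_left_mono) auto
    then show "norm (f n z) \<le> norm (exp \<alpha>) * B * norm (exp_coeff \<alpha> n * of_real y ^ n)"
      using y(1) unfolding f_def by (simp add: norm_mult norm_divide norm_power power_divide mult_ac)
  next
    show "summable (\<lambda>n. norm (exp \<alpha>) * B * norm (exp_coeff \<alpha> n * of_real y ^ n))"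
      by (intro summable_mult y)
  qed
  then have ul: "uniform_limit (path_image p) (\<lambda>N z. \<Sum>n<N. f n z) (phi_integrand \<alpha> s) sequentially"
    by (rule uniform_limit_cong'[THEN iffD1, rotated -1]) (use fsums in \<open>auto simp: sums_iff\<close>)
  have lim: "(\<lambda>N. contour_integral (linepath a b) (\<lambda>z. \<Sum>n<N. f n z)) \<longlonglongrightarrow> contour_integral (linepath a b) (phi_integrand \<alpha> s)"
    if "closed_segment a b \<subseteq> path_image p" for a b
  proof (rule contour_integral_uniform_limit(2)[where B = "norm (b - a)"])
    show "\<forall>\<^sub>F N in sequentially. (\<lambda>z. \<Sum>n<N. f n z) contour_integrable_on linepath a b"
      by (intro always_eventually allI contour_integrable_continuous_linepath continuous_on_subset[OF _ that]
          continuous_on_sum contf)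
    show "uniform_limit (path_image (linepath a b)) (\<lambda>N z. \<Sum>n<N. f n z) (phi_integrand \<alpha> s) sequentially"
      using ul that by (simp add: uniform_limit_on_subset)
  qed auto
  have seg: "closed_segment a1 a2 \<subseteq> path_image p" "closed_segment a2 a3 \<subseteq> path_image p"
    "closed_segment a3 a4 \<subseteq> path_image p" "closed_segment a4 a1 \<subseteq> path_image p"
    unfolding p_def rectpath_def Let_def a1_def a2_def a3_def a4_def by (auto simp: path_image_join)
  have split: "contour_integral p G = contour_integral (linepath a1 a2) G + contour_integral (linepath a2 a3) G
      + contour_integral (linepath a3 a4) G + contour_integral (linepath a4 a1) G"
    if "continuous_on (path_image p) G" for G
    using contour_integral_rectpath_eq[OF that[unfolded p_def]] unfolding p_def 
    by (simp add: a1_def a2_def a3_def a4_def)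
  have "(\<lambda>N. contour_integral p (\<lambda>z. \<Sum>n<N. f n z)) \<longlonglongrightarrow> contour_integral p (phi_integrand \<alpha> s)"
    unfolding split[OF contF] split[OF continuous_on_sum[OF contf]]
    by (intro tendsto_add lim seg)
  moreover have "contour_integral p (\<lambda>z. \<Sum>n<N. f n z) = (\<Sum>n<N. contour_integral p (f n))" for N
    by (intro contour_integral_unique has_contour_integral_sum has_contour_integral_integral)
       (use contf contour_integrable_rectpath p_def in auto)
  ultimately have "(\<lambda>n. contour_integral p (f n)) sums contour_integral p (phi_integrand \<alpha> s)"
    by (simp add: sums_def)
  moreover have "contour_integral p (f n) = exp \<alpha> * exp_coeff \<alpha> n * (- 1) ^ n *
      (case n of 0 \<Rightarrow> 0 | Suc m \<Rightarrow> 2 * of_real pi * \<i> * (s ^ m / fact m))" for n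
  proof -
    have "continuous_on (path_image p) (\<lambda>z. exp (s * z) / z ^ n)"
      using nz R0 by (intro continuous_intros) force
    then have "(\<lambda>z. exp (s * z) / z ^ n) contour_integrable_on p"
      unfolding p_def by (rule contour_integrable_rectpath)
    then have "contour_integral p (f n) = exp \<alpha> * exp_coeff \<alpha> n * (- 1) ^ n * contour_integral p (\<lambda>z. exp (s * z) / z ^ n)"
      unfolding f_def by (rule contour_integral_lmul)
    then show ?thesis
      using square_integral_exp_over_power[OF R0(1), of s n] by (simp add: p_def a1_def a3_def)
  qed
  moreover define k where "k = (\<lambda>n. exp \<alpha> * exp_coeff \<alpha> n * (- 1) ^ n *
      (case n of 0 \<Rightarrow> 0 | Suc m \<Rightarrow> 2 * of_real pi * \<i> * (s ^ m / fact m)))"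
  ultimately have "k sums contour_integral p (phi_integrand \<alpha> s)" by simp
  moreover have "k 0 = 0" by (simp add: k_def)
  ultimately have "(\<lambda>n. k (Suc n)) sums contour_integral p (phi_integrand \<alpha> s)"
    using sums_Suc_iff[of k "contour_integral p (phi_integrand \<alpha> s)"] by simp
  then have "(\<lambda>n. exp \<alpha> * exp_coeff \<alpha> (Suc n) * (- 1) ^ Suc n * (2 * of_real pi * \<i> * (s ^ n / fact n)))
      sums contour_integral p (phi_integrand \<alpha> s)"
    by (simp only: k_def nat.case)
  then have "(\<lambda>n. - 1 / (2 * of_real pi * \<i>) *
        (exp \<alpha> * exp_coeff \<alpha> (Suc n) * (- 1) ^ Suc n * (2 * of_real pi * \<i> * (s ^ n / fact n))))
      sums (- 1 / (2 * of_real pi * \<i>) * contour_integral p (phi_integrand \<alpha> s))"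
    by (rule sums_mult)
  moreover have "- 1 / (2 * of_real pi * \<i>) * contour_integral p (phi_integrand \<alpha> s) = phi c r \<alpha> s"
    using rectangle_integral_deform[of c r R \<alpha> s] R R0 assms
    by (simp add: phi_eq_phi_integrand p_def a1_def a3_def)
  ultimately show ?thesis by (simp add: mult_ac)
qed

text \<open>
Differentiation under the integral sign in both parameters at once.  The derivative is complex linear because
the derivative of the integrand is.
\<close>
lemma exp_integral_has_derivative:
  fixes G Z W :: "real \<Rightarrow> complex"
  assumes "continuous_on {0..1} G" "continuous_on {0..1} Z" "continuous_on {0..1} W"
  shows "\<exists>A B. ((\<lambda>p. integral {0..1} (\<lambda>t. exp (fst p * G t + snd p * Z t) * W t))
           has_derivative (\<lambda>h. A * fst h + B * snd h)) (at p0)"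
proof -
  define E where "E = (\<lambda>p t. exp (fst p * G t + snd p * Z t) * W t)"
  define fx :: "complex \<times> complex \<Rightarrow> real \<Rightarrow> (complex \<times> complex) \<Rightarrow>\<^sub>L complex" where
    "fx = (\<lambda>p t. (blinfun_mult_right (E p t * G t) o\<^sub>L fst_blinfun) + (blinfun_mult_right (E p t * Z t) o\<^sub>L snd_blinfun))"
  have fx_apply: "blinfun_apply (fx p t) h = E p t * G t * fst h + E p t * Z t * snd h" for p t h
    by (simp add: fx_def blinfun.add_left)
  have contE: "continuous_on (UNIV \<times> {0..1}) (\<lambda>(p, t). E p t)"
    unfolding E_def split_beta
    by (intro continuous_intros continuous_on_compose2[OF assms(1)] continuous_on_compose2[OF assms(2)]
        continuous_on_compose2[OF assms(3)]) auto
  have contEp: "continuous_on {0..1} (E p)" for p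
    unfolding E_def by (intro continuous_intros assms)
  have contfx: "continuous_on (UNIV \<times> {0..1}) (\<lambda>(p, t). fx p t)"
    using contE unfolding fx_def split_beta
    by (intro continuous_intros continuous_on_compose2[OF assms(1)] continuous_on_compose2[OF assms(2)]) auto
  have contfxp: "continuous_on {0..1} (fx p0)"
    unfolding fx_def by (intro continuous_intros contEp assms)
  have "((\<lambda>p. integral (cbox 0 1) (E p)) has_derivative blinfun_apply (integral (cbox 0 1) (fx p0))) (at p0 within UNIV)"
  proof (rule leibniz_rule)
    show "((\<lambda>p. E p t) has_derivative blinfun_apply (fx p t)) (at p within UNIV)" for p t
    proof -
      have "((\<lambda>p. fst p * G t + snd p * Z t) has_derivative (\<lambda>h. fst h * G t + snd h * Z t)) (at p)"
        by (auto intro!: derivative_eq_intros)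
      then have "((\<lambda>p. exp (fst p * G t + snd p * Z t)) has_derivative
          (\<lambda>h. exp (fst p * G t + snd p * Z t) * (fst h * G t + snd h * Z t))) (at p)"
        by (rule has_derivative_compose) (rule DERIV_exp[unfolded has_field_derivative_def])
      then have "((\<lambda>p. exp (fst p * G t + snd p * Z t) * W t) has_derivative
          (\<lambda>h. exp (fst p * G t + snd p * Z t) * (fst h * G t + snd h * Z t) * W t)) (at p)"
        by (rule has_derivative_mult_left)
      moreover have "(\<lambda>h. exp (fst p * G t + snd p * Z t) * (fst h * G t + snd h * Z t) * W t) = blinfun_apply (fx p t)"
        by (rule ext) (simp add: fx_apply E_def algebra_simps)
      ultimately show ?thesis by (simp add: E_def)
    qed
    show "E p integrable_on cbox 0 1" for p
      using contEp by (simp add: integrable_continuous_real)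
    show "continuous_on (UNIV \<times> cbox 0 1) (\<lambda>(x, t). fx x t)"
      using contfx by simp
  qed auto
  moreover have "blinfun_apply (integral (cbox 0 1) (fx p0)) h
      = integral {0..1} (\<lambda>t. E p0 t * G t) * fst h + integral {0..1} (\<lambda>t. E p0 t * Z t) * snd h" for h
  proof -
    have "blinfun_apply (integral (cbox 0 1) (fx p0)) h = integral {0..1} (\<lambda>t. blinfun_apply (fx p0 t) h)"
      using integral_linear[OF integrable_continuous_real[OF contfxp] blinfun.bounded_linear_left, of h]
      by (simp add: comp_def)
    also have "\<dots> = integral {0..1} (\<lambda>t. E p0 t * G t * fst h) + integral {0..1} (\<lambda>t. E p0 t * Z t * snd h)"
      unfolding fx_apply
      by (intro integral_add integrable_continuous_real continuous_intros contEp assms)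
    also have "\<dots> = integral {0..1} (\<lambda>t. E p0 t * G t) * fst h + integral {0..1} (\<lambda>t. E p0 t * Z t) * snd h"
      by (simp only: integral_mult_left)
    finally show ?thesis .
  qed
  then have "blinfun_apply (integral (cbox 0 1) (fx p0))
      = (\<lambda>h. integral {0..1} (\<lambda>t. E p0 t * G t) * fst h + integral {0..1} (\<lambda>t. E p0 t * Z t) * snd h)"
    by (rule ext)
  ultimately have "((\<lambda>p. integral {0..1} (E p)) has_derivative
      (\<lambda>h. integral {0..1} (\<lambda>t. E p0 t * G t) * fst h + integral {0..1} (\<lambda>t. E p0 t * Z t) * snd h)) (at p0)"
    by (simp only: box_real)
  then show ?thesis unfolding E_def by (intro exI)
qed

theorem entire2_phi:
  assumes "c > 1" "r > 0"
  shows "entire2 (phi c r)"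
  unfolding entire2_def
proof
  fix p0 :: "complex \<times> complex"
  define b1 b2 b3 b4 where "b1 = Complex (- c) (- r)" and "b2 = Complex 0 (- r)"
    and "b3 = Complex 0 r" and "b4 = Complex (- c) r"
  define P where "P = path_image (rectpath b1 b3)"
  have contg: "continuous_on P zlog"
    unfolding P_def b1_def b3_def using assms by (intro continuous_on_zlog_rect) auto
  have seg: "closed_segment b1 b2 \<subseteq> P" "closed_segment b2 b3 \<subseteq> P" "closed_segment b3 b4 \<subseteq> P" "closed_segment b4 b1 \<subseteq> P"
    unfolding P_def rectpath_def Let_def b1_def b2_def b3_def b4_def by (auto simp: path_image_join)
  have D: "\<exists>A B. ((\<lambda>p. contour_integral (linepath a b) (phi_integrand (fst p) (snd p)))
           has_derivative (\<lambda>h. A * fst h + B * snd h)) (at p0)" if "closed_segment a b \<subseteq> P" for a b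
  proof -
    have "linepath a b ` {0..1} \<subseteq> P" using that by (simp add: linepath_image_01)
    then have "continuous_on {0..1} (\<lambda>t. zlog (linepath a b t))"
      by (intro continuous_on_compose2[OF contg] continuous_on_linepath)
    then have "\<exists>A B. ((\<lambda>p. integral {0..1} (\<lambda>t. exp (fst p * zlog (linepath a b t) + snd p * linepath a b t) * (b - a)))
           has_derivative (\<lambda>h. A * fst h + B * snd h)) (at p0)"
      by (intro exp_integral_has_derivative continuous_on_linepath continuous_on_const)
    moreover have "contour_integral (linepath a b) (phi_integrand (fst p) (snd p)) =
       integral {0..1} (\<lambda>t. exp (fst p * zlog (linepath a b t) + snd p * linepath a b t) * (b - a))" for p
      by (simp add: contour_integral_integral phi_integrand_def)
    ultimately show ?thesis by simp
  qed
  obtain A1 B1 A2 B2 A3 B3 A4 B4 where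
    D1: "((\<lambda>p. contour_integral (linepath b1 b2) (phi_integrand (fst p) (snd p))) has_derivative (\<lambda>h. A1 * fst h + B1 * snd h)) (at p0)" and
    D2: "((\<lambda>p. contour_integral (linepath b2 b3) (phi_integrand (fst p) (snd p))) has_derivative (\<lambda>h. A2 * fst h + B2 * snd h)) (at p0)" and
    D3: "((\<lambda>p. contour_integral (linepath b3 b4) (phi_integrand (fst p) (snd p))) has_derivative (\<lambda>h. A3 * fst h + B3 * snd h)) (at p0)" and
    D4: "((\<lambda>p. contour_integral (linepath b4 b1) (phi_integrand (fst p) (snd p))) has_derivative (\<lambda>h. A4 * fst h + B4 * snd h)) (at p0)"
    using seg[THEN D] by blast
  define k where "k = - 1 / (2 * of_real pi * \<i>)"
  have phi: "(\<lambda>(x, y). phi c r x y) = (\<lambda>p. k * (contour_integral (linepath b1 b2) (phi_integrand (fst p) (snd p))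
      + contour_integral (linepath b2 b3) (phi_integrand (fst p) (snd p))
      + contour_integral (linepath b3 b4) (phi_integrand (fst p) (snd p))
      + contour_integral (linepath b4 b1) (phi_integrand (fst p) (snd p))))"
  proof (rule ext, clarify)
    fix x y
    have "contour_integral (rectpath b1 b3) (phi_integrand x y) = contour_integral (linepath b1 b2) (phi_integrand x y)
      + contour_integral (linepath b2 b3) (phi_integrand x y)
      + contour_integral (linepath b3 b4) (phi_integrand x y)
      + contour_integral (linepath b4 b1) (phi_integrand x y)"
      using contour_integral_rectpath_eq[OF continuous_on_phi_integrand[OF contg[unfolded P_def]]]
      by (simp add: b1_def b2_def b3_def b4_def)
    then show "phi c r x y = k * (contour_integral (linepath b1 b2) (phi_integrand (fst (x, y)) (snd (x, y)))
      + contour_integral (linepath b2 b3) (phi_integrand (fst (x, y)) (snd (x, y)))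
      + contour_integral (linepath b3 b4) (phi_integrand (fst (x, y)) (snd (x, y)))
      + contour_integral (linepath b4 b1) (phi_integrand (fst (x, y)) (snd (x, y))))"
      unfolding phi_eq_phi_integrand[OF assms] k_def b1_def b3_def by simp
  qed
  have "((\<lambda>(x, y). phi c r x y) has_derivative (\<lambda>h. k * ((A1 * fst h + B1 * snd h) + (A2 * fst h + B2 * snd h)
      + (A3 * fst h + B3 * snd h) + (A4 * fst h + B4 * snd h)))) (at p0)"
    unfolding phi by (intro has_derivative_mult_right has_derivative_add D1 D2 D3 D4)
  moreover have "(\<lambda>h. k * ((A1 * fst h + B1 * snd h) + (A2 * fst h + B2 * snd h)
      + (A3 * fst h + B3 * snd h) + (A4 * fst h + B4 * snd h)))
    = (\<lambda>(u, v). (k * (A1 + A2 + A3 + A4)) * u + (k * (B1 + B2 + B3 + B4)) * v)"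
    by (auto simp: fun_eq_iff algebra_simps)
  ultimately have "((\<lambda>(x, y). phi c r x y) has_derivative
      (\<lambda>(u, v). (k * (A1 + A2 + A3 + A4)) * u + (k * (B1 + B2 + B3 + B4)) * v)) (at p0)"
    by (simp only:)
  then show "\<exists>A B. ((\<lambda>(x, y). phi c r x y) has_derivative (\<lambda>(u, v). A * u + B * v)) (at p0)"
    by (intro exI)
qed


section \<open>Roots of the exponential equation and the Lambert function\<close>

text \<open>
The derivative \<open>1/z\<close> is at most \<open>1/m\<close> in the half plane.  With \<open>m = \<pi>\<close> this makes the iteration below a
contraction.
\<close>
lemma norm_Ln_diff_le:
  assumes "m > 0" "Im z \<ge> m" "Im w \<ge> m"
  shows "norm (Ln z - Ln w) \<le> norm (z - w) / m"
proof -
  have "norm (Ln z - Ln w) \<le> (1 / m) * norm (z - w)"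
  proof (rule field_differentiable_bound[where S = "{z. Im z \<ge> m}"])
    show "convex {z. Im z \<ge> m}" by (rule convex_halfspace_Im_ge)
    fix u assume "u \<in> {z. Im z \<ge> m}"
    then have u: "Im u \<ge> m" by simp
    then have "u \<notin> \<real>\<^sub>\<le>\<^sub>0" using \<open>m > 0\<close> by (auto simp: complex_nonpos_Reals_iff)
    then show "(Ln has_field_derivative inverse u) (at u within {z. Im z \<ge> m})"
      by (rule has_field_derivative_Ln[THEN has_field_derivative_at_within])
    have "m \<le> norm u" using u abs_Im_le_cmod[of u] by linarith
    then show "norm (inverse u) \<le> 1 / m"
      using \<open>m > 0\<close> by (simp add: norm_inverse le_imp_inverse_le flip: inverse_eq_divide)
  qed (use assms in auto)
  then show ?thesis by simp
qed

lemma Ln_minus_inverse_e: "Ln (- 1 / exp 1) = - 1 + \<i> * of_real pi"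
proof -
  have "exp (- 1 + \<i> * of_real pi) = exp (-1) * exp (\<i> * of_real pi :: complex)"
    by (simp only: exp_add)
  also have "\<dots> = (- 1 / exp 1 :: complex)"
    by (simp add: exp_minus field_simps)
  finally show ?thesis
    using Ln_exp[of "- 1 + \<i> * of_real pi"] pi_gt_zero by simp
qed

text \<open>
For \<open>k\<close> other than \<open>-1\<close> and \<open>0\<close>, the equation that defines the branch \<open>k\<close> of the Lambert function at
\<open>-1/e\<close>, with \<open>Log (-1/e) + 2\<pi>ik\<close> in
Cartesian form.
\<close>
definition W_branch :: "int \<Rightarrow> complex \<Rightarrow> bool" where
  "W_branch k w \<longleftrightarrow> w \<noteq> 0 \<and> w + Ln w = Complex (- 1) ((2 * of_int k + 1) * pi)"

lemma W_branch_Im: "W_branch k w \<Longrightarrow> Im w + Im (Ln w) = (2 * of_int k + 1) * pi"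
  unfolding W_branch_def by (metis complex.sel(2) plus_complex.simps(2))

lemma W_branch_Im_ge:
  assumes "k \<ge> 1" "W_branch k w"
  shows "Im w \<ge> 2 * pi"
proof -
  have "w \<noteq> 0" using assms by (simp add: W_branch_def)
  then have "Im (Ln w) \<le> pi" by (rule Im_Ln_le_pi)
  moreover have "3 * pi \<le> (2 * of_int k + 1) * pi" using assms(1) by (intro mult_right_mono) auto
  ultimately show ?thesis using W_branch_Im[OF assms(2)] by linarith
qed

text \<open>
The map \<open>w \<mapsto> -1 + (2k+1)\<pi>i - Log w\<close> lowers the imaginary part \<open>(2k+1)\<pi> \<ge> 3\<pi>\<close> by at most
\<open>\<pi>\<close>.  So it maps \<open>{Im w \<ge> \<pi>}\<close> into itself, every solution lies there, and Banach's fixed point theorem gives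
existence and uniqueness simultaneously.
\<close>
lemma W_branch_ex1:
  assumes "k \<ge> 1"
  shows "\<exists>!w. W_branch k w"
proof -
  define H where "H = {z. Im z \<ge> pi}"
  define T where "T = (\<lambda>w. Complex (- 1) ((2 * of_int k + 1) * pi) - Ln w)"
  have "\<exists>!w\<in>H. T w = w"
  proof (rule Banach_fix)
    show "complete H" unfolding H_def
      by (intro closed_Collect_le[THEN complete_eq_closed[THEN iffD2]] continuous_intros)
    show "H \<noteq> {}" unfolding H_def by (auto intro!: exI[of _ "Complex 0 pi"])
    show "0 \<le> 1 / pi" "1 / pi < 1" using pi_gt3 by auto
    show "T ` H \<subseteq> H"
    proof
      fix x assume "x \<in> T ` H"
      then obtain w where w: "w \<in> H" "x = T w" by auto
      then have "w \<noteq> 0" unfolding H_def using pi_gt_zero by (metis (lifting) mem_Collect_eq not_le zero_complex.simps(2))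
      then have "Im (Ln w) \<le> pi" by (rule Im_Ln_le_pi)
      moreover have "3 * pi \<le> (2 * of_int k + 1) * pi" using assms(1) by (intro mult_right_mono) auto
      ultimately have "pi \<le> (2 * of_int k + 1) * pi - Im (Ln w)" using pi_gt_zero by linarith
      then show "x \<in> H" by (simp add: H_def T_def w)
    qed
    show "dist (T x) (T y) \<le> 1 / pi * dist x y" if "x \<in> H" "y \<in> H" for x y
      using norm_Ln_diff_le[of pi y x] that unfolding T_def H_def dist_norm
      by (simp add: norm_minus_commute)
  qed
  moreover have "w \<in> H \<and> T w = w \<longleftrightarrow> W_branch k w" for w
  proof
    assume A: "w \<in> H \<and> T w = w"
    then have "w \<noteq> 0" unfolding H_def using pi_gt_zero by (metis (lifting) mem_Collect_eq not_le zero_complex.simps(2))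
    with A show "W_branch k w" unfolding W_branch_def T_def by (metis diff_add_cancel)
  next
    assume W: "W_branch k w"
    then have "Im w \<ge> 2 * pi" using assms by (rule W_branch_Im_ge[rotated])
    then have "w \<in> H" using pi_gt_zero unfolding H_def by (simp del: pi_gt_zero)
    moreover have "T w = w" using W unfolding T_def W_branch_def by (metis add_diff_cancel_right')
    ultimately show "w \<in> H \<and> T w = w" ..
  qed
  ultimately show ?thesis by simp
qed

text \<open>
Conjugation commutes with the principal logarithm off the negative axis.  A solution on that axis has
\<open>Im (Log w) = \<pi>\<close> and \<open>Im w = 0\<close>, which forces \<open>k = 0\<close>.
\<close>
lemma W_branch_cnj:
  assumes "k \<notin> {- 1, 0}" "W_branch k w"
  shows "W_branch (- k - 1) (cnj w)"
proof -
  have "w \<notin> \<real>\<^sub>\<le>\<^sub>0"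
  proof
    assume "w \<in> \<real>\<^sub>\<le>\<^sub>0"
    with assms(2) have "Im w = 0" "Re w < 0"
      by (auto simp: complex_nonpos_Reals_iff W_branch_def complex_eq_iff)
    then have "Im (Ln w) = pi"
      using W_branch_def assms(2) by (simp add: Im_Ln_eq_pi)
    then have "pi = (2 * of_int k + 1) * pi" using W_branch_Im[OF assms(2)] \<open>Im w = 0\<close> by simp
    then have "real_of_int (2 * k + 1) = real_of_int 1" by simp
    then have "2 * k + 1 = 1" by (simp only: of_int_eq_iff)
    with assms(1) show False by simp
  qed
  then have "cnj w + Ln (cnj w) = cnj (w + Ln w)" by (simp add: cnj_Ln)
  also have "\<dots> = cnj (Complex (- 1) ((2 * of_int k + 1) * pi))"
    using assms(2) by (simp add: W_branch_def)
  also have "\<dots> = Complex (- 1) ((2 * of_int (- k - 1) + 1) * pi)"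
    by (simp add: complex_eq_iff algebra_simps)
  finally show ?thesis using assms(2) by (simp add: W_branch_def)
qed

lemma W_branch_ex1':
  assumes "k \<notin> {- 1, 0}"
  shows "\<exists>!w. W_branch k w"
proof (cases "k \<ge> 1")
  case True then show ?thesis by (rule W_branch_ex1)
next
  case False
  with assms have "- k - 1 \<ge> 1" and *: "- k - 1 \<notin> {- 1, 0}" by auto
  then have ex: "\<exists>!w. W_branch (- k - 1) w" by (intro W_branch_ex1)
  then obtain w where w: "W_branch (- k - 1) w" by blast
  show ?thesis
  proof
    show "W_branch k (cnj w)" using W_branch_cnj[OF * w] by simp
    show "v = cnj w" if "W_branch k v" for v
      using ex w W_branch_cnj[OF assms that] by (metis complex_cnj_cnj)
  qed
qed

lemma lambertW_branch:
  assumes "k \<notin> {- 1, 0}"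
  shows "W_branch k (lambertW k (- 1 / exp 1))"
    and "W_branch k w \<Longrightarrow> lambertW k (- 1 / exp 1) = w"
proof -
  have eq: "- 1 + \<i> * of_real pi + 2 * of_real pi * \<i> * of_int k
      = Complex (- 1) ((2 * of_int k + 1) * pi)"
    by (simp add: complex_eq_iff algebra_simps)
  have "lambertW k (- 1 / exp 1) = (THE w. w \<noteq> 0 \<and>
      w + Ln w = Ln (- 1 / exp 1) + 2 * of_real pi * \<i> * of_int k)"
    using assms by (simp add: lambertW_def)
  then have lam: "lambertW k (- 1 / exp 1) = (THE w. W_branch k w)"
    by (simp only: Ln_minus_inverse_e eq W_branch_def)
  show "W_branch k (lambertW k (- 1 / exp 1))"
    unfolding lam by (rule theI'[OF W_branch_ex1'[OF assms]])
  show "lambertW k (- 1 / exp 1) = w" if "W_branch k w"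
    unfolding lam using W_branch_ex1'[OF assms] that by (rule the1_equality)
qed

lemma lambertW_cnj:
  assumes "k \<notin> {- 1, 0}"
  shows "lambertW (- k - 1) (- 1 / exp 1) = cnj (lambertW k (- 1 / exp 1))"
  using assms by (intro lambertW_branch(2) W_branch_cnj lambertW_branch(1)) auto

text \<open>
The difference \<open>sin v - v cos v\<close> vanishes at 0 and has derivative \<open>v sin v\<close>.
\<close>
lemma mult_cos_less_sin:
  fixes v :: real
  assumes "0 < v" "v < pi"
  shows "v * cos v < sin v"
proof -
  have "sin 0 - 0 * cos 0 < sin v - v * cos v"
  proof (rule DERIV_pos_imp_increasing_open[OF assms(1)])
    fix x assume x: "0 < x" "x < v"
    show "\<exists>y. ((\<lambda>v. sin v - v * cos v) has_real_derivative y) (at x) \<and> 0 < y"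
    proof (intro exI conjI)
      show "((\<lambda>v. sin v - v * cos v) has_real_derivative x * sin x) (at x)"
        by (auto intro!: derivative_eq_intros)
      show "0 < x * sin x" using x assms by (simp add: sin_gt_zero)
    qed
  qed (intro continuous_intros)
  then show ?thesis by simp
qed

text \<open>
Let \<open>s = u + iv\<close> with \<open>0 < v < \<pi>\<close>; the case of negative \<open>v\<close> follows by conjugation.  From
\<open>e^u sin v = v \<ge> sin v\<close> one gets \<open>u \<ge> 0\<close>; eliminating \<open>e^u\<close> gives
\<open>v cos v = (1 + u) sin v \<ge> sin v\<close>, which contradicts the preceding lemma.
\<close>
lemma exp_eq_one_plus_real_strip:
  assumes "exp s = 1 + s" "\<bar>Im s\<bar> < pi"
  shows "Im s = 0"
proof -
  have False if s: "exp s = 1 + s" "0 < Im s" "Im s < pi" for s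
  proof -
    define u v where "u = Re s" and "v = Im s"
    have c: "exp u * cos v = 1 + u" and d: "exp u * sin v = v"
      using arg_cong[OF s(1), of Re] arg_cong[OF s(1), of Im] by (simp_all add: Re_exp Im_exp u_def v_def)
    have v: "0 < v" "v < pi" using s v_def by auto
    then have sv: "0 < sin v" by (simp add: sin_gt_zero)
    have "sin v \<le> v" using v by (intro sin_x_le_x) auto
    then have "1 * sin v \<le> exp u * sin v" using d by simp
    then have "1 \<le> exp u" using sv mult_le_cancel_right by fastforce
    then have u: "0 \<le> u" by simp
    have "exp u * (v * cos v) = exp u * (sin v * (1 + u))"
      using c d by (metis mult.assoc mult.commute)
    then have "v * cos v = sin v * (1 + u)" by simp
    also have "\<dots> \<ge> sin v" using sv u by (simp add: algebra_simps)
    finally show False using mult_cos_less_sin[OF v] by simp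
  qed
  from this[of s] this[of "cnj s"] show ?thesis
    using assms by (cases "Im s" "0::real" rule: linorder_cases) (auto simp flip: exp_cnj)
qed

lemma exp_eq_one_plus_real:
  assumes "exp s = 1 + s" "Im s = 0"
  shows "s = 0"
proof -
  from assms have "of_real (exp (Re s)) = (of_real (1 + Re s) :: complex)"
    by (metis complex_is_Real_iff of_real_Re of_real_1 of_real_add exp_of_real)
  then have *: "exp (Re s) = 1 + Re s" by (simp only: of_real_eq_iff)
  have "Re s = 0"
    using ln_eq_minus_one[of "exp (Re s)"] * by (metis add_diff_cancel_left' exp_gt_zero ln_exp exp_eq_one_iff)
  with assms(2) show ?thesis by (simp add: complex_eq_iff)
qed

text \<open>
With \<open>w = -1 - s\<close> the equation becomes \<open>w e^w = -1/e\<close>, whose logarithm is the branch equation for some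
\<open>k\<close>.  For \<open>k = 0\<close> and \<open>k = -1\<close> the imaginary parts would give \<open>|Im s| < \<pi>\<close>, where the only solution is
\<open>s = 0\<close>.
\<close>
lemma exp_eq_one_plus_iff_lambertW:
  "exp s = 1 + s \<and> s \<noteq> 0 \<longleftrightarrow> s \<in> (\<lambda>k. - lambertW k (- 1 / exp 1) - 1) ` (UNIV - {- 1, 0})"
proof
  assume A: "exp s = 1 + s \<and> s \<noteq> 0"
  define w where "w = - 1 - s"
  have s: "s = - w - 1" by (simp add: w_def)
  have "w \<noteq> 0" using A s by (auto simp: exp_minus)
  have "exp (w + Ln w) = exp w * w"
    using \<open>w \<noteq> 0\<close> by (simp add: exp_add)
  also have "\<dots> = - (exp (- 1 - s) * (1 + s))"
    by (simp add: w_def algebra_simps)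
  also have "exp (- 1 - s) * (1 + s) = exp (- 1 - s) * exp s" using A by simp
  also have "\<dots> = exp (- 1)" by (simp flip: exp_add)
  also have "- exp (- 1) = exp (Complex (- 1) pi)"
    by (simp add: Complex_eq exp_diff exp_minus field_simps)
  finally obtain k :: int where k: "w + Ln w = Complex (- 1) pi + of_int (2 * k) * of_real pi * \<i>"
    unfolding exp_eq by auto
  then have W: "W_branch k w" using \<open>w \<noteq> 0\<close> by (simp add: W_branch_def complex_eq_iff algebra_simps)
  have "k \<notin> {- 1, 0}"
  proof
    assume "k \<in> {- 1, 0}"
    then have b: "\<bar>Im w + Im (Ln w)\<bar> = pi" using W_branch_Im[OF W] by auto
    have "Im s \<noteq> 0" using exp_eq_one_plus_real[of s] A by auto
    then have "Im w \<noteq> 0" by (simp add: w_def)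
    moreover have "\<bar>Im (Ln w)\<bar> \<le> pi"
      using Im_Ln_le_pi[OF \<open>w \<noteq> 0\<close>] mpi_less_Im_Ln[OF \<open>w \<noteq> 0\<close>] by simp
    moreover have "0 < Im w \<Longrightarrow> 0 < Im (Ln w)" "Im w < 0 \<Longrightarrow> Im (Ln w) < 0"
      using Im_Ln_pos_lt_imp[of w] Im_Ln_pos_lt[OF \<open>w \<noteq> 0\<close>] Im_Ln_pos_le[OF \<open>w \<noteq> 0\<close>] Im_Ln_le_pi[OF \<open>w \<noteq> 0\<close>] by auto
    ultimately have "\<bar>Im w\<bar> < pi" using b by linarith
    then have "\<bar>Im s\<bar> < pi" by (simp add: w_def)
    then show False using exp_eq_one_plus_real_strip[of s] A \<open>Im s \<noteq> 0\<close> by auto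
  qed
  then show "s \<in> (\<lambda>k. - lambertW k (- 1 / exp 1) - 1) ` (UNIV - {- 1, 0})"
    using lambertW_branch(2)[OF _ W] s by auto
next
  assume "s \<in> (\<lambda>k. - lambertW k (- 1 / exp 1) - 1) ` (UNIV - {- 1, 0})"
  then obtain k where k: "k \<notin> {- 1, 0}" and s: "s = - lambertW k (- 1 / exp 1) - 1" by auto
  define w where "w = lambertW k (- 1 / exp 1)"
  have W: "W_branch k w" unfolding w_def using k by (rule lambertW_branch(1))
  then have "w \<noteq> 0" by (simp add: W_branch_def)
  have "w + Ln w = Complex (- 1) ((2 * of_int k + 1) * pi)" using W by (simp add: W_branch_def)
  also have "\<dots> = Complex (- 1) pi + of_real (of_int (2 * k) * pi) * \<i>"
    by (simp add: complex_eq_iff algebra_simps)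
  finally have "w + Ln w = Complex (- 1) pi + of_real (of_int (2 * k) * pi) * \<i>" .
  then have "exp (w + Ln w) = exp (Complex (- 1) pi)" unfolding exp_eq by blast
  then have "exp w * w = - exp (- 1)" using \<open>w \<noteq> 0\<close> by (simp add: exp_add Complex_eq exp_diff exp_minus field_simps)
  then have "exp s = 1 + s" unfolding s w_def[symmetric] 
    by (simp add: exp_diff exp_minus field_simps)
  moreover have "s \<noteq> 0"
  proof
    assume "s = 0"
    then have "w = - 1" using s unfolding w_def[symmetric] by (metis add.inverse_inverse eq_iff_diff_eq_0)
    then have "pi = (2 * of_int k + 1) * pi" using W_branch_Im[OF W] by simp
    then have "real_of_int (2 * k + 1) = real_of_int 1" by simp
    then have "2 * k + 1 = 1" by (simp only: of_int_eq_iff)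
    with k show False by simp
  qed
  ultimately show "exp s = 1 + s \<and> s \<noteq> 0" by simp
qed

lemma inj_on_lambertW: "inj_on (\<lambda>k. - lambertW k (- 1 / exp 1) - 1) (UNIV - {- 1, 0})"
proof (rule inj_onI)
  fix k l assume k: "k \<in> UNIV - {- 1, 0}" and l: "l \<in> UNIV - {- 1, 0}"
    and "- lambertW k (- 1 / exp 1) - 1 = - lambertW l (- 1 / exp 1) - 1"
  then have eq: "lambertW k (- 1 / exp 1) = lambertW l (- 1 / exp 1)" by simp
  have "(2 * of_int k + 1) * pi = (2 * of_int l + 1) * pi"
    using W_branch_Im[OF lambertW_branch(1)[of k]] W_branch_Im[OF lambertW_branch(1)[of l]] k l unfolding eq by auto
  then show "k = l" by simp
qed

text \<open>
The hypotheses bound the residual of the fixed point equation at \<open>-p + iq\<close>, whose logarithm is written out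
in real terms.  Since the iteration contracts by \<open>1/\<pi> < 1/3\<close>, the distance to the fixed point is at most
\<open>3/2\<close> times the residual, and the residual is at most \<open>2d\<close>.
\<close>
lemma lambertW_approx:
  fixes p q d :: real
  assumes k: "k \<ge> 1" and q: "q \<ge> pi" and "p > 0"
    and re: "\<bar>1 - p + ln (p\<^sup>2 + q\<^sup>2) / 2\<bar> \<le> d"
    and im: "\<bar>q + arctan (p / q) - (2 * of_int k + 1 / 2) * pi\<bar> \<le> d"
  shows "norm (lambertW k (- 1 / exp 1) - Complex (- p) q) \<le> 3 * d"
proof -
  define w z where "w = lambertW k (- 1 / exp 1)" and "z = Complex (- p) q"
  have W: "W_branch k w" unfolding w_def using k by (intro lambertW_branch(1)) auto
  have q0: "q > 0" using q pi_gt_zero by linarith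
  have "z \<noteq> 0" using q0 by (simp add: z_def complex_eq_iff)
  have ReL: "Re (Ln z) = ln (p\<^sup>2 + q\<^sup>2) / 2"
    using \<open>z \<noteq> 0\<close> q0 by (simp add: Re_Ln) (simp add: z_def cmod_def ln_sqrt add_nonneg_pos)
  have "arctan (q / p) = pi / 2 - arctan (p / q)"
    using arctan_inverse[of "p / q"] q0 \<open>p > 0\<close> by simp
  then have ImL: "Im (Ln z) = pi / 2 + arctan (p / q)"
    using q0 \<open>p > 0\<close> by (subst Im_Ln_eq[OF \<open>z \<noteq> 0\<close>]) (simp add: z_def arctan_minus)
  define e where "e = z + Ln z - Complex (- 1) ((2 * of_int k + 1) * pi)"
  have "\<bar>Re e\<bar> \<le> d" using re by (simp add: e_def ReL) (simp add: z_def algebra_simps)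
  moreover have "\<bar>Im e\<bar> \<le> d" using im by (simp add: e_def ImL) (simp add: z_def algebra_simps)
  ultimately have ne: "norm e \<le> 2 * d" using cmod_le[of e] by linarith
  have "w - z = (Ln z - Ln w) - e" using W by (simp add: W_branch_def e_def algebra_simps)
  then have "norm (w - z) \<le> norm (Ln z - Ln w) + norm e" by (metis norm_triangle_ineq4)
  also have "norm (Ln z - Ln w) \<le> norm (z - w) / 3"
    using W_branch_Im_ge[OF k W] q pi_gt3 by (intro norm_Ln_diff_le) (auto simp: z_def)
  finally show ?thesis using ne by (simp add: norm_minus_commute w_def z_def)
qed


section \<open>Two numerical values of the Lambert function\<close>

lemma Re_Im_close:
  assumes "norm (w - Complex a b) \<le> e" 
  shows "\<bar>Re w - a\<bar> \<le> e" "\<bar>Im w - b\<bar> \<le> e"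
  using abs_Re_le_cmod[of "w - Complex a b"] abs_Im_le_cmod[of "w - Complex a b"] assms by simp_all

lemma ln_2_bounds: "ln 2 \<in> {0.69314717..(0.69314719::real)}"
  using ln_approx_bounds[of "2::real" 8] by (simp add: eval_nat_numeral)

text \<open>
The target \<open>-7.46148\<close> for the imaginary part of the first zero differs from the true value by about
\<open>9.3 \<cdot> 10^-6\<close>, so an error well below \<open>7 \<cdot> 10^-7\<close> is needed here.  Powers of 2 are split off
the argument of the logarithm to make its series converge fast.
\<close>
lemma lambertW_1_approx:
  "norm (lambertW 1 (- 1 / exp 1) - Complex (- 3.08884302) 7.46148929) \<le> 3 * (1 / 10 ^ 7)"
proof (rule lambertW_approx)
  have "ln ((3.08884302::real)\<^sup>2 + 7.46148929\<^sup>2) = ln (2 ^ 6 * 1.0189808379216785078125)"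
    by (rule arg_cong[where f = ln]) (simp add: power2_eq_square)
  also have "\<dots> = ln (2 ^ 6) + ln 1.0189808379216785078125" by (rule ln_mult_pos) simp_all
  also have "ln (2 ^ 6 :: real) = 6 * ln 2" by (subst ln_realpow) simp_all
  finally have eq: "ln ((3.08884302::real)\<^sup>2 + 7.46148929\<^sup>2) = 6 * ln 2 + ln 1.0189808379216785078125" .
  have b: "ln (1.0189808379216785078125::real) \<in> {0.01880294..0.01880296}"
    using ln_approx_bounds[of "1.0189808379216785078125::real" 3] by (simp add: eval_nat_numeral)
  have res: "\<bar>1 - 3.08884302 + X / 2\<bar> \<le> 1 / 10 ^ 7"
    if "X = 6 * a + b" "b \<in> {0.01880294..0.01880296}" "a \<in> {0.69314717..0.69314719}" for X a b :: real
    using that unfolding abs_le_iff by (auto simp: field_simps)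
  show "\<bar>1 - 3.08884302 + ln (3.08884302\<^sup>2 + 7.46148929\<^sup>2) / 2\<bar> \<le> (1 / 10 ^ 7 :: real)"
    using res[OF eq b ln_2_bounds] .
  have lo: "0.39249225 \<le> arctan (0.4139713::real)"
    using arctan_bounds(1)[of "0.4139713::real" 4] by (simp add: eval_nat_numeral)
  have hi: "arctan (0.4139714::real) \<le> 0.39249240"
    using arctan_bounds(2)[of "0.4139714::real" 4] by (simp add: eval_nat_numeral)
  have "arctan 0.4139713 \<le> arctan (3.08884302 / 7.46148929)" "arctan (3.08884302 / 7.46148929) \<le> arctan (0.4139714::real)"
    by (simp_all add: arctan_le_iff)
  then have arc: "arctan (3.08884302 / 7.46148929) \<in> {0.39249225..(0.39249240::real)}"
    unfolding atLeastAtMost_iff by (intro conjI order_trans[OF lo] order_trans[OF _ hi])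
  have res2: "\<bar>7.46148929 + A - (2 * of_int 1 + 1 / 2) * P\<bar> \<le> 1 / 10 ^ 7"
    if "A \<in> {0.39249225..0.39249240}" "3.141592653588 \<le> P" "P \<le> 3.1415926535899" for A P :: real
    using that unfolding abs_le_iff by (auto simp: field_simps)
  show "\<bar>7.46148929 + arctan (3.08884302 / 7.46148929) - (2 * of_int 1 + 1 / 2) * pi\<bar> \<le> (1 / 10 ^ 7 :: real)"
    using res2[OF arc pi_approx] .
  show "pi \<le> 7.46148929" using pi_approx by simp
qed simp_all

lemma lambertW_2_approx:
  "norm (lambertW 2 (- 1 / exp 1) - Complex (- 3.66406814) 13.879056) \<le> 3 * (1 / 10 ^ 7)"
proof (rule lambertW_approx)
  have "ln ((3.66406814::real)\<^sup>2 + 13.879056\<^sup>2)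
      = ln (2 ^ 7 * (1.25\<^sup>2 * 1.0302679539284952980))"
    by (rule arg_cong[where f = ln]) (simp add: power2_eq_square)
  also have "\<dots> = ln (2 ^ 7) + ln (1.25\<^sup>2 * 1.0302679539284952980)" by (rule ln_mult_pos) simp_all
  also have "ln (1.25\<^sup>2 * 1.0302679539284952980 :: real) = ln (1.25\<^sup>2) + ln 1.0302679539284952980"
    by (rule ln_mult_pos) simp_all
  also have "ln (2 ^ 7 :: real) = 7 * ln 2" by (subst ln_realpow) simp_all
  also have "ln (1.25\<^sup>2 :: real) = 2 * ln 1.25" by (subst ln_realpow) simp_all
  finally have eq: "ln ((3.66406814::real)\<^sup>2 + 13.879056\<^sup>2)
      = 7 * ln 2 + (2 * ln 1.25 + ln 1.0302679539284952980)" .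
  have b: "ln (1.25::real) \<in> {0.22314355..0.22314356}"
    using ln_approx_bounds[of "1.25::real" 4] by (simp add: eval_nat_numeral)
  have e: "ln (1.0302679539284952980::real) \<in> {0.02981891..0.02981892}"
    using ln_approx_bounds[of "1.0302679539284952980::real" 2] by (simp add: eval_nat_numeral)
  have res: "\<bar>1 - 3.66406814 + X / 2\<bar> \<le> 1 / 10 ^ 7"
    if "X = 7 * a + (2 * b + e)" "b \<in> {0.22314355..0.22314356}" "e \<in> {0.02981891..0.02981892}" 
       "a \<in> {0.69314717..0.69314719}" for X a b e :: real
    using that unfolding abs_le_iff by (auto simp: field_simps)
  show "\<bar>1 - 3.66406814 + ln (3.66406814\<^sup>2 + 13.879056\<^sup>2) / 2\<bar> \<le> (1 / 10 ^ 7 :: real)"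
    using res[OF eq b e ln_2_bounds] .
  have lo: "0.25811090 \<le> arctan (0.2639998::real)"
    using arctan_bounds(1)[of "0.2639998::real" 4] by (simp add: eval_nat_numeral)
  have hi: "arctan (0.2639999::real) \<le> 0.25811103"
    using arctan_bounds(2)[of "0.2639999::real" 4] by (simp add: eval_nat_numeral)
  have "arctan 0.2639998 \<le> arctan (3.66406814 / 13.879056)" "arctan (3.66406814 / 13.879056) \<le> arctan (0.2639999::real)"
    by (simp_all add: arctan_le_iff)
  then have arc: "arctan (3.66406814 / 13.879056) \<in> {0.25811090..(0.25811103::real)}"
    unfolding atLeastAtMost_iff by (intro conjI order_trans[OF lo] order_trans[OF _ hi])
  have res2: "\<bar>13.879056 + A - (2 * of_int 2 + 1 / 2) * P\<bar> \<le> 1 / 10 ^ 7"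
    if "A \<in> {0.25811090..0.25811103}" "3.141592653588 \<le> P" "P \<le> 3.1415926535899" for A P :: real
    using that unfolding abs_le_iff by (auto simp: field_simps)
  show "\<bar>13.879056 + arctan (3.66406814 / 13.879056) - (2 * of_int 2 + 1 / 2) * pi\<bar> \<le> (1 / 10 ^ 7 :: real)"
    using res2[OF arc pi_approx] .
  show "pi \<le> 13.879056" using pi_approx by simp
qed simp_all


section \<open>Persistence of zeros under uniform limits\<close>

text \<open>
On the sphere \<open>|g|\<close> has a positive minimum \<open>m\<close>.  A function within \<open>m/2\<close> of \<open>g\<close> is smaller at the
centre than anywhere on the sphere, and so has a zero inside by the minimum modulus principle.
\<close>
lemma hurwitz_zero_in_ball:
  fixes F :: "'i \<Rightarrow> complex \<Rightarrow> complex"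
  assumes g: "g holomorphic_on UNIV" and F: "\<forall>\<^sub>F i in T. F i holomorphic_on UNIV"
    and ul: "\<And>K. compact K \<Longrightarrow> uniform_limit K F g T"
    and "e > 0" and a: "g a = 0" and nz: "\<And>z. z \<in> cball a e - {a} \<Longrightarrow> g z \<noteq> 0"
  shows "\<forall>\<^sub>F i in T. \<exists>z\<in>ball a e. F i z = 0"
proof -
  have contg: "continuous_on S g" for S
    using g holomorphic_on_imp_continuous_on continuous_on_subset by blast
  have "sphere a e \<noteq> {}" using \<open>e > 0\<close> by simp
  then have "\<exists>x\<in>sphere a e. \<forall>y\<in>sphere a e. norm (g x) \<le> norm (g y)"
    by (intro continuous_attains_inf compact_sphere continuous_on_norm contg)
  then obtain x where x: "x \<in> sphere a e" "\<And>y. y \<in> sphere a e \<Longrightarrow> norm (g x) \<le> norm (g y)"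
    by blast
  define m where "m = norm (g x)"
  have m: "m > 0" using nz[of x] x(1) \<open>e > 0\<close> by (auto simp: m_def)
  have "\<forall>\<^sub>F i in T. \<forall>z\<in>cball a e. dist (F i z) (g z) < m / 2"
    using ul[of "cball a e"] m by (intro uniform_limitD) auto
  then show ?thesis using F
  proof eventually_elim
    case (elim i)
    have "\<exists>z. z \<in> ball a e \<and> F i z = 0"
    proof (rule holomorphic_contract_to_zero[of a e "F i"])
      show "continuous_on (cball a e) (F i)"
        using elim(2) holomorphic_on_imp_continuous_on continuous_on_subset by blast
      show "F i holomorphic_on ball a e" using elim(2) holomorphic_on_subset by blast
      fix z assume "norm (a - z) = e"
      then have z: "z \<in> sphere a e" by (simp add: dist_norm)
      have "norm (F i a) < m / 2" using elim(1) \<open>e > 0\<close> a by (auto dest: bspec[of _ _ a])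
      also have "m / 2 < norm (F i z)"
      proof -
        have "m \<le> norm (g z)" using x(2)[OF z] by (simp add: m_def)
        moreover have "dist (F i z) (g z) < m / 2" using elim(1) z by simp
        ultimately show ?thesis
          using norm_triangle_ineq2[of "g z" "F i z"] by (simp add: dist_norm norm_minus_commute)
      qed
      finally show "norm (F i a) < norm (F i z)" .
    qed (use \<open>e > 0\<close> in auto)
    then show ?case by blast
  qed
qed

lemma isolated_zero_cball:
  assumes g: "g holomorphic_on UNIV" and b: "g b \<noteq> 0"
  shows "\<exists>r>0. \<forall>z\<in>cball a r - {a}. g z \<noteq> 0"
proof (cases "g a = 0")
  case True
  obtain r where "0 < r" "\<And>z. z \<in> ball a r - {a} \<Longrightarrow> g z \<noteq> 0"
    using isolated_zeros[OF g open_UNIV convex_connected[OF convex_UNIV] UNIV_I True UNIV_I b] by metis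
  then show ?thesis by (intro exI[of _ "r / 2"]) auto
next
  case False
  have "isCont g a" using g holomorphic_on_imp_continuous_on continuous_on_eq_continuous_at by blast
  then obtain r where "r > 0" "\<And>z. dist z a < r \<Longrightarrow> g z \<noteq> 0"
    using continuous_at_avoid[of a g 0] False by (metis dist_commute)
  then show ?thesis by (intro exI[of _ "r / 2"]) (auto simp: dist_commute)
qed

text \<open>
Around each of \<open>n\<close> zeros of the limit a ball is chosen that contains no other zero; with half the radii
the balls are disjoint, so the zeros found in them are distinct.
\<close>
lemma hurwitz_infinitely_many:
  fixes F :: "'i \<Rightarrow> complex \<Rightarrow> complex"
  assumes g: "g holomorphic_on UNIV" and F: "\<forall>\<^sub>F i in T. F i holomorphic_on UNIV"
    and ul: "\<And>K. compact K \<Longrightarrow> uniform_limit K F g T"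
    and b: "g b \<noteq> 0" and U: "open U" and inf: "infinite {z \<in> U. g z = 0}"
  shows "\<forall>\<^sub>F i in T. \<exists>Z. finite Z \<and> card Z = n \<and> (\<forall>z\<in>Z. z \<in> U \<and> F i z = 0)"
proof -
  obtain Z0 where Z0: "Z0 \<subseteq> {z \<in> U. g z = 0}" "finite Z0" "card Z0 = n"
    using infinite_arbitrarily_large[OF inf] by metis
  have "\<exists>e>0. ball x e \<subseteq> U \<and> (\<forall>z\<in>cball x e - {x}. g z \<noteq> 0)" if "x \<in> Z0" for x
  proof -
    obtain r where r: "r > 0" "\<forall>z\<in>cball x r - {x}. g z \<noteq> 0"
      using isolated_zero_cball[OF g b] by blast
    have "x \<in> U" using Z0(1) that by auto
    then obtain d where d: "d > 0" "ball x d \<subseteq> U" using U openE by metis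
    show ?thesis using r d by (intro exI[of _ "min r d"]) auto
  qed
  then obtain e where e: "\<And>x. x \<in> Z0 \<Longrightarrow> e x > 0 \<and> ball x (e x) \<subseteq> U \<and> (\<forall>z\<in>cball x (e x) - {x}. g z \<noteq> 0)"
    by metis
  \<comment> \<open>a ball of radius \<open>e x\<close> contains no other point of \<open>Z0\<close>, so half the radius makes the balls disjoint\<close>
  have half: "\<forall>\<^sub>F i in T. \<exists>z\<in>ball x (e x / 2). F i z = 0" if "x \<in> Z0" for x
  proof (rule hurwitz_zero_in_ball[OF g F ul])
    show "e x / 2 > 0" "g x = 0" using that Z0(1) e[OF that] by auto
    fix z assume z: "z \<in> cball x (e x / 2) - {x}"
    then have "dist x z \<le> e x" using e[OF that] by simp
    then show "g z \<noteq> 0" using z e[OF that] by simp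
  qed
  have "\<forall>\<^sub>F i in T. \<forall>x\<in>Z0. \<exists>z\<in>ball x (e x / 2). F i z = 0"
    using half Z0(2) by (simp add: eventually_ball_finite_distrib)
  then show ?thesis
  proof eventually_elim
    case (elim i)
    then obtain z where z: "\<And>x. x \<in> Z0 \<Longrightarrow> z x \<in> ball x (e x / 2) \<and> F i (z x) = 0" by metis
    have "inj_on z Z0"
    proof (rule inj_onI, rule ccontr)
      fix x y assume xy: "x \<in> Z0" "y \<in> Z0" "z x = z y" "x \<noteq> y"
      have "dist x y < e x / 2 + e y / 2"
        using z[OF xy(1)] z[OF xy(2)] xy(3) dist_triangle[of x y "z x"] by (auto simp: dist_commute)
      moreover have "dist x y > e x" "dist x y > e y"
      proof -
        have "y \<notin> cball x (e x) - {x}" "x \<notin> cball y (e y) - {y}"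
          using e[OF xy(1)] e[OF xy(2)] Z0(1) xy(1,2) by blast+
        then show "dist x y > e x" "dist x y > e y" using xy(4) by (auto simp: dist_commute)
      qed
      ultimately show False by linarith
    qed
    then have "card (z ` Z0) = n" using Z0(3) by (simp add: card_image)
    moreover have "\<forall>w\<in>z ` Z0. w \<in> U \<and> F i w = 0"
    proof
      fix w assume "w \<in> z ` Z0"
      then obtain x where x: "x \<in> Z0" "w = z x" by auto
      have "w \<in> ball x (e x)" using z[OF x(1)] e[OF x(1)] x(2) by auto
      then show "w \<in> U \<and> F i w = 0" using e[OF x(1)] z[OF x(1)] x(2) by auto
    qed
    ultimately show ?case using Z0(2) by (intro exI[of _ "z ` Z0"]) auto
  qed
qed

text \<open>
Cauchy's estimate on balls of radius one.
\<close>
lemma uniform_limit_deriv: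
  fixes F :: "'i \<Rightarrow> complex \<Rightarrow> complex"
  assumes g: "g holomorphic_on UNIV" and F: "\<forall>\<^sub>F i in T. F i holomorphic_on UNIV"
    and ul: "\<And>K. compact K \<Longrightarrow> uniform_limit K F g T"
  shows "uniform_limit (cball a e) (\<lambda>i. deriv (F i)) (deriv g) T"
proof (rule uniform_limitI)
  fix d :: real assume "d > 0"
  then have "\<forall>\<^sub>F i in T. \<forall>z\<in>cball a (e + 1). dist (F i z) (g z) < d / 2"
    using ul[of "cball a (e + 1)"] by (intro uniform_limitD) auto
  then show "\<forall>\<^sub>F i in T. \<forall>z\<in>cball a e. dist (deriv (F i) z) (deriv g z) < d"
    using F
  proof eventually_elim
    case (elim i)
    show ?case
    proof
      fix z assume z: "z \<in> cball a e"
      have hol: "(\<lambda>w. F i w - g w) holomorphic_on UNIV" by (intro holomorphic_intros elim g)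
      have "norm ((deriv ^^ 1) (\<lambda>w. F i w - g w) z) \<le> fact 1 * (d / 2) / 1 ^ 1"
      proof (rule Cauchy_inequality)
        show "(\<lambda>w. F i w - g w) holomorphic_on ball z 1" using hol holomorphic_on_subset by blast
        show "continuous_on (cball z 1) (\<lambda>w. F i w - g w)"
          using hol holomorphic_on_imp_continuous_on continuous_on_subset by blast
        fix w assume "norm (z - w) = 1"
        then have "w \<in> cball a (e + 1)" using z dist_triangle[of a w z] by (simp add: dist_norm)
        then show "norm (F i w - g w) \<le> d / 2" using elim(1) by (auto simp: dist_norm less_imp_le)
      qed auto
      moreover have "deriv (\<lambda>w. F i w - g w) z = deriv (F i) z - deriv g z"
        using elim(2) g by (intro deriv_diff) (auto simp: holomorphic_on_def)
      ultimately show "dist (deriv (F i) z) (deriv g z) < d" using \<open>d > 0\<close> by (simp add: dist_norm)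
    qed
  qed
qed

lemma eventually_nonzero_compact:
  fixes F :: "'i \<Rightarrow> complex \<Rightarrow> complex"
  assumes "compact K" "continuous_on K g" "uniform_limit K F g T" "\<And>z. z \<in> K \<Longrightarrow> g z \<noteq> 0"
  shows "\<forall>\<^sub>F i in T. \<forall>z\<in>K. F i z \<noteq> 0"
proof (cases "K = {}")
  case False
  then have "\<exists>x\<in>K. \<forall>y\<in>K. norm (g x) \<le> norm (g y)"
    by (intro continuous_attains_inf continuous_on_norm assms)
  then obtain x where x: "x \<in> K" "\<And>y. y \<in> K \<Longrightarrow> norm (g x) \<le> norm (g y)"
    by blast
  have "norm (g x) > 0" using assms(4)[OF x(1)] by simp
  then have "\<forall>\<^sub>F i in T. \<forall>z\<in>K. dist (F i z) (g z) < norm (g x)"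
    using assms(3) by (intro uniform_limitD)
  then show ?thesis
    by eventually_elim (use x(2) in \<open>force simp: dist_norm\<close>)
qed simp

text \<open>
The ball is chosen such that neither \<open>g\<close> (apart from the centre) nor \<open>g'\<close> vanishes on it.  Then any
selection of zeros in this ball is eventually simple and converges to the centre, since
away from the centre the approximating functions are eventually zero free.
\<close>
lemma hurwitz_simple_zero:
  fixes F :: "'i \<Rightarrow> complex \<Rightarrow> complex"
  assumes g: "g holomorphic_on UNIV" and F: "\<forall>\<^sub>F i in T. F i holomorphic_on UNIV"
    and ul: "\<And>K. compact K \<Longrightarrow> uniform_limit K F g T"
    and a: "g a = 0" and d: "deriv g a \<noteq> 0"
  shows "\<exists>e>0. (\<forall>\<^sub>F i in T. \<exists>z\<in>ball a e. F i z = 0) \<and>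
     (\<forall>\<^sub>F i in T. \<forall>z\<in>ball a e. deriv (F i) z \<noteq> 0) \<and>
     (\<forall>d>0. \<forall>\<^sub>F i in T. \<forall>z\<in>ball a e. F i z = 0 \<longrightarrow> dist z a < d)"
proof -
  have hd: "deriv g holomorphic_on UNIV" using g holomorphic_deriv by blast
  obtain b where b: "g b \<noteq> 0"
  proof (rule ccontr)
    assume "\<not> thesis"
    with that have "g = (\<lambda>_. 0)" by auto
    with d show False by simp
  qed
  obtain r1 where r1: "r1 > 0" "\<forall>z\<in>cball a r1 - {a}. g z \<noteq> 0" using isolated_zero_cball[OF g b] by blast
  obtain r2 where r2: "r2 > 0" "\<forall>z\<in>cball a r2 - {a}. deriv g z \<noteq> 0" using isolated_zero_cball[OF hd d] by blast
  define e where "e = min r1 r2"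
  have e: "e > 0" "\<And>z. z \<in> cball a e - {a} \<Longrightarrow> g z \<noteq> 0" "\<And>z. z \<in> cball a e \<Longrightarrow> deriv g z \<noteq> 0"
    using r1 r2 d by (auto simp: e_def)
  have "\<forall>\<^sub>F i in T. \<exists>z\<in>ball a e. F i z = 0"
    by (rule hurwitz_zero_in_ball[OF g F ul e(1) a e(2)])
  moreover have "\<forall>\<^sub>F i in T. \<forall>z\<in>ball a e. deriv (F i) z \<noteq> 0"
  proof -
    have "\<forall>\<^sub>F i in T. \<forall>z\<in>cball a e. deriv (F i) z \<noteq> 0"
      using hd holomorphic_on_imp_continuous_on continuous_on_subset e(3)
      by (intro eventually_nonzero_compact[OF compact_cball _ uniform_limit_deriv[OF g F ul]]) blast+
    then show ?thesis by eventually_elim auto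
  qed
  moreover have "\<forall>\<^sub>F i in T. \<forall>z\<in>ball a e. F i z = 0 \<longrightarrow> dist z a < d" if "d > 0" for d
  proof -
    have cpt: "compact (cball a e - ball a d)" by (intro compact_diff) auto
    have cont: "continuous_on (cball a e - ball a d) g"
      using g holomorphic_on_imp_continuous_on continuous_on_subset by blast
    have "g z \<noteq> 0" if "z \<in> cball a e - ball a d" for z
      using that \<open>d > 0\<close> by (intro e(2)) auto
    then have "\<forall>\<^sub>F i in T. \<forall>z\<in>cball a e - ball a d. F i z \<noteq> 0"
      by (rule eventually_nonzero_compact[OF cpt cont ul[OF cpt]])
    then show ?thesis by eventually_elim (auto simp: dist_commute not_less)
  qed
  ultimately show ?thesis using e(1) by blast
qed

text \<open>
At a simple real zero a function that is real on the real axis changes sign.  The change of sign persists for the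
approximating functions, and the intermediate value theorem applies.
\<close>
lemma hurwitz_real_zero:
  fixes F :: "'i \<Rightarrow> complex \<Rightarrow> complex" and t e :: real
  assumes g: "g holomorphic_on UNIV" and F: "\<forall>\<^sub>F i in T. F i holomorphic_on UNIV"
    and ul: "\<And>K. compact K \<Longrightarrow> uniform_limit K F g T"
    and a: "g (of_real t) = 0" and d: "deriv g (of_real t) \<noteq> 0" and "e > 0"
    and greal: "\<And>x::real. g (of_real x) \<in> \<real>"
    and Freal: "\<And>i x. P i \<Longrightarrow> F i (of_real (x::real)) \<in> \<real>"
  shows "\<forall>\<^sub>F i in T. P i \<longrightarrow> (\<exists>x::real. (of_real x :: complex) \<in> ball (of_real t) e \<and> F i (of_real x) = 0)"
proof -
  define h where "h = (\<lambda>x::real. Re (g (of_real x)))"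
  have gh: "g (of_real x) = of_real (h x)" for x using greal[of x] by (simp add: h_def)
  have hder: "(h has_real_derivative Re (deriv g (of_real t))) (at t)"
  proof -
    have "(g has_field_derivative deriv g (of_real t)) (at (of_real t))"
      using g holomorphic_derivI[OF g open_UNIV] by blast
    then have "((\<lambda>x. g (of_real x)) has_vector_derivative deriv g (of_real t)) (at t)"
      by (rule has_vector_derivative_real_field)
    then show ?thesis unfolding h_def has_real_derivative_iff_has_vector_derivative
      by (rule bounded_linear.has_vector_derivative[OF bounded_linear_Re])
  qed
  have "deriv g (of_real t) \<in> \<real>"
  proof -
    have "(g has_field_derivative deriv g (of_real t)) (at (of_real t))"
      using g holomorphic_derivI[OF g open_UNIV] by blast
    then have "((\<lambda>x. g (of_real x)) has_vector_derivative deriv g (of_real t)) (at t)"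
      by (rule has_vector_derivative_real_field)
    then have "((\<lambda>x. Im (g (of_real x))) has_vector_derivative Im (deriv g (of_real t))) (at t)"
      by (rule bounded_linear.has_vector_derivative[OF bounded_linear_Im])
    then have "((\<lambda>x. 0::real) has_vector_derivative Im (deriv g (of_real t))) (at t)"
      by (simp add: gh)
    then have "Im (deriv g (of_real t)) = 0" using vector_derivative_unique_at has_vector_derivative_const by metis
    then show ?thesis by (simp add: complex_is_Real_iff)
  qed
  then have D: "Re (deriv g (of_real t)) \<noteq> 0" using d by (metis of_real_Re of_real_0)
  have ht: "h t = 0" using a by (simp add: h_def)
  have "\<exists>x1 x2. t - e < x1 \<and> x1 < x2 \<and> x2 < t + e \<and> h x1 * h x2 < 0"
  proof (cases "Re (deriv g (of_real t)) > 0")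
    case True
    obtain d1 where d1: "d1 > 0" "\<And>k. 0 < k \<Longrightarrow> k < d1 \<Longrightarrow> h t < h (t + k)"
      using has_real_derivative_pos_inc_right[OF hder[THEN has_field_derivative_at_within] True, of UNIV] by auto
    obtain d2 where d2: "d2 > 0" "\<And>k. 0 < k \<Longrightarrow> k < d2 \<Longrightarrow> h (t - k) < h t"
      using has_real_derivative_pos_inc_left[OF hder[THEN has_field_derivative_at_within] True, of UNIV] by auto
    define k where "k = min (min d1 d2) e / 2"
    have k: "0 < k" "k < d1" "k < d2" "k < e" using d1(1) d2(1) \<open>e > 0\<close> by (auto simp: k_def)
    show ?thesis using k d1(2)[of k] d2(2)[of k] ht
      by (intro exI[of _ "t - k"] exI[of _ "t + k"]) (auto simp: mult_neg_pos)
  next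
    case False
    with D have True: "Re (deriv g (of_real t)) < 0" by simp
    obtain d1 where d1: "d1 > 0" "\<And>k. 0 < k \<Longrightarrow> k < d1 \<Longrightarrow> h t > h (t + k)"
      using has_real_derivative_neg_dec_right[OF hder[THEN has_field_derivative_at_within] True, of UNIV] by auto
    obtain d2 where d2: "d2 > 0" "\<And>k. 0 < k \<Longrightarrow> k < d2 \<Longrightarrow> h (t - k) > h t"
      using has_real_derivative_neg_dec_left[OF hder[THEN has_field_derivative_at_within] True, of UNIV] by auto
    define k where "k = min (min d1 d2) e / 2"
    have k: "0 < k" "k < d1" "k < d2" "k < e" using d1(1) d2(1) \<open>e > 0\<close> by (auto simp: k_def)
    show ?thesis using k d1(2)[of k] d2(2)[of k] ht
      by (intro exI[of _ "t - k"] exI[of _ "t + k"]) (auto simp: mult_pos_neg)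
  qed
  then obtain x1 x2 where x: "t - e < x1" "x1 < x2" "x2 < t + e" "h x1 * h x2 < 0" by blast
  have lim: "((\<lambda>i. Re (F i (of_real x))) \<longlongrightarrow> h x) T" for x
    unfolding h_def
    by (intro tendsto_Re tendsto_uniform_limitI[OF ul[of "{of_real x}"]]) simp_all
  have "((\<lambda>i. Re (F i (of_real x1)) * Re (F i (of_real x2))) \<longlongrightarrow> h x1 * h x2) T"
    by (intro tendsto_mult lim)
  then have "\<forall>\<^sub>F i in T. Re (F i (of_real x1)) * Re (F i (of_real x2)) < 0"
    using x(4) by (rule order_tendstoD(2))
  then have "\<forall>\<^sub>F i in T. Re (F i (of_real x1)) * Re (F i (of_real x2)) < 0 \<and> F i holomorphic_on UNIV"
    using F by (rule eventually_conj)
  then show ?thesis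
  proof (rule eventually_mono)
    fix i assume elim': "Re (F i (of_real x1)) * Re (F i (of_real x2)) < 0 \<and> F i holomorphic_on UNIV"
    note elim = elim'[THEN conjunct1] elim'[THEN conjunct2]
    show "P i \<longrightarrow> (\<exists>x::real. (of_real x :: complex) \<in> ball (of_real t) e \<and> F i (of_real x) = 0)"
    proof
      assume "P i"
      define f where "f = (\<lambda>x::real. Re (F i (of_real x)))"
      have "continuous_on {x1..x2} (\<lambda>x. F i (of_real x))"
        by (rule continuous_on_compose2[OF holomorphic_on_imp_continuous_on[OF elim(2)]])
           (auto intro: continuous_on_of_real continuous_on_id)
      then have cont: "continuous_on {x1..x2} f"
        unfolding f_def by (rule continuous_on_Re)
      have "\<exists>x\<ge>x1. x \<le> x2 \<and> f x = 0"
      proof (cases "f x1 < 0")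
        case True
        then have "f x2 > 0" using elim(1) by (simp add: f_def mult_less_0_iff)
        then show ?thesis using IVT'[of f x1 0 x2] True cont x(2) by auto
      next
        case False
        then have "f x2 < 0" "f x1 > 0" using elim(1) by (auto simp: f_def mult_less_0_iff)
        then show ?thesis using IVT2'[of f x2 0 x1] cont x(2) by auto
      qed
      then obtain y where y: "x1 \<le> y" "y \<le> x2" "f y = 0" by blast
      have "F i (of_real y) = of_real (f y)" using Freal[OF \<open>P i\<close>, of y] by (simp add: f_def)
      then show "\<exists>x::real. (of_real x :: complex) \<in> ball (of_real t) e \<and> F i (of_real x) = 0"
        using y x by (intro exI[of _ y]) (auto simp: dist_of_real dist_real_def)
    qed
  qed
qed


section \<open>The Bessel limit function and its zeros\<close>

text \<open>
Polymorphic in order that the same series serves as a real function, for the oscillation argument, and as an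
entire function.
\<close>
definition bessel_coeff :: "nat \<Rightarrow> 'a::{real_normed_field,banach}" where
  "bessel_coeff n = (- 1) ^ n / (2 ^ (n + 1) * fact n * fact (n + 1))"

definition bessel_fun :: "'a::{real_normed_field,banach} \<Rightarrow> 'a" where "bessel_fun s = (\<Sum>n. bessel_coeff n * s ^ n)"

lemma bessel_coeff_of_real: "of_real (bessel_coeff n) = bessel_coeff n" by (simp add: bessel_coeff_def)

lemma summable_bessel_coeff: "summable (\<lambda>n. bessel_coeff n * (s::'a::{real_normed_field,banach}) ^ n)"
proof (rule summable_comparison_test_ev)
  show "summable (\<lambda>n. inverse (fact n) * norm s ^ n)" by (rule summable_exp)
  show "\<forall>\<^sub>F n in sequentially. norm (bessel_coeff n * s ^ n) \<le> inverse (fact n) * norm s ^ n"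
  proof (intro always_eventually allI)
    fix n
    have "1 * (fact n :: real) * 1 \<le> 2 ^ (n + 1) * fact n * fact (n + 1)"
      by (intro mult_mono) (auto simp: fact_ge_1 simp del: fact_Suc power_Suc)
    then have "norm (bessel_coeff n :: 'a) \<le> inverse (fact n)"
      by (simp add: bessel_coeff_def norm_divide norm_mult norm_power inverse_eq_divide frac_le del: fact_Suc power_Suc)
    then show "norm (bessel_coeff n * s ^ n) \<le> inverse (fact n) * norm s ^ n"
      by (simp add: norm_mult norm_power mult_right_mono)
  qed
qed

lemma bessel_quot_eq: "bessel_quot s = bessel_fun s"
  unfolding bessel_quot_def bessel_fun_def by (rule suminf_cong) (simp add: bessel_coeff_def)

lemma bessel_fun_of_real: "bessel_fun (of_real x) = (of_real (bessel_fun x) :: complex)"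
proof -
  have "(\<lambda>n. of_real (bessel_coeff n * x ^ n) :: complex) sums of_real (bessel_fun x)"
    unfolding bessel_fun_def by (intro sums_of_real summable_sums summable_bessel_coeff)
  moreover have "(\<lambda>n. of_real (bessel_coeff n * x ^ n) :: complex) = (\<lambda>n. bessel_coeff n * of_real x ^ n)"
    by (simp add: bessel_coeff_of_real)
  ultimately show ?thesis unfolding bessel_fun_def by (simp add: sums_iff)
qed

lemma bessel_fun_0: "bessel_fun 0 = (1/2 :: 'a::{real_normed_field,banach})"
  unfolding bessel_fun_def by (subst powser_zero) (simp add: bessel_coeff_def)

definition bessel_fun_d1 :: "'a::{real_normed_field,banach} \<Rightarrow> 'a" where "bessel_fun_d1 s = (\<Sum>n. diffs bessel_coeff n * s ^ n)"
definition bessel_fun_d2 :: "'a::{real_normed_field,banach} \<Rightarrow> 'a" where "bessel_fun_d2 s = (\<Sum>n. diffs (diffs bessel_coeff) n * s ^ n)"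

lemma summable_diffs_bessel_coeff:
  "summable (\<lambda>n. diffs bessel_coeff n * (s::'a::{real_normed_field,banach}) ^ n)"
  by (rule termdiff_converges_all) (rule summable_bessel_coeff)

lemma bessel_fun_has_derivative: "(bessel_fun has_field_derivative bessel_fun_d1 s) (at s)"
  unfolding bessel_fun_def[abs_def] bessel_fun_d1_def by (rule termdiffs_strong_converges_everywhere) (rule summable_bessel_coeff)

lemma bessel_fun_d1_has_derivative: "(bessel_fun_d1 has_field_derivative bessel_fun_d2 s) (at s)"
  unfolding bessel_fun_d1_def[abs_def] bessel_fun_d2_def by (rule termdiffs_strong_converges_everywhere) (rule summable_diffs_bessel_coeff)

lemma bessel_fun_d1_of_real: "bessel_fun_d1 (of_real x) = (of_real (bessel_fun_d1 x) :: complex)"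
proof -
  have "(\<lambda>n. of_real (diffs bessel_coeff n * x ^ n) :: complex) sums of_real (bessel_fun_d1 x)"
    unfolding bessel_fun_d1_def by (intro sums_of_real summable_sums summable_diffs_bessel_coeff)
  moreover have "of_real (diffs bessel_coeff n * x ^ n) = (diffs bessel_coeff n * of_real x ^ n :: complex)" for n
    by (simp add: diffs_def bessel_coeff_of_real)
  ultimately have "(\<lambda>n. diffs bessel_coeff n * of_real x ^ n :: complex) sums of_real (bessel_fun_d1 x)" by (simp only:)
  then show ?thesis unfolding bessel_fun_d1_def[of "of_real x"] by (rule sums_unique[symmetric])
qed

lemma bessel_coeff_Suc: "of_nat (n + 1) * of_nat (n + 2) * bessel_coeff (Suc n) = - bessel_coeff n / (2::'a::{real_normed_field,banach})"
proof -
  have "(of_nat (n + 1) :: 'a) \<noteq> 0" "(of_nat (n + 2) :: 'a) \<noteq> 0" by (simp_all only: of_nat_eq_0_iff)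
  moreover have "(fact (Suc n) :: 'a) = of_nat (n + 1) * fact n" "(fact (Suc n + 1) :: 'a) = of_nat (n + 2) * (of_nat (n + 1) * fact n)"
    by (simp_all add: algebra_simps)
  moreover have "(fact (n + 1) :: 'a) = of_nat (n + 1) * fact n" by simp
  ultimately show ?thesis unfolding bessel_coeff_def by (simp only:) (simp add: field_simps del: of_nat_Suc of_nat_add)
qed

text \<open>
Bessel's equation of order one, rewritten for \<open>J_1(x)/x\<close> in the variable \<open>s = x^2/2\<close>.
\<close>
lemma bessel_fun_ode: "s * bessel_fun_d2 s + 2 * bessel_fun_d1 s + bessel_fun s / 2 = (0::'a::{real_normed_field,banach})"
proof -
  have s2: "summable (\<lambda>n. diffs (diffs bessel_coeff) n * s ^ n)"
    by (rule termdiff_converges_all) (rule summable_diffs_bessel_coeff)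
  have "(\<lambda>n. diffs (diffs bessel_coeff) n * s ^ n * s) sums (bessel_fun_d2 s * s)"
    unfolding bessel_fun_d2_def by (intro sums_mult2 summable_sums s2)
  then have "(\<lambda>n. of_nat (Suc n) * diffs bessel_coeff (Suc n) * s ^ Suc n) sums (bessel_fun_d2 s * s)"
    by (simp add: diffs_def mult_ac)
  then have "(\<lambda>n. of_nat n * diffs bessel_coeff n * s ^ n) sums (s * bessel_fun_d2 s)"
    using sums_Suc_iff[of "\<lambda>n. of_nat n * diffs bessel_coeff n * s ^ n" "s * bessel_fun_d2 s"] by (simp add: mult.commute)
  moreover have "(\<lambda>n. 2 * (diffs bessel_coeff n * s ^ n)) sums (2 * bessel_fun_d1 s)"
    unfolding bessel_fun_d1_def by (intro sums_mult summable_sums summable_diffs_bessel_coeff)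
  moreover have "(\<lambda>n. bessel_coeff n * s ^ n / 2) sums (bessel_fun s / 2)"
    unfolding bessel_fun_def by (intro sums_divide summable_sums summable_bessel_coeff)
  ultimately have "(\<lambda>n. of_nat n * diffs bessel_coeff n * s ^ n + 2 * (diffs bessel_coeff n * s ^ n) + bessel_coeff n * s ^ n / 2)
      sums (s * bessel_fun_d2 s + 2 * bessel_fun_d1 s + bessel_fun s / 2)"
    by (intro sums_add)
  moreover have "of_nat n * diffs bessel_coeff n * s ^ n + 2 * (diffs bessel_coeff n * s ^ n) + bessel_coeff n * s ^ n / 2 = 0" for n
  proof -
    have "of_nat n * diffs bessel_coeff n * s ^ n + 2 * (diffs bessel_coeff n * s ^ n) + bessel_coeff n * s ^ n / 2
        = (of_nat (n + 1) * of_nat (n + 2) * bessel_coeff (Suc n) + bessel_coeff n / 2) * s ^ n"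
      by (simp add: diffs_def algebra_simps)
    then show ?thesis unfolding bessel_coeff_Suc by simp
  qed
  ultimately have "(\<lambda>n. 0) sums (s * bessel_fun_d2 s + 2 * bessel_fun_d1 s + bessel_fun s / 2)" by (simp only:)
  then show ?thesis by (rule sums_unique2[OF _ sums_zero])
qed

text \<open>
For \<open>y = t B\<close> the quantity \<open>t y'^2 + y^2/2\<close> has derivative \<open>y'^2\<close>, hence is nondecreasing.  It would vanish at a
multiple zero \<open>x\<close> of \<open>B\<close>, so \<open>y\<close> would vanish on \<open>]0,x]\<close>; but \<open>B\<close> is continuous with \<open>B(0) = 1/2\<close>.
\<close>
lemma bessel_fun_simple_zero:
  fixes x :: real
  assumes "x > 0" "bessel_fun x = 0"
  shows "bessel_fun_d1 x \<noteq> 0"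
proof
  assume B1x: "bessel_fun_d1 x = 0"
  define y' where "y' = (\<lambda>t::real. bessel_fun t + t * bessel_fun_d1 t)"
  \<comment> \<open>the weighted energy of \<open>y = t B\<close>, with \<open>y' = B + t B'\<close>\<close>
  define N where "N = (\<lambda>t::real. t * (y' t)\<^sup>2 + (t * bessel_fun t)\<^sup>2 / 2)"
  have N_deriv: "(N has_real_derivative (y' t)\<^sup>2) (at t)" for t
  proof -
    have "(N has_real_derivative (y' t)\<^sup>2 + 2 * t * y' t * (t * bessel_fun_d2 t + 2 * bessel_fun_d1 t) + t * bessel_fun t * y' t) (at t)"
      unfolding N_def y'_def
      by (auto intro!: derivative_eq_intros bessel_fun_has_derivative bessel_fun_d1_has_derivative simp: power2_eq_square algebra_simps)
    moreover have "t * bessel_fun_d2 t + 2 * bessel_fun_d1 t = - bessel_fun t / 2" using bessel_fun_ode[of t] by simp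
    ultimately show ?thesis by simp
  qed
  have N0: "N t \<le> 0" if "0 \<le> t" "t \<le> x" for t
  proof -
    have "N t \<le> N x" using that(2) N_deriv
      by (intro DERIV_nonneg_imp_nondecreasing[of t x N]) (auto intro!: exI)
    also have "N x = 0" using assms B1x by (simp add: N_def y'_def)
    finally show ?thesis .
  qed
  have zero: "bessel_fun t = 0" if "0 < t" "t \<le> x" for t
  proof -
    have "0 \<le> t * (y' t)\<^sup>2" using that by simp
    then have "(t * bessel_fun t)\<^sup>2 \<le> 0" using N0[of t] that unfolding N_def by linarith
    then show ?thesis using that by simp
  qed
  have "isCont bessel_fun (0::real)" using bessel_fun_has_derivative by (rule DERIV_isCont)
  then have "\<exists>d>0. \<forall>t::real. dist t 0 < d \<longrightarrow> dist (bessel_fun t) (bessel_fun 0) < (1/2::real)"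
    unfolding continuous_at_eps_delta by (elim allE[of _ "1/2"]) simp
  then obtain d where d: "d > 0" "\<And>t::real. dist t 0 < d \<Longrightarrow> dist (bessel_fun t) (bessel_fun 0) < 1/2"
    by blast
  have "dist (bessel_fun (min (d / 2) x)) (bessel_fun 0) < (1/2::real)"
    using d assms by (intro d(2)) (auto simp: dist_real_def)
  moreover have "bessel_fun (min (d / 2) x) = 0" using d assms by (intro zero) auto
  ultimately show False by (simp add: bessel_fun_0 dist_real_def)
qed

text \<open>
Sturm comparison of \<open>y = x B\<close>, which satisfies \<open>y'' = -y/(2x)\<close>, with \<open>v = sin (\<omega>(x - A))\<close>,
\<open>\<omega>^2 = 1/(8A)\<close>.  On \<open>[A,4A]\<close> one has \<open>1/(2x) \<ge> \<omega>^2\<close>, so if \<open>y\<close> kept its sign there, the Wronskian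
\<open>y v' - y' v\<close> (made positive at \<open>A\<close> by the factor \<open>\<sigma>\<close>) would be nondecreasing over the half period \<open>[A, A + \<pi>/\<omega>]\<close>.
But it changes sign from positive to negative.  The half period fits into \<open>[A,4A]\<close> when \<open>8\<pi>^2 \<le> 9A\<close>.
\<close>
lemma bessel_fun_zero_between:
  fixes A :: real
  assumes A: "A \<ge> 9"
  shows "\<exists>x\<in>{A..4*A}. bessel_fun x = 0"
proof (rule ccontr)
  assume no: "\<not> ?thesis"
  have cont: "continuous_on S bessel_fun" for S :: "real set"
    using bessel_fun_has_derivative DERIV_isCont continuous_at_imp_continuous_on by blast
  define \<sigma> :: real where "\<sigma> = sgn (bessel_fun A)"
  have "bessel_fun A \<noteq> 0" using no A by auto
  then have \<sigma>: "\<sigma> = 1 \<or> \<sigma> = - 1" by (auto simp: \<sigma>_def sgn_if)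
  have pos: "\<sigma> * bessel_fun x > 0" if x: "x \<in> {A..4*A}" for x
  proof (rule ccontr)
    assume "\<not> \<sigma> * bessel_fun x > 0"
    moreover have "\<sigma> * bessel_fun A > 0" using \<open>bessel_fun A \<noteq> 0\<close> by (simp add: \<sigma>_def sgn_if)
    moreover have "continuous_on {A..x} (\<lambda>t. \<sigma> * bessel_fun t)" by (intro continuous_intros cont)
    ultimately have "\<exists>t\<ge>A. t \<le> x \<and> \<sigma> * bessel_fun t = 0"
      using x by (intro IVT2') auto
    then show False using no x \<sigma> by auto
  qed
  define \<omega> where "\<omega> = 1 / sqrt (8 * A)"
  have \<omega>: "\<omega> > 0" "\<omega>\<^sup>2 = 1 / (8 * A)" using A by (auto simp: \<omega>_def power_divide)
  define D where "D = pi / \<omega>"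
  have D: "D > 0" using \<omega> by (simp add: D_def)
  have D3: "D \<le> 3 * A"
  proof (rule power2_le_imp_le)
    have "pi \<le> 3.15" using pi_approx by simp
    then have "pi\<^sup>2 \<le> 3.15\<^sup>2" by (intro power_mono) auto
    then have "pi\<^sup>2 * 8 \<le> 9 * A" using A by (simp add: power2_eq_square)
    then have "pi\<^sup>2 * 8 * A \<le> 9 * A * A" using A by (intro mult_right_mono) auto
    moreover have "D\<^sup>2 = pi\<^sup>2 * (8 * A)" using \<omega>(2) A by (simp add: D_def power_divide)
    ultimately show "D\<^sup>2 \<le> (3 * A)\<^sup>2" by (simp add: power2_eq_square)
  qed (use A in auto)
  \<comment> \<open>the Wronskian of \<open>x B\<close> and \<open>sin (\<omega>(x - A))\<close>, with the sign of \<open>B\<close> on the interval\<close>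
  define W where "W = (\<lambda>x. \<sigma> * (x * bessel_fun x * (\<omega> * cos (\<omega> * (x - A))) - (bessel_fun x + x * bessel_fun_d1 x) * sin (\<omega> * (x - A))))"
  have W_deriv: "(W has_real_derivative \<sigma> * bessel_fun x * sin (\<omega> * (x - A)) * (1 / 2 - x * \<omega>\<^sup>2)) (at x)" for x
  proof -
    have "(W has_real_derivative \<sigma> * ((bessel_fun x + x * bessel_fun_d1 x) * (\<omega> * cos (\<omega> * (x - A))) - x * bessel_fun x * (\<omega>\<^sup>2 * sin (\<omega> * (x - A)))
        - ((x * bessel_fun_d2 x + 2 * bessel_fun_d1 x) * sin (\<omega> * (x - A)) + (bessel_fun x + x * bessel_fun_d1 x) * (\<omega> * cos (\<omega> * (x - A)))))) (at x)"
      unfolding W_def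
      by (auto intro!: derivative_eq_intros bessel_fun_has_derivative bessel_fun_d1_has_derivative simp: power2_eq_square algebra_simps)
    moreover have e: "x * bessel_fun_d2 x + 2 * bessel_fun_d1 x = - bessel_fun x / 2" using bessel_fun_ode[of x] by simp
    ultimately show ?thesis unfolding e by (simp add: algebra_simps)
  qed
  have "W A \<le> W (A + D)"
  proof (rule DERIV_nonneg_imp_nondecreasing[of A "A + D" W])
    show "A \<le> A + D" using D by simp
    fix x assume x: "A \<le> x" "x \<le> A + D"
    have "0 \<le> \<sigma> * bessel_fun x" using pos[of x] x D3 by auto
    moreover have "0 \<le> sin (\<omega> * (x - A))"
    proof (rule sin_ge_zero)
      show "0 \<le> \<omega> * (x - A)" using \<omega> x by simp
      have "\<omega> * (x - A) \<le> \<omega> * D" using \<omega> x by (intro mult_left_mono) auto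
      then show "\<omega> * (x - A) \<le> pi" using \<omega> by (simp add: D_def)
    qed
    moreover have "x * \<omega>\<^sup>2 \<le> 4 * A * \<omega>\<^sup>2" using x D3 by (intro mult_right_mono) auto
    then have "0 \<le> 1 / 2 - x * \<omega>\<^sup>2" using \<omega>(2) A by simp
    ultimately have "0 \<le> \<sigma> * bessel_fun x * sin (\<omega> * (x - A)) * (1 / 2 - x * \<omega>\<^sup>2)"
      by (simp only: mult_nonneg_nonneg)
    then show "\<exists>y. (W has_real_derivative y) (at x) \<and> 0 \<le> y"
      using W_deriv[of x] by blast
  qed
  moreover have "W A = A * \<omega> * (\<sigma> * bessel_fun A)" by (simp add: W_def)
  then have "W A > 0" using pos[of A] A \<omega> by simp
  moreover have "\<omega> * D = pi" using \<omega> by (simp add: D_def)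
  then have "W (A + D) = - ((A + D) * \<omega> * (\<sigma> * bessel_fun (A + D)))" by (simp add: W_def)
  then have "W (A + D) < 0" using pos[of "A + D"] A D D3 \<omega> by simp
  ultimately show False by linarith
qed

lemma bessel_J1_eq: "bessel_J 1 z = z * bessel_fun (z\<^sup>2 / 2)"
proof -
  have "(\<lambda>n. z * (bessel_coeff n * (z\<^sup>2 / 2) ^ n)) sums (z * bessel_fun (z\<^sup>2 / 2))"
    unfolding bessel_fun_def by (intro sums_mult summable_sums summable_bessel_coeff)
  moreover have "z * (bessel_coeff n * (z\<^sup>2 / 2) ^ n) = (- 1) ^ n / (fact n * fact (n + 1)) * (z / 2) ^ (2 * n + 1)" for n
  proof -
    have 1: "(z\<^sup>2 / 2) ^ n = z ^ (2 * n) / 2 ^ n"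
      by (simp add: power_divide power_mult)
    have 2: "(z / 2) ^ (2 * n + 1) = z * z ^ (2 * n) / (2 ^ (n + 1) * 2 ^ n)"
    proof -
      have "(2::complex) ^ (2 * n + 1) = 2 ^ (n + 1 + n)" by (rule arg_cong[where f = "power 2"]) simp
      then show ?thesis unfolding power_divide power_add by (simp add: mult_ac)
    qed
    show ?thesis unfolding 1 2 bessel_coeff_def by (simp only: times_divide_eq_right times_divide_eq_left divide_divide_eq_left mult_ac)
  qed
  ultimately show ?thesis unfolding bessel_J_def by (simp add: sums_iff)
qed

lemma bessel_fun_holomorphic: "bessel_fun holomorphic_on (UNIV :: complex set)"
  using bessel_fun_has_derivative by (auto simp: holomorphic_on_def field_differentiable_def intro: has_field_derivative_at_within)

definition J1_zeros :: "real set" where "J1_zeros = {x. x > 0 \<and> bessel_J 1 (of_real x) = 0}"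

lemma J1_zeros_iff: "x \<in> J1_zeros \<longleftrightarrow> x > 0 \<and> bessel_fun (x\<^sup>2 / 2) = 0"
proof -
  have "bessel_J 1 (of_real x) = of_real (x * bessel_fun (x\<^sup>2 / 2))"
    unfolding bessel_J1_eq using bessel_fun_of_real[of "x\<^sup>2 / 2"] by simp
  then show ?thesis by (auto simp: J1_zeros_def)
qed

text \<open>
Zeros of a nonconstant entire function are finite in number on compact sets.
\<close>
lemma finite_J1_zeros_le: "finite {x \<in> J1_zeros. x \<le> M}"
proof -
  have "\<not> (bessel_fun :: complex \<Rightarrow> complex) constant_on UNIV"
  proof
    assume "(bessel_fun :: complex \<Rightarrow> complex) constant_on UNIV"
    then have "bessel_fun (of_real x) = (bessel_fun (0::complex))" for x :: real by (auto simp: constant_on_def)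
    then have "of_real (bessel_fun x) = (of_real (1/2) :: complex)" for x :: real by (simp add: bessel_fun_of_real bessel_fun_0)
    then have half: "bessel_fun x = 1/2" for x :: real by (simp only: of_real_eq_iff)
    obtain x :: real where "bessel_fun x = 0" using bessel_fun_zero_between[of 9] by auto
    with half[of x] show False by simp
  qed
  then have fin: "finite {z \<in> cball 0 (M\<^sup>2 / 2). bessel_fun z = (0::complex)}"
    by (intro holomorphic_compact_finite_zeros[OF bessel_fun_holomorphic]) (auto simp: convex_connected)
  have sub: "(\<lambda>x::real. of_real (x\<^sup>2 / 2)) ` {x \<in> J1_zeros. x \<le> M} \<subseteq> {z \<in> cball 0 (M\<^sup>2 / 2). bessel_fun z = (0::complex)}"
  proof safe
    fix x assume x: "x \<in> J1_zeros" "x \<le> M"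
    then have "x\<^sup>2 \<le> M\<^sup>2" by (intro power_mono) (auto simp: J1_zeros_def)
    then show "(of_real (x\<^sup>2 / 2) :: complex) \<in> cball 0 (M\<^sup>2 / 2)" by (simp del: of_real_power of_real_divide)
    show "bessel_fun (of_real (x\<^sup>2 / 2)) = (0::complex)" using x by (simp add: bessel_fun_of_real J1_zeros_iff del: of_real_divide of_real_power)
  qed
  have "inj_on (\<lambda>x::real. of_real (x\<^sup>2 / 2) :: complex) {x \<in> J1_zeros. x \<le> M}"
  proof (rule inj_onI)
    fix x y assume x: "x \<in> {x \<in> J1_zeros. x \<le> M}" and y: "y \<in> {x \<in> J1_zeros. x \<le> M}"
      and "(of_real (x\<^sup>2 / 2) :: complex) = of_real (y\<^sup>2 / 2)"
    then have "x\<^sup>2 / 2 = y\<^sup>2 / 2" by (simp only: of_real_eq_iff)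
    then show "x = y" using x y by - (rule power2_eq_imp_eq, auto simp: J1_zeros_def)
  qed
  then show ?thesis using sub fin by (rule inj_on_finite)
qed

lemma J1_zeros_unbounded: "\<exists>x\<in>J1_zeros. x > M"
proof -
  define A where "A = max 9 (M\<^sup>2 + 1)"
  obtain s where s: "s \<in> {A..4*A}" "bessel_fun s = 0" using bessel_fun_zero_between[of A] by (auto simp: A_def)
  have s0: "s > 0" "s > M\<^sup>2" using s(1) unfolding A_def by (auto simp: max_def split: if_splits)
  have "M\<^sup>2 < (sqrt (2 * s))\<^sup>2" using s0 by simp
  then have "M < sqrt (2 * s)" by (rule power2_less_imp_less) (use s0 in auto)
  moreover have "sqrt (2 * s) \<in> J1_zeros" using s s0 by (simp add: J1_zeros_iff)
  ultimately show ?thesis by blast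
qed

text \<open>
Each real number has a next larger element of \<open>Z\<close>; iterating from \<open>b\<close> gives the enumeration.  An element that is
never reached would bound infinitely many elements of \<open>Z\<close>.
\<close>
lemma increasing_enumeration:
  fixes Z :: "real set"
  assumes pos: "\<And>x. x \<in> Z \<Longrightarrow> x > b" and fin: "\<And>M. finite {x \<in> Z. x \<le> M}" and unb: "\<And>M. \<exists>x\<in>Z. x > M"
  shows "\<exists>j :: nat \<Rightarrow> real. strict_mono_on {1..} j \<and> j ` {1..} = Z"
proof -
  have "\<exists>z. z \<in> Z \<and> m < z \<and> (\<forall>x\<in>Z. m < x \<longrightarrow> z \<le> x)" for m
  proof -
    obtain x0 where x0: "x0 \<in> Z" "x0 > m" using unb by blast
    define S where "S = {x \<in> {x \<in> Z. x \<le> x0}. m < x}"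
    have S: "finite S" "x0 \<in> S" unfolding S_def using x0 by (auto intro: finite_subset[OF _ fin[of x0]])
    then have "Min S \<in> S" by (intro Min_in) auto
    moreover have "Min S \<le> x" if "x \<in> Z" "m < x" for x
    proof (cases "x \<le> x0")
      case True then show ?thesis using that S(1) by (intro Min_le) (auto simp: S_def)
    next
      case False then show ?thesis using Min_le[OF S] by linarith
    qed
    ultimately show ?thesis by (auto simp: S_def)
  qed
  then obtain nxt where nxt: "\<And>m. nxt m \<in> Z" "\<And>m. m < nxt m" "\<And>m x. x \<in> Z \<Longrightarrow> m < x \<Longrightarrow> nxt m \<le> x"
    by metis
  define j where "j = rec_nat b (\<lambda>_. nxt)"
  have j0: "j 0 = b" and jS: "j (Suc k) = nxt (j k)" for k by (simp_all add: j_def)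
  have mono: "strict_mono j" unfolding strict_mono_Suc_iff by (simp add: jS nxt(2))
  have "j k \<in> Z" if "k \<ge> 1" for k using that by (cases k) (auto simp: jS nxt(1))
  moreover have "\<exists>k\<ge>1. z = j k" if z: "z \<in> Z" for z
  proof (rule ccontr)
    assume no: "\<not> ?thesis"
    have less: "j k < z" for k
    proof (induction k)
      case 0 then show ?case using pos[OF z] j0 by simp
    next
      case (Suc k)
      then have "j (Suc k) \<le> z" unfolding jS using nxt(3) z by blast
      moreover have "j (Suc k) \<noteq> z" using no by auto
      ultimately show ?case by simp
    qed
    have "j (Suc k) \<in> {x \<in> Z. x \<le> z}" for k
      using less[of "Suc k"] nxt(1)[of "j k"] by (simp add: jS less_imp_le)
    then have "range (\<lambda>k. j (Suc k)) \<subseteq> {x \<in> Z. x \<le> z}" by blast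
    then have "finite (range (\<lambda>k. j (Suc k)))" using fin finite_subset by blast
    moreover have "inj (\<lambda>k. j (Suc k))" using strict_mono_imp_inj_on[OF mono] by (auto simp: inj_on_def)
    ultimately show False using finite_imageD by blast
  qed
  ultimately have "j ` {1..} = Z" by fastforce
  moreover have "strict_mono_on {1..} j" using mono by (auto simp: strict_mono_def monotone_on_def)
  ultimately show ?thesis by blast
qed


section \<open>The two limits of the parameter\<close>

lemma norm_sums_le_exp:
  fixes d :: "nat \<Rightarrow> complex"
  assumes "d sums D" "\<And>n. norm (d n) \<le> k * (x ^ n / fact n)"
  shows "norm D \<le> k * exp x"
proof -
  have "(\<lambda>n. x ^ n / fact n) sums exp x"
    using exp_converges[of x] by (simp add: divide_inverse mult.commute)
  then have s: "(\<lambda>n. k * (x ^ n / fact n)) sums (k * exp x)" by (rule sums_mult)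
  have "norm (suminf d) \<le> (\<Sum>n. k * (x ^ n / fact n))"
    using assms(2) sums_summable[OF s] by (rule norm_suminf_le)
  then show ?thesis using s assms(1) by (simp add: sums_iff)
qed

definition small_limit :: "complex \<Rightarrow> complex" where
  "small_limit s = (if s = 0 then 1 / 2 else (1 - (1 + s) * exp (- s)) / s ^ 2)"

text \<open>
Since \<open>(n+1)/(n+2)! = 1/(n+1)! - 1/(n+2)!\<close>, the series is a combination of two tails of the exponential series.
\<close>
lemma small_limit_sums: "(\<lambda>n. (- 1) ^ n / of_nat (n + 2) * (s ^ n / fact n)) sums small_limit s"
proof (cases "s = 0")
  case True
  have "(\<lambda>n. ((- 1) ^ n / of_nat (n + 2) / fact n) * s ^ n) sums (1 / 2)"
    unfolding True using powser_sums_zero[of "\<lambda>n. (- 1) ^ n / of_nat (n + 2) / fact n :: complex"] by simp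
  then show ?thesis using True by (simp add: small_limit_def mult.commute)
next
  case False
  define a where "a = (\<lambda>m. (- s) ^ m / fact m)"
  have a: "a sums exp (- s)"
    using exp_converges[of "- s"] by (simp add: a_def scaleR_conv_of_real divide_inverse mult.commute)
  then have a1: "(\<lambda>n. a (Suc n)) sums (exp (- s) - 1)"
    by (subst sums_Suc_iff) (simp add: a_def)
  then have a2: "(\<lambda>n. a (Suc (Suc n))) sums (exp (- s) - 1 + s)"
    by (subst sums_Suc_iff) (simp add: a_def)
  have "(\<lambda>n. (- s * a (Suc n) - a (Suc (Suc n))) / s ^ 2) sums ((- s * (exp (- s) - 1) - (exp (- s) - 1 + s)) / s ^ 2)"
    by (intro sums_divide sums_diff sums_mult a1 a2)
  moreover have "- s * (exp (- s) - 1) - (exp (- s) - 1 + s) = 1 - (1 + s) * exp (- s)"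
    by (simp add: algebra_simps)
  moreover have "(- s * a (Suc n) - a (Suc (Suc n))) / s ^ 2 = (- 1) ^ n / of_nat (n + 2) * (s ^ n / fact n)" for n
  proof -
    define N where "N = (of_nat n :: complex)"
    have N: "1 + N \<noteq> 0" "2 + N \<noteq> 0"
      unfolding N_def by (metis of_nat_1 of_nat_add of_nat_eq_0_iff add_is_0 one_neq_zero,
          metis of_nat_numeral of_nat_add of_nat_eq_0_iff add_is_0 zero_neq_numeral)
    have "a (Suc n) = - s * (- s) ^ n / ((1 + N) * fact n)"
      "a (Suc (Suc n)) = s ^ 2 * (- s) ^ n / ((2 + N) * ((1 + N) * fact n))"
      unfolding a_def N_def by (simp_all add: power2_eq_square algebra_simps)
    then have "- s * a (Suc n) - a (Suc (Suc n)) = s ^ 2 * (- s) ^ n / fact n * (1 / (1 + N) - 1 / ((2 + N) * (1 + N)))"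
      by (simp add: power2_eq_square algebra_simps)
    also have "1 / (1 + N) - 1 / ((2 + N) * (1 + N)) = 1 / (2 + N)"
    proof -
      have "1 / (1 + N) = (2 + N) / ((2 + N) * (1 + N))" using N by simp
      then have "1 / (1 + N) - 1 / ((2 + N) * (1 + N)) = (2 + N - 1) / ((2 + N) * (1 + N))"
        by (simp only: diff_divide_distrib)
      also have "2 + N - 1 = 1 + N" by simp
      finally show ?thesis using N by simp
    qed
    finally show ?thesis using False by (simp add: N_def power_minus' [of s] power_minus[of s] add.commute)
  qed
  ultimately have "(\<lambda>n. (- 1) ^ n / of_nat (n + 2) * (s ^ n / fact n)) sums ((1 - (1 + s) * exp (- s)) / s ^ 2)"
    by (simp only:)
  then show ?thesis by (simp only: small_limit_def False if_False)
qed

lemma small_limit_zero_iff: "small_limit s = 0 \<longleftrightarrow> exp s = 1 + s \<and> s \<noteq> 0"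
  by (auto simp: small_limit_def exp_minus field_simps)

lemma powser_entire_holomorphic:
  fixes a :: "nat \<Rightarrow> complex"
  assumes "\<And>s. (\<lambda>n. a n * s ^ n) sums f s"
  shows "f holomorphic_on UNIV"
proof -
  have "f = (\<lambda>s. \<Sum>n. a n * s ^ n)" using assms by (auto simp: sums_iff)
  moreover have "((\<lambda>s. \<Sum>n. a n * s ^ n) has_field_derivative (\<Sum>n. diffs a n * s ^ n)) (at s)" for s
    using assms by (intro termdiffs_strong_converges_everywhere) (auto simp: sums_iff)
  ultimately show ?thesis
    by (auto simp: holomorphic_on_def field_differentiable_def intro: has_field_derivative_at_within)
qed

lemma small_limit_holomorphic: "small_limit holomorphic_on UNIV"
proof (rule powser_entire_holomorphic)
  show "(\<lambda>n. ((- 1) ^ n / of_nat (n + 2) / fact n) * s ^ n) sums small_limit s" for s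
    using small_limit_sums[of s] by simp
qed

lemma phi_holomorphic:
  assumes "c > 1" "r > 0"
  shows "phi c r \<alpha> holomorphic_on UNIV"
proof (rule powser_entire_holomorphic)
  show "(\<lambda>n. (exp \<alpha> * (- 1) ^ n * exp_coeff \<alpha> (Suc n) / fact n) * s ^ n) sums phi c r \<alpha> s" for s
    using phi_sums[OF assms, of \<alpha> s] by simp
qed

text \<open>
The coefficient bound is uniform in \<open>n\<close>, so the difference of the two power series is majorised by a multiple of
the exponential series.
\<close>
lemma phi_limit_0_bound:
  assumes "c > 1" "r > 0" "\<alpha> \<noteq> 0" "norm \<alpha> \<le> 1"
  shows "norm (phi c r \<alpha> s / (\<alpha> * exp \<alpha>) - small_limit s) \<le> norm \<alpha> * exp (norm s)"
proof (rule norm_sums_le_exp)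
  show "(\<lambda>n. exp \<alpha> * (- 1) ^ n * exp_coeff \<alpha> (Suc n) * (s ^ n / fact n) / (\<alpha> * exp \<alpha>)
      - (- 1) ^ n / of_nat (n + 2) * (s ^ n / fact n)) sums (phi c r \<alpha> s / (\<alpha> * exp \<alpha>) - small_limit s)"
    by (intro sums_diff sums_divide phi_sums assms small_limit_sums)
  fix n
  have "exp \<alpha> * (- 1) ^ n * exp_coeff \<alpha> (Suc n) * (s ^ n / fact n) / (\<alpha> * exp \<alpha>)
      - (- 1) ^ n / of_nat (n + 2) * (s ^ n / fact n)
      = (exp_coeff \<alpha> (Suc n) / \<alpha> - 1 / of_nat (n + 2)) * ((- 1) ^ n * (s ^ n / fact n))"
    unfolding left_diff_distrib by (simp add: mult_ac)
  then have "norm (exp \<alpha> * (- 1) ^ n * exp_coeff \<alpha> (Suc n) * (s ^ n / fact n) / (\<alpha> * exp \<alpha>)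
      - (- 1) ^ n / of_nat (n + 2) * (s ^ n / fact n))
      = norm (exp_coeff \<alpha> (Suc n) / \<alpha> - 1 / of_nat (n + 2)) * (norm s ^ n / fact n)"
    by (simp only: norm_mult norm_divide norm_power norm_minus_cancel norm_one power_one mult_1 norm_fact)
  also have "\<dots> \<le> norm \<alpha> * (norm s ^ n / fact n)"
    by (intro mult_right_mono exp_coeff_tendsto_0_bound assms) simp
  finally show "norm (exp \<alpha> * (- 1) ^ n * exp_coeff \<alpha> (Suc n) * (s ^ n / fact n) / (\<alpha> * exp \<alpha>)
      - (- 1) ^ n / of_nat (n + 2) * (s ^ n / fact n)) \<le> norm \<alpha> * (norm s ^ n / fact n)" .
qed

lemma phi_limit_infinity_bound:
  assumes "c > 1" "r > 0" "norm \<alpha> \<ge> 1"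
  shows "norm (phi c r \<alpha> (s / \<alpha>) / (\<alpha> * exp \<alpha>) - bessel_fun s) \<le> 1 / norm \<alpha> * exp (norm s)"
proof (rule norm_sums_le_exp)
  have nz: "\<alpha> \<noteq> 0" using assms by auto
  show "(\<lambda>n. exp \<alpha> * (- 1) ^ n * exp_coeff \<alpha> (Suc n) * ((s / \<alpha>) ^ n / fact n) / (\<alpha> * exp \<alpha>)
      - bessel_coeff n * s ^ n) sums (phi c r \<alpha> (s / \<alpha>) / (\<alpha> * exp \<alpha>) - bessel_fun s)"
    unfolding bessel_fun_def by (intro sums_diff sums_divide phi_sums assms summable_sums summable_bessel_coeff)
  fix n
  have "exp \<alpha> * (- 1) ^ n * exp_coeff \<alpha> (Suc n) * ((s / \<alpha>) ^ n / fact n) / (\<alpha> * exp \<alpha>)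
      = exp_coeff \<alpha> (Suc n) / \<alpha> ^ Suc n * ((- 1) ^ n * (s ^ n / fact n))"
    using nz by (simp add: power_divide field_simps)
  moreover have "bessel_coeff n * s ^ n = 1 / (2 ^ Suc n * fact (Suc n)) * ((- 1) ^ n * (s ^ n / fact n))"
    by (simp add: bessel_coeff_def mult_ac del: fact_Suc)
  ultimately have "exp \<alpha> * (- 1) ^ n * exp_coeff \<alpha> (Suc n) * ((s / \<alpha>) ^ n / fact n) / (\<alpha> * exp \<alpha>) - bessel_coeff n * s ^ n
      = (exp_coeff \<alpha> (Suc n) / \<alpha> ^ Suc n - 1 / (2 ^ Suc n * fact (Suc n))) * ((- 1) ^ n * (s ^ n / fact n))"
    by (simp only: left_diff_distrib)
  then have "norm (exp \<alpha> * (- 1) ^ n * exp_coeff \<alpha> (Suc n) * ((s / \<alpha>) ^ n / fact n) / (\<alpha> * exp \<alpha>) - bessel_coeff n * s ^ n)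
      = norm (exp_coeff \<alpha> (Suc n) / \<alpha> ^ Suc n - 1 / (2 ^ Suc n * fact (Suc n))) * (norm s ^ n / fact n)"
    by (simp only: norm_mult norm_divide[of "s ^ n"] norm_power norm_minus_cancel norm_one power_one mult_1 norm_fact)
  also have "\<dots> \<le> 1 / norm \<alpha> * (norm s ^ n / fact n)"
    by (intro mult_right_mono exp_coeff_tendsto_infinity_bound assms) simp
  finally show "norm (exp \<alpha> * (- 1) ^ n * exp_coeff \<alpha> (Suc n) * ((s / \<alpha>) ^ n / fact n) / (\<alpha> * exp \<alpha>)
      - bessel_coeff n * s ^ n) \<le> 1 / norm \<alpha> * (norm s ^ n / fact n)" .
qed

lemma uniform_limit_of_exp_bound:
  fixes F :: "'i \<Rightarrow> complex \<Rightarrow> complex"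
  assumes "compact K" "(k \<longlongrightarrow> 0) T" "\<forall>\<^sub>F i in T. \<forall>s. norm (F i s - g s) \<le> k i * exp (norm s)" 
  shows "uniform_limit K F g T"
proof (rule uniform_limitI)
  fix e :: real assume e: "e > 0"
  obtain M where M: "\<And>s. s \<in> K \<Longrightarrow> norm s \<le> M"
    using compact_imp_bounded[OF assms(1)] by (auto simp: bounded_iff)
  have "((\<lambda>i. \<bar>k i\<bar> * exp M) \<longlongrightarrow> 0) T"
    using assms(2) by (auto intro!: tendsto_eq_intros)
  then have "\<forall>\<^sub>F i in T. \<bar>k i\<bar> * exp M < e" using e by (rule order_tendstoD)
  then show "\<forall>\<^sub>F i in T. \<forall>s\<in>K. dist (F i s) (g s) < e"
    using assms(3)
  proof eventually_elim
    case (elim i)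
    show ?case
    proof
      fix s assume s: "s \<in> K"
      have "norm (F i s - g s) \<le> k i * exp (norm s)" using elim(2) by blast
      also have "\<dots> \<le> \<bar>k i\<bar> * exp M" using M[OF s] by (intro mult_mono) auto
      also have "\<dots> < e" by (rule elim(1))
      finally show "dist (F i s) (g s) < e" by (simp add: dist_norm)
    qed
  qed
qed

lemma uniform_limit_phi_0:
  assumes "c > 1" "r > 0" "compact K"
  shows "uniform_limit K (\<lambda>\<alpha> s. phi c r \<alpha> s / (\<alpha> * exp \<alpha>)) small_limit (at 0)"
proof (rule uniform_limit_of_exp_bound[OF assms(3)])
  show "((\<lambda>\<alpha>::complex. norm \<alpha>) \<longlongrightarrow> 0) (at 0)" by (auto intro!: tendsto_eq_intros)
  show "\<forall>\<^sub>F \<alpha> in at 0. \<forall>s. norm (phi c r \<alpha> s / (\<alpha> * exp \<alpha>) - small_limit s) \<le> norm \<alpha> * exp (norm s)"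
    unfolding eventually_at using phi_limit_0_bound[OF assms(1,2)]
    by (intro exI[of _ 1]) (auto simp: dist_norm)
qed

lemma uniform_limit_phi_infinity:
  assumes "c > 1" "r > 0" "compact K"
  shows "uniform_limit K (\<lambda>\<alpha> s. phi c r \<alpha> (s / \<alpha>) / (\<alpha> * exp \<alpha>)) bessel_fun at_infinity"
proof (rule uniform_limit_of_exp_bound[OF assms(3)])
  have "((\<lambda>\<alpha>::complex. norm (inverse \<alpha>)) \<longlongrightarrow> 0) at_infinity"
    using tendsto_inverse_0 tendsto_norm_zero by blast
  then show "((\<lambda>\<alpha>::complex. 1 / norm \<alpha>) \<longlongrightarrow> 0) at_infinity" by (simp add: norm_divide inverse_eq_divide)
  show "\<forall>\<^sub>F \<alpha> in at_infinity. \<forall>s. norm (phi c r \<alpha> (s / \<alpha>) / (\<alpha> * exp \<alpha>) - bessel_fun s) \<le> 1 / norm \<alpha> * exp (norm s)"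
    unfolding eventually_at_infinity using phi_limit_infinity_bound[OF assms(1,2)] by blast
qed



section \<open>Growth for positive parameters\<close>


text \<open>
Above, the power series is majorised termwise.  Below, the value at \<open>-R\<close> has only positive terms, and
replacing the coefficients by their lower bounds produces the closed form of the limit function for
\<open>\<alpha> \<rightarrow> 0\<close> at \<open>-R\<close>.
\<close>
lemma max_modulus_phi_bounds:
  fixes a R :: real
  assumes cr: "c > 1" "r > 0" and a: "a > 0" and R: "R \<ge> 2"
    and C: "\<And>n. exp_coeff a n \<le> C * q ^ n" and q: "q > 1"
  shows "max_modulus (phi c r (of_real a)) R \<le> (exp a * C * q) * exp (q * R)"
    and "(exp a * a) * exp R / R\<^sup>2 \<le> max_modulus (phi c r (of_real a)) R"
proof -
  have "norm (phi c r (of_real a) z) \<le> (exp a * C * q) * exp (q * R)" if z: "z \<in> sphere 0 R" for z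
  proof (rule norm_sums_le_exp[OF phi_sums[OF cr]])
    fix n
    have "norm (exp_coeff (of_real a :: complex) (Suc n)) \<le> C * q ^ Suc n"
      using C[of "Suc n"] exp_coeff_nonneg[of a "Suc n"] a by (simp add: exp_coeff_of_real)
    then have "exp a * norm (exp_coeff (of_real a :: complex) (Suc n)) * (R ^ n / fact n) \<le> exp a * (C * q ^ Suc n) * (R ^ n / fact n)"
      using R by (intro mult_right_mono mult_left_mono) auto
    then show "norm (exp (of_real a) * (- 1) ^ n * exp_coeff (of_real a) (Suc n) * (z ^ n / fact n)) \<le> exp a * C * q * ((q * R) ^ n / fact n)"
      using z by (simp add: norm_mult norm_divide norm_power power_mult_distrib mult_ac)
  qed
  then have ub: "\<And>w. w \<in> (\<lambda>z. norm (phi c r (of_real a) z)) ` sphere 0 R \<Longrightarrow> w \<le> (exp a * C * q) * exp (q * R)" by auto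
  have ne: "sphere (0::complex) R \<noteq> {}" using R by simp
  show "max_modulus (phi c r (of_real a)) R \<le> (exp a * C * q) * exp (q * R)"
    unfolding max_modulus_def using ne ub by (intro cSup_least) auto
  have in_sphere: "- of_real R \<in> sphere (0::complex) R" using R by simp
  have le: "norm (phi c r (of_real a) (- of_real R)) \<le> max_modulus (phi c r (of_real a)) R"
    unfolding max_modulus_def using ub in_sphere by (intro cSUP_upper bdd_aboveI) auto
  define b where "b = (\<lambda>n. exp a * exp_coeff a (Suc n) * (R ^ n / fact n))"
  have sgn: "(- 1) ^ n * (- of_real R) ^ n = (of_real (R ^ n) :: complex)" for n
    unfolding power_mult_distrib[symmetric] by simp
  have perm: "e * x * k * (y / d) = e * k * (x * y / d)" "x / m * (y / d) = 1 / m * (x * y / d)" for e x k y d m :: complex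
    by simp_all
  have "exp (of_real a) * (- 1) ^ n * exp_coeff (of_real a) (Suc n) * ((- of_real R) ^ n / fact n) = (of_real (b n) :: complex)" for n
    unfolding perm(1) sgn b_def exp_coeff_of_real exp_of_real by simp
  then have "(\<lambda>n. exp (of_real a) * (- 1) ^ n * exp_coeff (of_real a) (Suc n) * ((- of_real R) ^ n / fact n)) = (\<lambda>n. of_real (b n) :: complex)"
    by (rule ext)
  then have sumsb: "(\<lambda>n. of_real (b n)) sums phi c r (of_real a) (- of_real R)"
    using phi_sums[OF cr, of "of_real a" "- of_real R"] by (simp only:)
  then have sumsRe: "b sums Re (phi c r (of_real a) (- of_real R))"
    by (drule_tac sums_Re) simp
  have "small_limit (- of_real R) = of_real ((1 + (R - 1) * exp R) / R\<^sup>2)"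
    using R by (simp add: small_limit_def exp_of_real algebra_simps)
  then have "(\<lambda>n. (- 1) ^ n / of_nat (n + 2) * ((- of_real R) ^ n / fact n)) sums (of_real ((1 + (R - 1) * exp R) / R\<^sup>2) :: complex)"
    using small_limit_sums[of "- of_real R"] by (simp only:)
  then have "(\<lambda>n. Re ((- 1) ^ n / of_nat (n + 2) * ((- of_real R) ^ n / fact n))) sums ((1 + (R - 1) * exp R) / R\<^sup>2)"
    by (drule_tac sums_Re) (simp only: Re_complex_of_real)
  moreover have "Re ((- 1) ^ n / of_nat (n + 2) * ((- of_real R) ^ n / fact n)) = 1 / real (n + 2) * (R ^ n / fact n)" for n
  proof -
    have "(- 1) ^ n / of_nat (n + 2) * ((- of_real R) ^ n / fact n) = (of_real (1 / real (n + 2) * (R ^ n / fact n)) :: complex)"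
      unfolding perm(2)[of "(- 1) ^ n" "of_nat (n + 2)" "(- of_real R) ^ n" "fact n"] sgn by simp
    then show ?thesis by (simp only: Re_complex_of_real)
  qed
  ultimately have L: "(\<lambda>n. 1 / real (n + 2) * (R ^ n / fact n)) sums ((1 + (R - 1) * exp R) / R\<^sup>2)" by (simp only:)
  have "(\<lambda>n. exp a * a * (1 / real (n + 2) * (R ^ n / fact n))) sums (exp a * a * ((1 + (R - 1) * exp R) / R\<^sup>2))"
    using L by (rule sums_mult)
  then have "exp a * a * ((1 + (R - 1) * exp R) / R\<^sup>2) \<le> Re (phi c r (of_real a) (- of_real R))"
  proof (rule sums_le[rotated])
    fix n
    have "exp a * (a / real (n + 2)) * (R ^ n / fact n) \<le> exp a * exp_coeff a (Suc n) * (R ^ n / fact n)"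
      using exp_coeff_ge[of a n] a R by (intro mult_right_mono mult_left_mono) auto
    then show "exp a * a * (1 / real (n + 2) * (R ^ n / fact n)) \<le> b n" by (simp add: b_def)
  qed (rule sumsRe)
  moreover have "(exp a * a) * exp R / R\<^sup>2 \<le> exp a * a * ((1 + (R - 1) * exp R) / R\<^sup>2)"
  proof -
    have "1 * exp R \<le> (R - 1) * exp R" using R by (intro mult_right_mono) auto
    then have "exp R \<le> 1 + (R - 1) * exp R" by linarith
    then have "exp a * a * (exp R / R\<^sup>2) \<le> exp a * a * ((1 + (R - 1) * exp R) / R\<^sup>2)"
      using a by (intro mult_left_mono divide_right_mono) auto
    then show ?thesis by simp
  qed
  ultimately show "(exp a * a) * exp R / R\<^sup>2 \<le> max_modulus (phi c r (of_real a)) R"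
    using le complex_Re_le_cmod[of "phi c r (of_real a) (- of_real R)"] by linarith
qed

text \<open>
The lower bound yields \<open>R - 2 log R\<close> and the upper bound \<open>qR\<close> up to constants, with \<open>q > 1\<close> arbitrary.
\<close>
lemma ln_max_modulus_phi:
  fixes a :: real
  assumes cr: "c > 1" "r > 0" and a: "a > 0"
  shows "((\<lambda>R. ln (max_modulus (phi c r (of_real a)) R) / R) \<longlongrightarrow> 1) at_top"
proof (rule order_tendstoI)
  define M where "M = max_modulus (phi c r (of_real a))"
  have lower: "M R > 0 \<and> a + ln a + R - 2 * ln R \<le> ln (M R)" if R: "R \<ge> 2" for R
  proof -
    obtain C where C: "\<And>n. exp_coeff a n \<le> C * 2 ^ n" using exp_coeff_geometric_bound[of a 2] a by auto
    have lb: "(exp a * a) * exp R / R\<^sup>2 \<le> M R"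
      unfolding M_def using max_modulus_phi_bounds(2)[OF cr a R C] by simp
    have pos: "0 < (exp a * a) * exp R / R\<^sup>2" using a R by simp
    have "ln ((exp a * a) * exp R / R\<^sup>2) = a + ln a + R - 2 * ln R"
      using a R by (simp add: ln_mult ln_div ln_realpow)
    then show ?thesis using lb pos ln_mono[OF lb pos] by simp
  qed
  fix u :: real
  show "\<forall>\<^sub>F R in at_top. u < ln (max_modulus (phi c r (of_real a)) R) / R" if u: "u < 1"
  proof -
    have "((\<lambda>R. (a + ln a) / R + 1 - 2 * (ln R / R)) \<longlongrightarrow> 0 + 1 - 2 * 0) at_top"
      by (intro tendsto_add tendsto_diff tendsto_mult tendsto_const ln_x_over_x_tendsto_0
          real_tendsto_divide_at_top[OF tendsto_const filterlim_ident])
    then have "\<forall>\<^sub>F R in at_top. u < (a + ln a) / R + 1 - 2 * (ln R / R)"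
      using u by (intro order_tendstoD) auto
    then show ?thesis using eventually_ge_at_top[of 2]
    proof eventually_elim
      case (elim R)
      have "(a + ln a) / R + 1 - 2 * (ln R / R) = (a + ln a + R - 2 * ln R) / R"
        using elim(2) by (simp add: field_simps)
      also have "\<dots> \<le> ln (M R) / R" using lower[OF elim(2)] elim(2) by (intro divide_right_mono) auto
      finally show ?case using elim(1) by (simp add: M_def)
    qed
  qed
  show "\<forall>\<^sub>F R in at_top. ln (max_modulus (phi c r (of_real a)) R) / R < u" if u: "u > 1"
  proof -
    define q where "q = (1 + u) / 2"
    have q: "q > 1" "q < u" using u by (auto simp: q_def)
    obtain C where C0: "C > 0" and C: "\<And>n. exp_coeff a n \<le> C * q ^ n" using exp_coeff_geometric_bound[of a q] a q by auto
    have "((\<lambda>R. (a + ln (C * q)) / R + q) \<longlongrightarrow> 0 + q) at_top"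
      by (intro tendsto_add tendsto_const real_tendsto_divide_at_top[OF tendsto_const filterlim_ident])
    then have "\<forall>\<^sub>F R in at_top. (a + ln (C * q)) / R + q < u"
      using q by (intro order_tendstoD) auto
    then show ?thesis using eventually_ge_at_top[of 2]
    proof eventually_elim
      case (elim R)
      have "M R \<le> (exp a * C * q) * exp (q * R)"
        unfolding M_def by (rule max_modulus_phi_bounds(1)[OF cr a elim(2) C q(1)])
      then have "ln (M R) \<le> ln ((exp a * C * q) * exp (q * R))"
        using lower[OF elim(2)] by (intro ln_mono) auto
      also have "\<dots> = a + ln (C * q) + q * R"
        using C0 q by (simp add: ln_mult)
      finally have "ln (M R) / R \<le> (a + ln (C * q) + q * R) / R"
        using elim(2) by (intro divide_right_mono) auto
      also have "\<dots> = (a + ln (C * q)) / R + q" using elim(2) by (simp add: field_simps)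
      finally show ?case using elim(1) by (simp add: M_def)
    qed
  qed
qed

text \<open>
If \<open>log M(R) = R h(R)\<close> with \<open>h \<rightarrow> 1\<close>, then \<open>log log M(R) / log R = 1 + log h(R) / log R\<close>.
\<close>
lemma order_and_type_1:
  fixes g :: "complex \<Rightarrow> complex"
  assumes lim: "((\<lambda>R. ln (max_modulus g R) / R) \<longlongrightarrow> 1) at_top"
  shows "entire_order g = 1" "entire_type g = 1"
proof -
  define h where "h = (\<lambda>R. ln (max_modulus g R) / R)"
  have h: "(h \<longlongrightarrow> 1) at_top" using lim by (simp add: h_def)
  have "((\<lambda>R. ln (h R) / ln R) \<longlongrightarrow> 0) at_top"
    using h by (intro real_tendsto_divide_at_top[of _ "ln 1"] tendsto_ln ln_at_top) auto
  then have "((\<lambda>R. 1 + ln (h R) / ln R) \<longlongrightarrow> 1 + 0) at_top" by (intro tendsto_intros)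
  moreover have "\<forall>\<^sub>F R in at_top. 1 + ln (h R) / ln R = ln (ln (max_modulus g R)) / ln R"
  proof -
    have "\<forall>\<^sub>F R in at_top. 0 < h R" using h by (rule order_tendstoD) simp
    then show ?thesis using eventually_gt_at_top[of 1]
    proof eventually_elim
      case (elim R)
      have "ln (max_modulus g R) = R * h R" using elim by (simp add: h_def)
      then show ?case using elim by (simp add: ln_mult add_divide_distrib)
    qed
  qed
  ultimately have "((\<lambda>R. ln (ln (max_modulus g R)) / ln R) \<longlongrightarrow> 1) at_top"
    using tendsto_cong by force
  then have "((\<lambda>R. ereal (ln (ln (max_modulus g R)) / ln R)) \<longlongrightarrow> ereal 1) at_top"
    by (rule tendsto_ereal)
  then show ord: "entire_order g = 1"
    unfolding entire_order_def one_ereal_def by (intro lim_imp_Limsup) auto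
  have "\<forall>\<^sub>F R in at_top. ereal (h R) = ereal (ln (max_modulus g R) / R powr real_of_ereal (entire_order g))"
    using eventually_gt_at_top[of 0] by eventually_elim (simp add: h_def ord)
  moreover have "((\<lambda>R. ereal (h R)) \<longlongrightarrow> ereal 1) at_top" using h by (rule tendsto_ereal)
  ultimately have "((\<lambda>R. ereal (ln (max_modulus g R) / R powr real_of_ereal (entire_order g))) \<longlongrightarrow> ereal 1) at_top"
    by (rule Lim_transform_eventually[rotated])
  then show "entire_type g = 1"
    unfolding entire_type_def one_ereal_def by (intro lim_imp_Limsup) auto
qed


section \<open>Zeros of the transform\<close>

lemma phi_real:
  assumes "c > 1" "r > 0"
  shows "phi c r (of_real a) (of_real x) \<in> \<real>"
proof -
  have "exp (of_real a) * (- 1) ^ n * exp_coeff (of_real a) (Suc n) * (of_real x ^ n / fact n)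
      = (of_real (exp a * (- 1) ^ n * exp_coeff a (Suc n) * (x ^ n / fact n)) :: complex)" for n
    by (simp add: exp_coeff_of_real exp_of_real)
  then have "(\<lambda>n. of_real (exp a * (- 1) ^ n * exp_coeff a (Suc n) * (x ^ n / fact n))) sums phi c r (of_real a) (of_real x)"
    using phi_sums[OF assms, of "of_real a" "of_real x"] by (simp only:)
  then have "(\<lambda>n. Im (of_real (exp a * (- 1) ^ n * exp_coeff a (Suc n) * (x ^ n / fact n)))) sums Im (phi c r (of_real a) (of_real x))"
    by (rule sums_Im)
  then have "(\<lambda>n. 0) sums Im (phi c r (of_real a) (of_real x))" by (simp only: Im_complex_of_real)
  then have "Im (phi c r (of_real a) (of_real x)) = 0" using sums_unique2[OF _ sums_zero] by blast
  then show ?thesis by (simp add: complex_is_Real_iff)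
qed

text \<open>
The zeros of the rescaled function near \<open>j_k^2/2\<close> are selected in the balls supplied by
\<open>hurwitz_simple_zero\<close>, real ones being preferred when \<open>\<alpha> > 0\<close>.  They converge to \<open>j_k^2/2\<close> whatever the
selection.  Dividing by \<open>\<alpha>\<close> undoes the rescaling, and the strict order of the limits gives the strict order of the moduli.
\<close>
lemma phi_zeros_large:
  fixes j :: "nat \<Rightarrow> real"
  assumes cr: "c > 1" "r > 0"
    and mono: "strict_mono_on {1..} j" and j: "j ` {1..} = J1_zeros"
  shows "\<exists>s :: nat \<Rightarrow> complex \<Rightarrow> complex.
           (\<forall>\<^sub>F \<alpha> in at_infinity.
              (\<forall>k\<in>{1..n}. simple_zero (phi c r \<alpha>) (s k \<alpha>) \<and> 0 < norm (s k \<alpha>)) \<and>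
              strict_mono_on {1..n} (\<lambda>k. norm (s k \<alpha>)) \<and>
              (\<alpha> \<in> \<real> \<and> Re \<alpha> > 0 \<longrightarrow> (\<forall>k\<in>{1..n}. s k \<alpha> \<in> \<real> \<and> Re (s k \<alpha>) > 0))) \<and>
           (\<forall>k\<in>{1..n}. ((\<lambda>\<alpha>. \<alpha> * s k \<alpha>) \<longlongrightarrow> of_real ((j k)\<^sup>2 / 2)) at_infinity)"
proof -
  define \<Phi> where "\<Phi> = (\<lambda>\<alpha> s. phi c r \<alpha> (s / \<alpha>) / (\<alpha> * exp \<alpha>))"
  define t where "t = (\<lambda>k. (j k)\<^sup>2 / 2)"
  define P where "P = (\<lambda>\<alpha>::complex. \<alpha> \<in> \<real> \<and> Re \<alpha> > 0)"
  have ul: "uniform_limit K \<Phi> bessel_fun at_infinity" if "compact K" for K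
    unfolding \<Phi>_def by (rule uniform_limit_phi_infinity[OF cr that])
  have ev0: "\<forall>\<^sub>F \<alpha>::complex in at_infinity. \<alpha> \<noteq> 0"
    unfolding eventually_at_infinity by (intro exI[of _ 1]) auto
  have hol: "\<Phi> \<alpha> holomorphic_on UNIV" if "\<alpha> \<noteq> 0" for \<alpha>
  proof -
    have "(phi c r \<alpha> \<circ> (\<lambda>s. s / \<alpha>)) holomorphic_on UNIV"
      by (intro holomorphic_on_compose_gen[of _ _ _ UNIV] phi_holomorphic[OF cr] holomorphic_intros) (use that in auto)
    then have "(\<lambda>s. phi c r \<alpha> (s / \<alpha>)) holomorphic_on UNIV" by (simp add: comp_def)
    then show ?thesis unfolding \<Phi>_def using that by (intro holomorphic_on_divide holomorphic_on_const) auto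
  qed
  have evhol: "\<forall>\<^sub>F \<alpha> in at_infinity. \<Phi> \<alpha> holomorphic_on UNIV"
    using ev0 by eventually_elim (rule hol)
  have jZ: "j k \<in> J1_zeros" if "k \<ge> 1" for k using that j by auto
  have t_pos: "t k > 0" if "k \<ge> 1" for k using jZ[OF that] by (simp add: t_def J1_zeros_def)
  have t_mono: "t k < t l" if "k \<ge> 1" "k < l" for k l
  proof -
    have "j k < j l" using mono that by (auto simp: monotone_on_def)
    moreover have "j k > 0" using jZ[OF that(1)] by (simp add: J1_zeros_def)
    ultimately show ?thesis by (simp add: t_def power_strict_mono)
  qed
  have Bt: "bessel_fun (t k) = 0" if "k \<ge> 1" for k using jZ[OF that] by (simp add: t_def J1_zeros_iff)
  have Bt': "bessel_fun (of_real (t k) :: complex) = 0" if "k \<ge> 1" for k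
    using Bt[OF that] by (simp add: bessel_fun_of_real)
  have Bd: "deriv bessel_fun (of_real (t k) :: complex) \<noteq> 0" if "k \<ge> 1" for k
    using bessel_fun_simple_zero[OF t_pos[OF that] Bt[OF that]]
    by (simp add: DERIV_imp_deriv[OF bessel_fun_has_derivative] bessel_fun_d1_of_real)
  have "\<forall>k\<in>{1..}. \<exists>e>0. (\<forall>\<^sub>F i in at_infinity. \<exists>z\<in>ball (of_real (t k)) e. \<Phi> i z = 0) \<and>
     (\<forall>\<^sub>F i in at_infinity. \<forall>z\<in>ball (of_real (t k)) e. deriv (\<Phi> i) z \<noteq> 0) \<and>
     (\<forall>d>0. \<forall>\<^sub>F i in at_infinity. \<forall>z\<in>ball (of_real (t k)) e. \<Phi> i z = 0 \<longrightarrow> dist z (of_real (t k)) < d)"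
    using hurwitz_simple_zero[OF bessel_fun_holomorphic evhol ul Bt' Bd] by auto
  then obtain e where e: "\<And>k. k \<ge> 1 \<Longrightarrow> e k > 0"
    and ex: "\<And>k. k \<ge> 1 \<Longrightarrow> \<forall>\<^sub>F i in at_infinity. \<exists>z\<in>ball (of_real (t k)) (e k). \<Phi> i z = 0"
    and dv: "\<And>k. k \<ge> 1 \<Longrightarrow> \<forall>\<^sub>F i in at_infinity. \<forall>z\<in>ball (of_real (t k)) (e k). deriv (\<Phi> i) z \<noteq> 0"
    and cl: "\<And>k d. k \<ge> 1 \<Longrightarrow> d > 0 \<Longrightarrow> \<forall>\<^sub>F i in at_infinity. \<forall>z\<in>ball (of_real (t k)) (e k). \<Phi> i z = 0 \<longrightarrow> dist z (of_real (t k)) < d"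
    unfolding bchoice_iff by auto
  have Preal: "\<Phi> \<alpha> (of_real x) \<in> \<real>" if "P \<alpha>" for \<alpha> x
  proof -
    have "\<alpha> \<in> \<real>" using that by (simp add: P_def)
    then obtain a where a: "\<alpha> = of_real a" by (rule Reals_cases)
    have "phi c r (of_real a) (of_real (x / a)) \<in> \<real>" by (rule phi_real[OF cr])
    then show ?thesis unfolding \<Phi>_def a by (simp add: exp_of_real)
  qed
  have exr: "\<forall>\<^sub>F \<alpha> in at_infinity. P \<alpha> \<longrightarrow> (\<exists>x::real. (of_real x :: complex) \<in> ball (of_real (t k)) (e k) \<and> \<Phi> \<alpha> (of_real x) = 0)"
    if k: "k \<ge> 1" for k
    by (rule hurwitz_real_zero[OF bessel_fun_holomorphic evhol ul Bt'[OF k] Bd[OF k] e[OF k] _ Preal])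
       (simp_all add: bessel_fun_of_real)
  define Q where "Q = (\<lambda>k \<alpha> z. z \<in> ball (of_real (t k)) (e k) \<and> \<Phi> \<alpha> z = 0)"
  \<comment> \<open>where no zero lies in the ball the value is arbitrary; this happens only for bounded \<open>\<alpha>\<close>\<close>
  define \<sigma> where "\<sigma> = (\<lambda>k \<alpha>. if \<exists>x::real. P \<alpha> \<and> Q k \<alpha> (of_real x)
      then of_real (SOME x::real. Q k \<alpha> (of_real x)) else (SOME z. Q k \<alpha> z))"
  have \<sigma>Q: "\<forall>\<^sub>F \<alpha> in at_infinity. Q k \<alpha> (\<sigma> k \<alpha>)" if k: "k \<ge> 1" for k
    using ex[OF k]
  proof eventually_elim
    case (elim \<alpha>)
    then have "\<exists>z. Q k \<alpha> z" by (auto simp: Q_def)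
    then have 1: "Q k \<alpha> (SOME z. Q k \<alpha> z)" by (rule someI_ex)
    have 2: "Q k \<alpha> (of_real (SOME x::real. Q k \<alpha> (of_real x)))" if "\<exists>x::real. Q k \<alpha> (of_real x)"
      using someI_ex[OF that] .
    show ?case using 1 2 by (auto simp: \<sigma>_def)
  qed
  have \<sigma>real: "\<forall>\<^sub>F \<alpha> in at_infinity. P \<alpha> \<longrightarrow> \<sigma> k \<alpha> \<in> \<real>" if k: "k \<ge> 1" for k
    using exr[OF k] by eventually_elim (auto simp: \<sigma>_def Q_def)
  have \<sigma>lim: "(\<sigma> k \<longlongrightarrow> of_real (t k)) at_infinity" if k: "k \<ge> 1" for k
  proof (rule tendstoI)
    fix d :: real assume "d > 0"
    show "\<forall>\<^sub>F \<alpha> in at_infinity. dist (\<sigma> k \<alpha>) (of_real (t k)) < d"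
      using cl[OF k \<open>d > 0\<close>] \<sigma>Q[OF k] by eventually_elim (auto simp: Q_def)
  qed
  define s where "s = (\<lambda>k \<alpha>. \<sigma> k \<alpha> / \<alpha>)"
  have simple: "simple_zero (phi c r \<alpha>) (s k \<alpha>)"
    if nz: "\<alpha> \<noteq> 0" and zero: "\<Phi> \<alpha> (\<sigma> k \<alpha>) = 0" and d: "deriv (\<Phi> \<alpha>) (\<sigma> k \<alpha>) \<noteq> 0" for k \<alpha>
    unfolding simple_zero_def
  proof
    show "phi c r \<alpha> (s k \<alpha>) = 0" using zero nz by (simp add: \<Phi>_def s_def)
    show "deriv (phi c r \<alpha>) (s k \<alpha>) \<noteq> 0"
    proof
      assume 0: "deriv (phi c r \<alpha>) (s k \<alpha>) = 0"
      have "(phi c r \<alpha> has_field_derivative 0) (at (\<sigma> k \<alpha> / \<alpha>))"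
        using holomorphic_derivI[OF phi_holomorphic[OF cr, of \<alpha>] open_UNIV UNIV_I, of "s k \<alpha>"] 0 by (simp add: s_def)
      moreover have "((\<lambda>w. w / \<alpha>) has_field_derivative (1 / \<alpha>)) (at (\<sigma> k \<alpha>))"
        using nz by (auto intro!: derivative_eq_intros)
      ultimately have "((\<lambda>w. phi c r \<alpha> (w / \<alpha>)) has_field_derivative 0 * (1 / \<alpha>)) (at (\<sigma> k \<alpha>))"
        by (rule DERIV_chain2)
      then have "(\<Phi> \<alpha> has_field_derivative 0 * (1 / \<alpha>) / (\<alpha> * exp \<alpha>)) (at (\<sigma> k \<alpha>))"
        unfolding \<Phi>_def by (rule DERIV_cdivide)
      then have "deriv (\<Phi> \<alpha>) (\<sigma> k \<alpha>) = 0" by (simp add: DERIV_imp_deriv)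
      with d show False by simp
    qed
  qed
  have good: "\<forall>\<^sub>F \<alpha> in at_infinity. \<alpha> \<noteq> 0 \<and> simple_zero (phi c r \<alpha>) (s k \<alpha>) \<and> 0 < norm (s k \<alpha>) \<and>
      (P \<alpha> \<longrightarrow> s k \<alpha> \<in> \<real> \<and> Re (s k \<alpha>) > 0)" if k: "k \<ge> 1" for k
  proof -
    have "\<forall>\<^sub>F \<alpha> in at_infinity. 0 < Re (\<sigma> k \<alpha>)"
      using tendsto_Re[OF \<sigma>lim[OF k]] t_pos[OF k] by (intro order_tendstoD(1)) auto
    then show ?thesis using ev0 dv[OF k] \<sigma>Q[OF k] \<sigma>real[OF k]
    proof eventually_elim
      case (elim \<alpha>)
      have Q: "\<sigma> k \<alpha> \<in> ball (of_real (t k)) (e k)" "\<Phi> \<alpha> (\<sigma> k \<alpha>) = 0" using elim(4) by (auto simp: Q_def)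
      have "simple_zero (phi c r \<alpha>) (s k \<alpha>)" using elim(2,3) Q by (intro simple) auto
      moreover have "\<sigma> k \<alpha> \<noteq> 0" using elim(1) by auto
      then have "0 < norm (s k \<alpha>)" using elim(2) by (simp add: s_def)
      moreover have "s k \<alpha> \<in> \<real> \<and> Re (s k \<alpha>) > 0" if "P \<alpha>"
      proof -
        have "\<alpha> \<in> \<real>" "Re \<alpha> > 0" using that by (simp_all add: P_def)
        then obtain a where a: "\<alpha> = of_real a" "a > 0" by (elim Reals_cases) simp
        have "\<sigma> k \<alpha> \<in> \<real>" using elim(5) that by blast
        then obtain x where x: "\<sigma> k \<alpha> = of_real x" by (rule Reals_cases)
        have "s k \<alpha> = of_real (x / a)" unfolding s_def x by (simp add: a)
        moreover have "x / a > 0" using elim(1) a(2) by (simp add: x)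
        ultimately show ?thesis by (simp only: Reals_of_real Re_complex_of_real)
      qed
      ultimately show ?case using elim(2) by blast
    qed
  qed
  have mono_s: "\<forall>\<^sub>F \<alpha> in at_infinity. norm (s k \<alpha>) < norm (s l \<alpha>)" if kl: "k \<ge> 1" "k < l" for k l
  proof -
    have l: "l \<ge> 1" using kl by simp
    have "((\<lambda>\<alpha>. norm (\<sigma> l \<alpha>) - norm (\<sigma> k \<alpha>)) \<longlongrightarrow> norm (of_real (t l) :: complex) - norm (of_real (t k) :: complex)) at_infinity"
      by (intro tendsto_diff tendsto_norm \<sigma>lim kl l)
    moreover have "0 < norm (of_real (t l) :: complex) - norm (of_real (t k) :: complex)"
      using t_mono[OF kl] t_pos[OF kl(1)] by simp
    ultimately have "\<forall>\<^sub>F \<alpha> in at_infinity. 0 < norm (\<sigma> l \<alpha>) - norm (\<sigma> k \<alpha>)" by (rule order_tendstoD(1))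
    then show ?thesis using ev0 by eventually_elim (simp add: s_def norm_divide divide_strict_right_mono)
  qed
  show ?thesis
  proof (intro exI[of _ s] conjI ballI)
    have "\<forall>\<^sub>F \<alpha> in at_infinity. \<forall>k\<in>{1..n}. \<alpha> \<noteq> 0 \<and> simple_zero (phi c r \<alpha>) (s k \<alpha>) \<and> 0 < norm (s k \<alpha>) \<and>
      (P \<alpha> \<longrightarrow> s k \<alpha> \<in> \<real> \<and> Re (s k \<alpha>) > 0)"
      using good by (intro eventually_ball_finite) auto
    moreover have "\<forall>\<^sub>F \<alpha> in at_infinity. \<forall>k\<in>{1..n}. \<forall>l\<in>{1..n}. k < l \<longrightarrow> norm (s k \<alpha>) < norm (s l \<alpha>)"
    proof (intro eventually_ball_finite ballI)
      fix k l assume "k \<in> {1..n}" "l \<in> {1..n}"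
      then show "\<forall>\<^sub>F \<alpha> in at_infinity. k < l \<longrightarrow> norm (s k \<alpha>) < norm (s l \<alpha>)"
        using mono_s[of k l] by (cases "k < l") auto
    qed auto
    ultimately show "\<forall>\<^sub>F \<alpha> in at_infinity.
              (\<forall>k\<in>{1..n}. simple_zero (phi c r \<alpha>) (s k \<alpha>) \<and> 0 < norm (s k \<alpha>)) \<and>
              strict_mono_on {1..n} (\<lambda>k. norm (s k \<alpha>)) \<and>
              (\<alpha> \<in> \<real> \<and> Re \<alpha> > 0 \<longrightarrow> (\<forall>k\<in>{1..n}. s k \<alpha> \<in> \<real> \<and> Re (s k \<alpha>) > 0))"
    proof eventually_elim
      case (elim \<alpha>)
      have "strict_mono_on {1..n} (\<lambda>k. norm (s k \<alpha>))"
        unfolding monotone_on_def using elim(2) by blast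
      then show ?case using elim(1) unfolding P_def by blast
    qed
  next
    fix k assume "k \<in> {1..n}"
    then have k: "k \<ge> 1" by simp
    have "\<forall>\<^sub>F \<alpha> in at_infinity. \<sigma> k \<alpha> = \<alpha> * s k \<alpha>"
      using ev0 by eventually_elim (simp add: s_def)
    then show "((\<lambda>\<alpha>. \<alpha> * s k \<alpha>) \<longlongrightarrow> of_real ((j k)\<^sup>2 / 2)) at_infinity"
      using \<sigma>lim[OF k] unfolding t_def by (rule Lim_transform_eventually[rotated])
  qed
qed

text \<open>
Hurwitz's theorem in the open set of non-real numbers, which contains all zeros of the limit.
\<close>
lemma phi_nonreal_zeros:
  assumes cr: "c > 1" "r > 0"
    and real: "\<And>s. s \<in> \<real> \<Longrightarrow> small_limit s \<noteq> 0" and inf: "infinite {s. small_limit s = 0}"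
  shows "\<forall>\<^sub>F \<alpha> in at 0. \<exists>Z. finite Z \<and> card Z = n \<and> (\<forall>s\<in>Z. s \<notin> \<real> \<and> phi c r \<alpha> s = 0)"
proof -
  define \<Phi> where "\<Phi> = (\<lambda>\<alpha> s. phi c r \<alpha> s / (\<alpha> * exp \<alpha>))"
  have ev: "\<forall>\<^sub>F \<alpha>::complex in at 0. \<alpha> \<noteq> 0" by (simp add: eventually_at_filter)
  have "\<forall>\<^sub>F \<alpha> in at 0. \<Phi> \<alpha> holomorphic_on UNIV"
    using ev by eventually_elim (auto simp: \<Phi>_def intro!: holomorphic_on_divide phi_holomorphic[OF cr])
  moreover have "uniform_limit K \<Phi> small_limit (at 0)" if "compact K" for K
    unfolding \<Phi>_def by (rule uniform_limit_phi_0[OF cr that])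
  moreover have "small_limit 0 \<noteq> 0" by (simp add: small_limit_def)
  moreover have "open (- \<real> :: complex set)" using closed_complex_Reals by (simp add: open_Compl)
  moreover have "{z \<in> - \<real>. small_limit z = 0} = {s. small_limit s = 0}" using real by auto
  ultimately have "\<forall>\<^sub>F \<alpha> in at 0. \<exists>Z. finite Z \<and> card Z = n \<and> (\<forall>z\<in>Z. z \<in> - \<real> \<and> \<Phi> \<alpha> z = 0)"
    using inf by (intro hurwitz_infinitely_many[OF small_limit_holomorphic]) simp_all
  then show ?thesis using ev
    by eventually_elim (auto simp: \<Phi>_def)
qed



section \<open>Proof of the theorem\<close>

theorem theorem1p3:
  fixes c r :: real and L :: "complex \<Rightarrow> complex" and \<xi> :: "int \<Rightarrow> complex"
  assumes c: "c > 1" and r: "r > 0"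
  defines "L \<equiv> (\<lambda>s. \<Sum>n. (- 1) ^ n / of_nat (n + 2) * (s ^ n / fact n))"
    and "\<xi> \<equiv> (\<lambda>k. - lambertW k (- 1 / exp 1) - 1)"
  shows
    "entire2 (phi c r)
     \<and>
     \<comment> \<open>(i)\<close>
     (\<forall>K. compact K \<longrightarrow> uniform_limit K (\<lambda>\<alpha> s. phi c r \<alpha> s / (\<alpha> * exp \<alpha>)) L (at 0)) \<and>
     (\<forall>s::complex. (\<lambda>n. (- 1) ^ n / of_nat (n + 2) * (s ^ n / fact n)) sums
        (if s = 0 then 1 / 2 else (1 - (1 + s) * exp (- s)) / s ^ 2)) \<and>
     (\<forall>s \<in> \<real>. L s \<noteq> 0) \<and>
     infinite {s. L s = 0} \<and>
     {s. L s = 0} = \<xi> ` (UNIV - {- 1, 0}) \<and>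
     \<xi> 1 = cnj (\<xi> (- 2)) \<and>
     \<bar>Re (\<xi> 1) - 2.08884\<bar> < 1 / 10 ^ 5 \<and> \<bar>Im (\<xi> 1) - (- 7.46148)\<bar> < 1 / 10 ^ 5 \<and>
     \<xi> 2 = cnj (\<xi> (- 3)) \<and>
     \<bar>Re (\<xi> 2) - 2.66406\<bar> < 1 / 10 ^ 5 \<and> \<bar>Im (\<xi> 2) - (- 13.87905)\<bar> < 1 / 10 ^ 5
     \<and>
     \<comment> \<open>(ii)\<close>
     (\<forall>n::nat. \<forall>\<^sub>F \<alpha> in at 0. \<exists>Z. finite Z \<and> card Z = n \<and> (\<forall>s\<in>Z. s \<notin> \<real> \<and> phi c r \<alpha> s = 0))
     \<and>
     \<comment> \<open>(iii)\<close>
     (\<forall>K. compact K \<longrightarrow>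
        uniform_limit K (\<lambda>\<alpha> s. phi c r \<alpha> (s / \<alpha>) / (\<alpha> * exp \<alpha>)) bessel_quot at_infinity)
     \<and>
     \<comment> \<open>(iv)\<close>
     (\<exists>j :: nat \<Rightarrow> real.
        strict_mono_on {1..} j \<and> j ` {1..} = {x. x > 0 \<and> bessel_J 1 (of_real x) = 0} \<and>
        (\<forall>n::nat. \<exists>s :: nat \<Rightarrow> complex \<Rightarrow> complex.
           (\<forall>\<^sub>F \<alpha> in at_infinity.
              (\<forall>k\<in>{1..n}. simple_zero (phi c r \<alpha>) (s k \<alpha>) \<and> 0 < norm (s k \<alpha>)) \<and>
              strict_mono_on {1..n} (\<lambda>k. norm (s k \<alpha>)) \<and>
              (\<alpha> \<in> \<real> \<and> Re \<alpha> > 0 \<longrightarrow> (\<forall>k\<in>{1..n}. s k \<alpha> \<in> \<real> \<and> Re (s k \<alpha>) > 0))) \<and>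
           (\<forall>k\<in>{1..n}. ((\<lambda>\<alpha>. \<alpha> * s k \<alpha>) \<longlongrightarrow> of_real ((j k)\<^sup>2 / 2)) at_infinity)))
     \<and>
     \<comment> \<open>(v)\<close>
     (\<forall>a::real. a > 0 \<longrightarrow>
        entire_order (phi c r (of_real a)) = 1 \<and> entire_type (phi c r (of_real a)) = 1)"
proof -
  have L: "L = small_limit"
    unfolding L_def using sums_unique[OF small_limit_sums] by (intro ext) (rule sym)
  have closed_form: "\<forall>s::complex. (\<lambda>n. (- 1) ^ n / of_nat (n + 2) * (s ^ n / fact n)) sums
        (if s = 0 then 1 / 2 else (1 - (1 + s) * exp (- s)) / s ^ 2)"
    using small_limit_sums unfolding small_limit_def by blast
  have unif0: "\<forall>K. compact K \<longrightarrow> uniform_limit K (\<lambda>\<alpha> s. phi c r \<alpha> s / (\<alpha> * exp \<alpha>)) L (at 0)"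
    unfolding L using uniform_limit_phi_0[OF c r] by blast
  have real: "\<forall>s\<in>\<real>. L s \<noteq> 0"
    unfolding L small_limit_zero_iff using exp_eq_one_plus_real by (auto simp: complex_is_Real_iff)
  have zeros: "{s. L s = 0} = \<xi> ` (UNIV - {- 1, 0})"
    unfolding L small_limit_zero_iff exp_eq_one_plus_iff_lambertW \<xi>_def by simp
  have inf: "infinite {s. L s = 0}"
    using finite_imageD[OF _ inj_on_lambertW] infinite_UNIV_int unfolding zeros \<xi>_def by force
  have xi1: "\<xi> 1 = cnj (\<xi> (- 2))" and xi2: "\<xi> 2 = cnj (\<xi> (- 3))"
    unfolding \<xi>_def using lambertW_cnj[of "- 2"] lambertW_cnj[of "- 3"] by simp_all
  have approx1: "\<bar>Re (\<xi> 1) - 2.08884\<bar> < 1 / 10 ^ 5" "\<bar>Im (\<xi> 1) - (- 7.46148)\<bar> < 1 / 10 ^ 5"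
    using Re_Im_close[OF lambertW_1_approx] unfolding \<xi>_def abs_le_iff abs_less_iff by simp_all
  have approx2: "\<bar>Re (\<xi> 2) - 2.66406\<bar> < 1 / 10 ^ 5" "\<bar>Im (\<xi> 2) - (- 13.87905)\<bar> < 1 / 10 ^ 5"
    using Re_Im_close[OF lambertW_2_approx] unfolding \<xi>_def abs_le_iff abs_less_iff by simp_all
  have nonreal: "\<forall>n::nat. \<forall>\<^sub>F \<alpha> in at 0. \<exists>Z. finite Z \<and> card Z = n \<and> (\<forall>s\<in>Z. s \<notin> \<real> \<and> phi c r \<alpha> s = 0)"
    using real inf unfolding L by (intro allI phi_nonreal_zeros[OF c r]) auto
  have bessel: "bessel_quot = bessel_fun" using bessel_quot_eq by (rule ext)
  have unif_inf: "\<forall>K. compact K \<longrightarrow>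
        uniform_limit K (\<lambda>\<alpha> s. phi c r \<alpha> (s / \<alpha>) / (\<alpha> * exp \<alpha>)) bessel_quot at_infinity"
    unfolding bessel using uniform_limit_phi_infinity[OF c r] by blast
  obtain j :: "nat \<Rightarrow> real" where j: "strict_mono_on {1..} j" "j ` {1..} = J1_zeros"
    using increasing_enumeration[of J1_zeros 0] finite_J1_zeros_le J1_zeros_unbounded
    by (auto simp: J1_zeros_def)
  have large: "\<exists>j :: nat \<Rightarrow> real.
        strict_mono_on {1..} j \<and> j ` {1..} = {x. x > 0 \<and> bessel_J 1 (of_real x) = 0} \<and>
        (\<forall>n::nat. \<exists>s :: nat \<Rightarrow> complex \<Rightarrow> complex.
           (\<forall>\<^sub>F \<alpha> in at_infinity.
              (\<forall>k\<in>{1..n}. simple_zero (phi c r \<alpha>) (s k \<alpha>) \<and> 0 < norm (s k \<alpha>)) \<and>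
              strict_mono_on {1..n} (\<lambda>k. norm (s k \<alpha>)) \<and>
              (\<alpha> \<in> \<real> \<and> Re \<alpha> > 0 \<longrightarrow> (\<forall>k\<in>{1..n}. s k \<alpha> \<in> \<real> \<and> Re (s k \<alpha>) > 0))) \<and>
           (\<forall>k\<in>{1..n}. ((\<lambda>\<alpha>. \<alpha> * s k \<alpha>) \<longlongrightarrow> of_real ((j k)\<^sup>2 / 2)) at_infinity))"
  proof (intro exI[of _ j], intro conjI)
    show "strict_mono_on {1..} j" by (rule j(1))
    show "j ` {1..} = {x. x > 0 \<and> bessel_J 1 (of_real x) = 0}" using j(2) unfolding J1_zeros_def .
  qed (rule allI, rule phi_zeros_large[OF c r j])
  have order_type: "\<forall>a::real. a > 0 \<longrightarrow>
        entire_order (phi c r (of_real a)) = 1 \<and> entire_type (phi c r (of_real a)) = 1"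
    using order_and_type_1[OF ln_max_modulus_phi[OF c r]] by blast
  show ?thesis
    using entire2_phi[OF c r] unif0 closed_form real inf zeros xi1 approx1 xi2 approx2 nonreal unif_inf large order_type
    by (intro conjI)
qed

end
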